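(* Let $\alpha\in(0,1)$ and $b_0>0$, and put $b_{2k-1}=b_{2k}=k^{\alpha}$ for $k=1,2,3,\ldots$. Let $A$ be the self-adjoint operator in $\ell^2(\mathbb{N}_0)$ generated by the Jacobi matrix with zero main diagonal and off-diagonal entries $b_0,b_1,b_2,\ldots$, and let $\mu$ be its spectral measure with respect to the first basis vector $e_0$. Then the spectral density of $A$ is equivalent to (that is, coincides Lebesgue-almost everywhere with) a positive continuous function everywhere except possibly at the point $x=0$. Explicitly: there exists a continuous function $f:\mathbb{R}\setminus\{0\}\to(0,\infty)$ such that $$\mu(B)=\int_B f(x)\,dx\qquad\text{for every Borel set } B\subset\mathbb{R}\setminus\{0\}.$$
   Context: Let $\{e_n\}_{n\ge 0}$ be the standard orthonormal basis of $\ell^2(\mathbb{N}_0)$. The Jacobi matrix with zero diagonal and off-diagonal weights $b_n>0$ is $$\left(\begin{array}{ccccc} 0&b_0&0&0&\ldots\\ b_0&0&b_1&0&\ldots\\ 0&b_1&0&b_2&\ldots\\ 0&0&b_2&0&\ldots\\ \vdots&\vdots&\vdots&\vdots&\ddots\end{array}\right).$$ It acts on finitely supported sequences by $Ae_0=b_0e_1$ and $Ae_n=b_{n-1}e_{n-1}+b_ne_{n+1}$ for $n\ge1$. For the weights $b_{2k-1}=b_{2k}=k^\alpha$, $k\ge1$, with $b_0>0$ and $\alpha\in(0,1)$, this symmetric operator is essentially self-adjoint, and $A$ denotes its (unbounded) self-adjoint closure. The spectral measure is $\mu(B)=\langle E(B)e_0,e_0\rangle$ for Borel $B\subset\mathbb{R}$,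 where $E$ is the projection-valued spectral measure of $A$. The spectral density of $A$ is the density of $\mu$ with respect to Lebesgue measure. *)

theory Defs
  imports "HOL-Analysis.Analysis"
begin

text \<open>The Hilbert space of square-summable complex sequences is represented by a carrier set
  of functions on the natural numbers; the inner product is linear in its first argument.\<close>

definition ell2 :: "(nat \<Rightarrow> complex) set" where
  "ell2 = {x. summable (\<lambda>n. (cmod (x n))\<^sup>2)}"

definition ell2_inner :: "(nat \<Rightarrow> complex) \<Rightarrow> (nat \<Rightarrow> complex) \<Rightarrow> complex" where
  "ell2_inner x y = (\<Sum>n. x n * cnj (y n))"

definition ell2_norm :: "(nat \<Rightarrow> complex) \<Rightarrow> real" where
  "ell2_norm x = sqrt (\<Sum>n. (cmod (x n))\<^sup>2)"

definition ell2_lim :: "(nat \<Rightarrow> nat \<Rightarrow> complex) \<Rightarrow> (nat \<Rightarrow> complex) \<Rightarrow> bool" where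
  "ell2_lim u x \<longleftrightarrow>
     (\<forall>k. u k \<in> ell2) \<and> x \<in> ell2 \<and> (\<lambda>k. ell2_norm (\<lambda>n. u k n - x n)) \<longlonglongrightarrow> 0"

definition basis_vec :: "nat \<Rightarrow> nat \<Rightarrow> complex" where
  "basis_vec k = (\<lambda>n. if n = k then 1 else 0)"


text \<open>Unbounded operators are represented by their graphs, so that \<open>Domain\<close> is the operator
  domain.\<close>

type_synonym operator_graph = "((nat \<Rightarrow> complex) \<times> (nat \<Rightarrow> complex)) set"

definition jacobi_apply :: "(nat \<Rightarrow> real) \<Rightarrow> (nat \<Rightarrow> complex) \<Rightarrow> nat \<Rightarrow> complex" where
  "jacobi_apply b u n =
     (if n = 0 then 0 else of_real (b (n - 1)) * u (n - 1)) + of_real (b n) * u (Suc n)"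

lemma jacobi_apply_basis_vec_0:
  "jacobi_apply b (basis_vec 0) = (\<lambda>n. of_real (b 0) * basis_vec 1 n)"
  by (auto simp: jacobi_apply_def basis_vec_def fun_eq_iff)

lemma jacobi_apply_basis_vec:
  "k \<ge> 1 \<Longrightarrow> jacobi_apply b (basis_vec k) =
     (\<lambda>n. of_real (b (k - 1)) * basis_vec (k - 1) n + of_real (b k) * basis_vec (k + 1) n)"
  by (auto simp: jacobi_apply_def basis_vec_def fun_eq_iff)

definition jacobi_finite :: "(nat \<Rightarrow> real) \<Rightarrow> operator_graph" where
  "jacobi_finite b = {(u, jacobi_apply b u) | u. finite {n. u n \<noteq> 0}}"

definition op_closure :: "operator_graph \<Rightarrow> operator_graph" where
  "op_closure G = {(x, y). \<exists>u v. (\<forall>k. (u k, v k) \<in> G) \<and> ell2_lim u x \<and> ell2_lim v y}"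

definition jacobi_operator :: "(nat \<Rightarrow> real) \<Rightarrow> operator_graph" where
  "jacobi_operator b = op_closure (jacobi_finite b)"


text \<open>Linearity and boundedness of a map are automatic from its being symmetric and everywhere
  defined, so symmetry and idempotence say that it is an orthogonal projection.\<close>

definition orth_projection :: "((nat \<Rightarrow> complex) \<Rightarrow> (nat \<Rightarrow> complex)) \<Rightarrow> bool" where
  "orth_projection P \<longleftrightarrow>
     (\<forall>x\<in>ell2. P x \<in> ell2 \<and> P (P x) = P x) \<and>
     (\<forall>x\<in>ell2. \<forall>y\<in>ell2. ell2_inner (P x) y = ell2_inner x (P y))"

definition projection_valued_measure ::
    "(real set \<Rightarrow> (nat \<Rightarrow> complex) \<Rightarrow> (nat \<Rightarrow> complex)) \<Rightarrow> bool" where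
  "projection_valued_measure E \<longleftrightarrow>
     (\<forall>B\<in>sets borel. orth_projection (E B)) \<and>
     (\<forall>x\<in>ell2. E UNIV x = x) \<and>
     (\<forall>B\<in>sets borel. \<forall>C\<in>sets borel. \<forall>x\<in>ell2. E (B \<inter> C) x = E B (E C x)) \<and>
     (\<forall>B :: nat \<Rightarrow> real set. range B \<subseteq> sets borel \<longrightarrow> disjoint_family B \<longrightarrow>
        (\<forall>x\<in>ell2. ell2_lim (\<lambda>N n. \<Sum>i<N. E (B i) x n) (E (\<Union>i. B i) x)))"

text \<open>The measure \<open>B \<mapsto> \<langle>E(B)x, x\<rangle>\<close>.\<close>

definition spectral_measure ::
    "(real set \<Rightarrow> (nat \<Rightarrow> complex) \<Rightarrow> (nat \<Rightarrow> complex)) \<Rightarrow> (nat \<Rightarrow> complex) \<Rightarrow> real measure" where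
  "spectral_measure E x =
     measure_of UNIV (sets borel) (\<lambda>B. ennreal (Re (ell2_inner (E B x) x)))"

text \<open>\<open>E\<close> is the projection-valued spectral measure of \<open>A\<close>, that is \<open>A = \<integral> t dE(t)\<close> in the usual
  sense of the functional calculus: the domain consists of the \<open>x\<close> with
  \<open>\<integral> t\<^sup>2 d\<langle>E(t)x, x\<rangle> < \<infinity>\<close>, and \<open>\<langle>Ax, x\<rangle> = \<integral> t d\<langle>E(t)x, x\<rangle>\<close> there (which determines \<open>A\<close>
  by polarization). In particular such an \<open>A\<close> is self-adjoint.\<close>

definition is_spectral_resolution ::
    "operator_graph \<Rightarrow> (real set \<Rightarrow> (nat \<Rightarrow> complex) \<Rightarrow> (nat \<Rightarrow> complex)) \<Rightarrow> bool" where
  "is_spectral_resolution A E \<longleftrightarrow>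
     projection_valued_measure E \<and>
     Domain A = {x \<in> ell2. (\<integral>\<^sup>+ t. ennreal (t\<^sup>2) \<partial>spectral_measure E x) < \<infinity>} \<and>
     (\<forall>(x, y)\<in>A. ell2_inner y x = of_real (\<integral> t. t \<partial>spectral_measure E x))"

text \<open>The set function in \<open>spectral_measure\<close> really is real-valued and countably additive, so
  \<open>measure_of\<close> does not fall back to the null measure.\<close>

lemma ell2_summable_mult:
  assumes "x \<in> ell2" "y \<in> ell2"
  shows "summable (\<lambda>n. cmod (x n * cnj (y n)))"
proof (rule summable_comparison_test')
  show "summable (\<lambda>n. (cmod (x n))\<^sup>2 + (cmod (y n))\<^sup>2)"
    using assms by (auto simp: ell2_def intro: summable_add)
  show "norm (cmod (x n * cnj (y n))) \<le> (cmod (x n))\<^sup>2 + (cmod (y n))\<^sup>2" if "n \<ge> 0" for n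
  proof -
    have "2 * cmod (x n) * cmod (y n) \<le> (cmod (x n))\<^sup>2 + (cmod (y n))\<^sup>2"
      by (rule sum_squares_bound)
    moreover have "0 \<le> cmod (x n) * cmod (y n)" by simp
    ultimately show ?thesis unfolding norm_mult real_norm_def complex_mod_cnj abs_mult abs_norm_cancel
      by linarith
  qed
qed

lemma ell2_add: assumes "x \<in> ell2" "y \<in> ell2" shows "(\<lambda>n. x n + y n) \<in> ell2"
  unfolding ell2_def mem_Collect_eq
proof (rule summable_comparison_test')
  show "summable (\<lambda>n. 2 * (cmod (x n))\<^sup>2 + 2 * (cmod (y n))\<^sup>2)"
    using assms by (auto simp: ell2_def intro!: summable_add summable_mult)
  show "norm ((cmod (x n + y n))\<^sup>2) \<le> 2 * (cmod (x n))\<^sup>2 + 2 * (cmod (y n))\<^sup>2" if "n \<ge> 0" for n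
  proof -
    have "(cmod (x n + y n))\<^sup>2 \<le> (cmod (x n) + cmod (y n))\<^sup>2"
      by (intro power_mono norm_triangle_ineq) simp
    also have "\<dots> \<le> 2 * (cmod (x n))\<^sup>2 + 2 * (cmod (y n))\<^sup>2"
      using sum_squares_bound[of "cmod (x n)" "cmod (y n)"] by (simp add: power2_sum)
    finally show ?thesis by simp
  qed
qed

lemma ell2_uminus: "x \<in> ell2 \<Longrightarrow> (\<lambda>n. - x n) \<in> ell2"
  by (simp add: ell2_def)

lemma ell2_diff: "x \<in> ell2 \<Longrightarrow> y \<in> ell2 \<Longrightarrow> (\<lambda>n. x n - y n) \<in> ell2"
  using ell2_add[of x "\<lambda>n. - y n"] ell2_uminus[of y] by simp

lemma ell2_sum: "(\<And>i. i < N \<Longrightarrow> f i \<in> ell2) \<Longrightarrow> (\<lambda>n. \<Sum>i<(N::nat). f i n) \<in> ell2"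
proof (induction N)
  case 0
  then show ?case by (simp add: ell2_def)
next
  case (Suc N)
  then show ?case using ell2_add[of "\<lambda>n. \<Sum>i<N. f i n" "f N"] by simp
qed

lemma ell2_inner_diff:
  assumes "x \<in> ell2" "y \<in> ell2" "z \<in> ell2"
  shows "ell2_inner (\<lambda>n. x n - y n) z = ell2_inner x z - ell2_inner y z"
  unfolding ell2_inner_def left_diff_distrib
  using assms by (intro suminf_diff[symmetric] summable_norm_cancel[OF ell2_summable_mult]) auto

lemma ell2_inner_sum:
  assumes "\<And>i. i < N \<Longrightarrow> f i \<in> ell2" "z \<in> ell2"
  shows "ell2_inner (\<lambda>n. \<Sum>i<(N::nat). f i n) z = (\<Sum>i<N. ell2_inner (f i) z)"
  unfolding ell2_inner_def sum_distrib_right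
  using assms by (intro suminf_sum summable_norm_cancel[OF ell2_summable_mult]) auto

lemma ell2_cauchy_schwarz:
  assumes "x \<in> ell2" "y \<in> ell2"
  shows "cmod (ell2_inner x y) \<le> ell2_norm x * ell2_norm y"
proof -
  have s: "summable (\<lambda>n. cmod (x n * cnj (y n)))" by (rule ell2_summable_mult[OF assms])
  have le: "sqrt (\<Sum>i<N. (cmod (z i))\<^sup>2) \<le> ell2_norm z" if "z \<in> ell2" for z N
    unfolding ell2_norm_def using that
    by (intro real_sqrt_le_mono sum_le_suminf) (auto simp: ell2_def)
  have "(\<Sum>i<N. cmod (x i * cnj (y i))) \<le> ell2_norm x * ell2_norm y" for N
  proof -
    have "(\<Sum>i<N. cmod (x i * cnj (y i))) = (\<Sum>i<N. \<bar>cmod (x i)\<bar> * \<bar>cmod (y i)\<bar>)"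
      by (simp add: norm_mult)
    also have "\<dots> \<le> L2_set (\<lambda>i. cmod (x i)) {..<N} * L2_set (\<lambda>i. cmod (y i)) {..<N}"
      by (rule L2_set_mult_ineq)
    also have "\<dots> \<le> ell2_norm x * ell2_norm y"
      unfolding L2_set_def using assms
      by (intro mult_mono le) (auto simp: ell2_norm_def ell2_def intro!: sum_nonneg suminf_nonneg)
    finally show ?thesis .
  qed
  then have "(\<Sum>n. cmod (x n * cnj (y n))) \<le> ell2_norm x * ell2_norm y"
    by (intro suminf_le_const s) 
  then show ?thesis using summable_norm[OF s] by (simp add: ell2_inner_def)
qed

lemma ell2_inner_self:
  assumes "x \<in> ell2"
  shows "ell2_inner x x = of_real ((ell2_norm x)\<^sup>2)"
proof -
  have s: "summable (\<lambda>n. (cmod (x n))\<^sup>2)" using assms by (simp add: ell2_def)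
  have "ell2_inner x x = (\<Sum>n. of_real ((cmod (x n))\<^sup>2))"
    unfolding ell2_inner_def by (simp add: complex_norm_square del: of_real_power)
  also have "\<dots> = of_real (\<Sum>n. (cmod (x n))\<^sup>2)" by (rule suminf_of_real[OF s, symmetric])
  finally show ?thesis using s by (simp add: ell2_norm_def suminf_nonneg)
qed

lemma orth_projection_inner:
  assumes "orth_projection P" "x \<in> ell2"
  shows "ell2_inner (P x) x = of_real ((ell2_norm (P x))\<^sup>2)"
proof -
  have "ell2_inner (P x) x = ell2_inner (P (P x)) x"
    using assms by (simp add: orth_projection_def)
  also have "\<dots> = ell2_inner (P x) (P x)"
    using assms by (simp add: orth_projection_def)
  finally show ?thesis using ell2_inner_self[of "P x"] assms by (simp add: orth_projection_def)
qed

lemma space_spectral_measure [simp]: "space (spectral_measure E x) = UNIV"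
  by (simp add: spectral_measure_def space_measure_of_conv)

lemma sets_spectral_measure [simp, measurable_cong]: "sets (spectral_measure E x) = sets borel"
  unfolding spectral_measure_def
  by (subst sets_measure_of) (use sets.sigma_sets_eq[of "borel :: real measure"] in auto)

lemma emeasure_spectral_measure:
  assumes E: "projection_valued_measure E" and x: "x \<in> ell2" and B: "B \<in> sets borel"
  shows "emeasure (spectral_measure E x) B = ennreal (Re (ell2_inner (E B x) x))"
    and "Im (ell2_inner (E B x) x) = 0"
proof -
  define m where "m = (\<lambda>B. Re (ell2_inner (E B x) x))"
  have P: "orth_projection (E C)" if "C \<in> sets borel" for C
    using E that by (simp add: projection_valued_measure_def)
  have Ex: "E C x \<in> ell2" if "C \<in> sets borel" for C
    using P[OF that] x by (simp add: orth_projection_def)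
  have m0: "m C \<ge> 0" if "C \<in> sets borel" for C
    using orth_projection_inner[OF P[OF that] x] by (simp add: m_def)
  have add: "(\<lambda>i. m (C i)) sums m (\<Union>i. C i)"
    if C: "range C \<subseteq> sets borel" "disjoint_family C" for C :: "nat \<Rightarrow> real set"
  proof -
    have Cb: "C i \<in> sets borel" for i using C by auto
    have U: "(\<Union>i. C i) \<in> sets borel" using Cb by blast
    define S where "S = (\<lambda>N n. \<Sum>i<N. E (C i) x n)"
    have S: "S N \<in> ell2" for N unfolding S_def by (intro ell2_sum Ex Cb)
    have lim: "(\<lambda>N. ell2_norm (\<lambda>n. S N n - E (\<Union>i. C i) x n)) \<longlonglongrightarrow> 0"
      using E C x by (simp add: projection_valued_measure_def ell2_lim_def S_def)
    have "(\<lambda>N. ell2_inner (S N) x - ell2_inner (E (\<Union>i. C i) x) x) \<longlonglongrightarrow> 0"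
    proof (rule Lim_null_comparison)
      show "(\<lambda>N. ell2_norm (\<lambda>n. S N n - E (\<Union>i. C i) x n) * ell2_norm x) \<longlonglongrightarrow> 0"
        using tendsto_mult_right[OF lim, of "ell2_norm x"] by simp
      show "\<forall>\<^sub>F N in sequentially. norm (ell2_inner (S N) x - ell2_inner (E (\<Union>i. C i) x) x)
              \<le> ell2_norm (\<lambda>n. S N n - E (\<Union>i. C i) x n) * ell2_norm x"
        using ell2_cauchy_schwarz[OF ell2_diff[OF S Ex[OF U]] x]
        by (simp add: ell2_inner_diff[OF S Ex[OF U] x])
    qed
    then have "(\<lambda>N. ell2_inner (S N) x) \<longlonglongrightarrow> ell2_inner (E (\<Union>i. C i) x) x"
      by (simp add: LIM_zero_iff)
    then have "(\<lambda>N. Re (ell2_inner (S N) x)) \<longlonglongrightarrow> m (\<Union>i. C i)"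
      unfolding m_def by (rule tendsto_Re)
    moreover have "Re (ell2_inner (S N) x) = (\<Sum>i<N. m (C i))" for N
      unfolding S_def m_def by (subst ell2_inner_sum) (auto intro: Ex Cb x)
    ultimately show ?thesis by (simp add: sums_def)
  qed
  have "countably_additive (sets borel) (\<lambda>C. ennreal (m C))"
  proof (rule countably_additiveI)
    fix C :: "nat \<Rightarrow> real set" assume C: "range C \<subseteq> sets borel" "disjoint_family C"
    have "(\<Sum>i. ennreal (m (C i))) = ennreal (\<Sum>i. m (C i))"
      using C add[OF C] by (intro suminf_ennreal2 m0) (auto simp: sums_iff)
    then show "(\<Sum>i. ennreal (m (C i))) = ennreal (m (\<Union>i. C i))"
      using add[OF C] by (simp add: sums_iff)
  qed
  moreover have "m {} = 0"
  proof -
    have "(\<lambda>i::nat. m {}) sums m {}"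
      using add[of "\<lambda>_. {}"] by (simp add: disjoint_family_on_def)
    then have "(\<lambda>i::nat. m {}) \<longlonglongrightarrow> 0"
      by (intro summable_LIMSEQ_zero) (auto simp: sums_iff)
    then show ?thesis by (simp add: LIMSEQ_const_iff)
  qed
  ultimately show "emeasure (spectral_measure E x) B = ennreal (Re (ell2_inner (E B x) x))"
    unfolding spectral_measure_def m_def[symmetric]
    by (intro emeasure_measure_of_sigma)
       (use B sets.sigma_algebra_axioms[of "borel :: real measure"] in \<open>auto simp: positive_def m_def\<close>)
  show "Im (ell2_inner (E B x) x) = 0"
    using orth_projection_inner[OF P[OF B] x] by simp
qed

end

theory Submission
  imports Defs "HOL-Complex_Analysis.Complex_Analysis"
begin

text \<open>Let \<open>p\<^sub>n\<close> be the orthonormal polynomials of the Jacobi matrix. For every \<open>N\<close> the probability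
  density \<open>1 / (\<pi> b\<^sub>N (p\<^sub>N\<^sup>2 + p\<^sub>N\<^sub>+\<^sub>1\<^sup>2))\<close> is the spectral density of the matrix whose tail beyond \<open>N\<close>
  has been replaced by a constant Weyl function. Its Stieltjes transform lies in the same \<open>N\<close>-th Weyl
  disc as that of \<open>\<mu>\<close>; the discs shrink to points because \<open>\<Sum> 1/b\<^sub>n\<close> diverges for \<open>\<alpha> < 1\<close> (Carleman's
  condition), so these densities converge weakly to \<open>\<mu>\<close>. Along even \<open>N\<close> they also converge locally
  uniformly on \<open>\<real> - {0}\<close>: over a pair of equal weights \<open>s\<close> the recurrence turns \<open>(p\<^sub>N, p\<^sub>N\<^sub>+\<^sub>1)\<close>
      almost by
  a rotation of angle \<open>x/s\<close>, which for \<open>x \<noteq> 0\<close> and \<open>\<alpha> < 1\<close> dominates the relative increment \<open>O(1/k)\<close>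
      of the
  weights, and a corrected Turan determinant of \<open>p\<^sub>N\<close>, \<open>p\<^sub>N\<^sub>+\<^sub>1\<close> converges to a positive limit.\<close>

section \<open>Orthogonal polynomials and Weyl discs\<close>

text \<open>The hypothesis on \<open>E\<close> supplies the domain and the quadratic form of the
  operator, but neither a resolvent nor the action of the operator on the range of a projection. The
  Weyl solution that belongs to \<mu> therefore has to be recovered: projections onto short
  intervals yield approximate eigenvectors, Riemann sums of these satisfy the resolvent equation up
  to a vanishing error, and the recurrence forces every entry of the limit. Being in a Weyl disc
  enters through the bound 1 / (Im z)^2 on the partial sums of |\<open>weyl\<close>|^2, which holds
  for both transforms. Convergence of the transforms is convergence of Poisson integrals, so weak
  convergence is tested on Lipschitz functions smoothed by Poisson kernels; that these kernels
  reproduce the approximants comes from Cauchy's formula on half discs. The point 0 is lost because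
  the correction of the Turan determinant divides by x: its limit is uniform only on sets c <= |x|
  <= M. The measures are therefore compared on such sets, which exhaust the complement of 0.\<close>

fun jacobi_poly :: "(nat \<Rightarrow> real) \<Rightarrow> 'a::real_normed_field \<Rightarrow> nat \<Rightarrow> 'a" where
  "jacobi_poly b z 0 = 1"
| "jacobi_poly b z (Suc 0) = z / of_real (b 0)"
| "jacobi_poly b z (Suc (Suc n)) =
     (z * jacobi_poly b z (Suc n) - of_real (b n) * jacobi_poly b z n) / of_real (b (Suc n))"

text \<open>Polynomials of the second kind. The start 0, 1 / b 0 produces the inhomogeneity e0 in
  \<open>jacobi_apply_q\<close>. Both families are polymorphic in the field: Weyl discs need complex
  z, the amplitudes need real x.\<close>

fun jacobi_poly2 :: "(nat \<Rightarrow> real) \<Rightarrow> 'a::real_normed_field \<Rightarrow> nat \<Rightarrow> 'a" where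
  "jacobi_poly2 b z 0 = 0"
| "jacobi_poly2 b z (Suc 0) = 1 / of_real (b 0)"
| "jacobi_poly2 b z (Suc (Suc n)) =
     (z * jacobi_poly2 b z (Suc n) - of_real (b n) * jacobi_poly2 b z n) / of_real (b (Suc n))"

lemma jacobi_poly_of_real: "jacobi_poly b (of_real x) n = of_real (jacobi_poly b x n)"
  by (induction b x n rule: jacobi_poly.induct) auto

lemma jacobi_apply_add_scaled:
  "jacobi_apply b (\<lambda>n. u n + c * v n) n = jacobi_apply b u n + c * jacobi_apply b v n"
  by (simp add: jacobi_apply_def algebra_simps)

locale jacobi_weights =
  fixes b :: "nat \<Rightarrow> real"
  assumes b_pos: "0 < b n"
begin

abbreviation "p \<equiv> jacobi_poly b"
abbreviation "q \<equiv> jacobi_poly2 b"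

lemma b_nz [simp]: "b n \<noteq> 0" using b_pos[of n] by simp

lemma jacobi_apply_p: "jacobi_apply b (p z) n = z * p z n"
  by (cases n) (simp_all add: jacobi_apply_def)

lemma jacobi_apply_q: "jacobi_apply b (q z) n = z * q z n + basis_vec 0 n"
  by (cases n) (simp_all add: jacobi_apply_def basis_vec_def)

text \<open>The general solution of the formal equation (A - z) u = e0, parametrized by its entry m
  at 0. If m is the Stieltjes transform of the spectral measure, this is the resolvent applied to
  e0.\<close>

definition weyl :: "complex \<Rightarrow> complex \<Rightarrow> nat \<Rightarrow> complex" where
  "weyl z m n = q z n + m * p z n"

lemma jacobi_apply_weyl: "jacobi_apply b (weyl z m) n = z * weyl z m n + basis_vec 0 n"
  unfolding weyl_def jacobi_apply_add_scaled jacobi_apply_p jacobi_apply_q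
  by (simp add: algebra_simps)

text \<open>Multiply row n by \<open>cnj (u n)\<close> and take imaginary parts. Since Im (a * cnj
  c) = - Im (c * cnj a), the two off-diagonal contributions are consecutive values of one boundary
  term, and the sum over n telescopes.\<close>

lemma green_identity:
  assumes "\<And>n. jacobi_apply b u n = z * u n + c * basis_vec 0 n"
  shows "b N * Im (u (Suc N) * cnj (u N)) =
           Im z * (\<Sum>n\<le>N. (cmod (u n))\<^sup>2) + Im (c * cnj (u 0))"
proof -
  define w where "w = (\<lambda>n. Im (u (Suc n) * cnj (u n)))"
  have step: "b n * w n - (if n = 0 then 0 else b (n - 1) * w (n - 1)) =
      Im z * (cmod (u n))\<^sup>2 + (if n = 0 then Im (c * cnj (u 0)) else 0)" for n
  proof -
    have 1: "Im (jacobi_apply b u n * cnj (u n)) = Im z * (cmod (u n))\<^sup>2 + (if n = 0 then Im (c *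
        cnj (u 0)) else 0)"
      unfolding assms unfolding cmod_power2 by (auto simp: basis_vec_def algebra_simps power2_eq_square)
    have 2: "Im (jacobi_apply b u n * cnj (u n)) =
       b n * w n - (if n = 0 then 0 else b (n - 1) * w (n - 1))"
      by (cases n) (auto simp: jacobi_apply_def w_def algebra_simps)
    show ?thesis using 1 2 by simp
  qed
  have "b N * w N = Im z * (\<Sum>n\<le>N. (cmod (u n))\<^sup>2) + Im (c * cnj (u 0))"
  proof (induction N)
    case 0 show ?case using step[of 0] by simp
  next
    case (Suc N)
    then show ?case using step[of "Suc N"] by (simp add: algebra_simps)
  qed
  then show ?thesis by (simp add: w_def)
qed

text \<open>The recurrence conserves the Wronskian of its two solutions. In particular
  \<open>p z N\<close> and \<open>p z (Suc N)\<close> never vanish together.\<close>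

lemma wronskian: "of_real (b N) * (q z (Suc N) * p z N - q z N * p z (Suc N)) = 1"
proof (induction N)
  case 0 show ?case by simp
next
  case (Suc N)
  have "of_real (b (Suc N)) * (q z (Suc (Suc N)) * p z (Suc N) - q z (Suc N) * p z (Suc (Suc N)))
     = of_real (b N) * (q z (Suc N) * p z N - q z N * p z (Suc N))"
    by (simp add: field_simps)
  then show ?case using Suc by simp
qed

lemma christoffel_darboux:
  "b N * Im (p z (Suc N) * cnj (p z N)) = Im z * (\<Sum>n\<le>N. (cmod (p z n))\<^sup>2)"
  using green_identity[of "p z" z 0 N] by (simp add: jacobi_apply_p)

lemma sum_p_ge_1: "1 \<le> (\<Sum>n\<le>N. (cmod (p z n))\<^sup>2)"
proof -
  have "(cmod (p z 0))\<^sup>2 \<le> (\<Sum>n\<le>N. (cmod (p z n))\<^sup>2)" by (rule member_le_sum) auto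
  then show ?thesis by simp
qed

section \<open>Carmona's approximants of the Weyl function\<close>

definition denom :: "nat \<Rightarrow> complex \<Rightarrow> complex" where
  "denom N z = p z (Suc N) + \<i> * p z N"

text \<open>The value m for which the Weyl solution satisfies u (N + 1) = - \<i> u N, see
  \<open>weyl_carmona\<close>. The factor - \<i>, as opposed to \<i>, makes the boundary term of
  Green's identity negative.\<close>

definition carmona_m :: "nat \<Rightarrow> complex \<Rightarrow> complex" where
  "carmona_m N z = - (q z (Suc N) + \<i> * q z N) / denom N z"

text \<open>A zero would make the left side of \<open>christoffel_darboux\<close> equal to - b N |p
  z N|^2, while its right side is nonnegative; then both polynomials vanish, against the Wronskian.
  Real z are included, so \<open>carmona_m\<close> extends continuously to the real axis.\<close>

lemma denom_nz:
  assumes "Im z \<ge> 0"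
  shows "denom N z \<noteq> 0"
proof
  assume "denom N z = 0"
  then have e: "p z (Suc N) = - \<i> * p z N" by (simp add: denom_def eq_neg_iff_add_eq_0)
  have "Im (p z (Suc N) * cnj (p z N)) = - (cmod (p z N))\<^sup>2"
    unfolding e cmod_power2 by (simp add: power2_eq_square)
  then have "b N * (cmod (p z N))\<^sup>2 \<le> 0"
    using christoffel_darboux[of N z] mult_nonneg_nonneg[OF assms sum_nonneg, of "{..N}" "\<lambda>n. (cmod
        (p z n))\<^sup>2"]
    by (simp del: minus_mult_right)
  then have "p z N = 0" using b_pos[of N] by (simp add: mult_le_0_iff)
  with e have "p z (Suc N) = 0" by simp
  with \<open>p z N = 0\<close> show False using wronskian[of N z] by simp
qed

lemma weyl_carmona:
  assumes "Im z \<ge> 0"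
  shows "weyl z (carmona_m N z) (Suc N) = - \<i> * weyl z (carmona_m N z) N"
  using denom_nz[OF assms, of N] unfolding weyl_def carmona_m_def
  by (simp add: field_simps) (simp add: denom_def algebra_simps)

text \<open>The boundary condition turns the boundary term into - b N |u N|^2. On the upper
  half-plane this gives the l2 bound, and on the real axis only the boundary term survives.\<close>

lemma carmona_green:
  assumes "Im z \<ge> 0"
  shows "Im z * (\<Sum>n\<le>N. (cmod (weyl z (carmona_m N z) n))\<^sup>2)
     + b N * (cmod (weyl z (carmona_m N z) N))\<^sup>2 = Im (carmona_m N z)"
proof -
  let ?u = "weyl z (carmona_m N z)"
  have "Im (?u (Suc N) * cnj (?u N)) = - (cmod (?u N))\<^sup>2"
    unfolding weyl_carmona[OF assms] cmod_power2 by (simp add: power2_eq_square)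
  moreover have "?u 0 = carmona_m N z" by (simp add: weyl_def)
  ultimately show ?thesis
    using green_identity[of ?u z 1 N] by (simp add: jacobi_apply_weyl)
qed

text \<open>As \<open>weyl z m 0 = m\<close>, the hypothesis contains Im z |m|^2 <= Im m <= |m|,
  which bounds m. Feeding that bound back into the right side of the hypothesis bounds the
  sum.\<close>

lemma weyl_disc_bound:
  assumes z: "Im z > 0" and le: "Im z * (\<Sum>n\<le>N. (cmod (weyl z m n))\<^sup>2) \<le> Im m"
  shows "cmod m \<le> 1 / Im z" "(\<Sum>n\<le>N. (cmod (weyl z m n))\<^sup>2) \<le> 1 / (Im z)\<^sup>2"
proof -
  have "(cmod (weyl z m 0))\<^sup>2 \<le> (\<Sum>n\<le>N. (cmod (weyl z m n))\<^sup>2)" by (rule member_le_sum) auto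
  then have "Im z * (cmod m)\<^sup>2 \<le> Im m"
    using z le by (smt (verit) mult_left_mono weyl_def jacobi_poly2.simps(1) jacobi_poly.simps(1)
        add_0 mult.right_neutral)
  also have "\<dots> \<le> cmod m" by (rule order_trans[OF abs_ge_self abs_Im_le_cmod])
  finally have "cmod m * (cmod m * Im z) \<le> cmod m * 1" by (simp add: power2_eq_square mult_ac)
  then have 1: "cmod m * Im z \<le> 1" by (cases "m = 0") (auto simp: mult_le_cancel_left)
  then show "cmod m \<le> 1 / Im z" using z by (simp add: field_simps)
  have "Im z * (Im z * (\<Sum>n\<le>N. (cmod (weyl z m n))\<^sup>2)) \<le> Im z * cmod m"
    using z le abs_Im_le_cmod[of m] by (intro mult_left_mono) auto
  also have "\<dots> \<le> 1" using 1 by (simp add: mult_ac)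
  finally show "(\<Sum>n\<le>N. (cmod (weyl z m n))\<^sup>2) \<le> 1 / (Im z)\<^sup>2"
    using z by (simp add: field_simps power2_eq_square)
qed

lemma carmona_bounds:
  assumes "Im z > 0"
  shows "cmod (carmona_m N z) \<le> 1 / Im z"
    and "(\<Sum>n\<le>N. (cmod (weyl z (carmona_m N z) n))\<^sup>2) \<le> 1 / (Im z)\<^sup>2"
proof -
  have "Im z * (\<Sum>n\<le>N. (cmod (weyl z (carmona_m N z) n))\<^sup>2) \<le> Im (carmona_m N z)"
    using carmona_green[of z N] assms b_pos[of N] by (simp add: order_less_imp_le flip: carmona_green)
  from weyl_disc_bound[OF assms this] show "cmod (carmona_m N z) \<le> 1 / Im z"
    "(\<Sum>n\<le>N. (cmod (weyl z (carmona_m N z) n))\<^sup>2) \<le> 1 / (Im z)\<^sup>2" .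
qed

text \<open>For real z Green's identity leaves Im m = b N |u N|^2, and u N times
  \<open>denom\<close> is the Wronskian expression - 1 / b N. The polynomials being real,
  |\<open>denom\<close>|^2 is the sum of squares.\<close>

lemma Im_carmona_real:
  "Im (carmona_m N (of_real x)) = 1 / (b N * ((p x N)\<^sup>2 + (p x (Suc N))\<^sup>2))"
proof -
  let ?z = "complex_of_real x"
  have d: "denom N ?z \<noteq> 0" by (rule denom_nz) simp
  have "weyl ?z (carmona_m N ?z) N * denom N ?z
      = q ?z N * p ?z (Suc N) - q ?z (Suc N) * p ?z N"
    unfolding weyl_def carmona_m_def using d
    by (simp add: field_simps) (simp add: denom_def algebra_simps)
  also have "\<dots> = - 1 / of_real (b N)"
    using wronskian[of N ?z] by (simp add: field_simps)
  finally have "weyl ?z (carmona_m N ?z) N * denom N ?z = - 1 / of_real (b N)" .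
  then have "cmod (weyl ?z (carmona_m N ?z) N) * cmod (denom N ?z) = 1 / b N"
    using b_pos[of N] by (metis norm_mult norm_divide norm_minus_cancel norm_one norm_of_real
        abs_of_pos)
  then have w: "cmod (weyl ?z (carmona_m N ?z) N) = 1 / (b N * cmod (denom N ?z))"
    using d by (simp add: field_simps)
  have "denom N ?z = Complex (p x (Suc N)) (p x N)"
    by (simp add: denom_def jacobi_poly_of_real complex_eq_iff)
  then have dd: "(cmod (denom N ?z))\<^sup>2 = (p x N)\<^sup>2 + (p x (Suc N))\<^sup>2"
    by (simp add: cmod_power2)
  have "Im (carmona_m N ?z) = b N * (cmod (weyl ?z (carmona_m N ?z) N))\<^sup>2"
    using carmona_green[of ?z N] by simp
  also have "\<dots> = b N / ((b N)\<^sup>2 * ((p x N)\<^sup>2 + (p x (Suc N))\<^sup>2))"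
    unfolding w power_divide power_mult_distrib dd by simp
  finally show ?thesis by (simp add: power2_eq_square)
qed

lemma carmona_denominator_pos: "0 < (p (x::real) N)\<^sup>2 + (p x (Suc N))\<^sup>2"
proof (rule ccontr)
  assume "\<not> ?thesis"
  then have "p x N = 0" "p x (Suc N) = 0"
    by (metis not_sum_power2_lt_zero linorder_neqE_linordered_idom sum_power2_eq_zero_iff)+
  then show False using wronskian[of N x] by simp
qed

lemma continuous_on_p [continuous_intros]:
  "continuous_on A (\<lambda>z::'a::real_normed_field. p z n)"
  by (induction n rule: induct_nat_012) (auto intro!: continuous_intros)

lemma continuous_on_q: "continuous_on A (\<lambda>z::'a::real_normed_field. q z n)"
  by (induction n rule: induct_nat_012) (auto intro!: continuous_intros)

lemma field_differentiable_p: "(\<lambda>z. p z n) field_differentiable at z" for z :: complex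
  by (induction n rule: induct_nat_012) (auto intro!: derivative_intros field_differentiable_mult
      field_differentiable_divide field_differentiable_diff)

lemma field_differentiable_q: "(\<lambda>z. q z n) field_differentiable at z" for z :: complex
  by (induction n rule: induct_nat_012) (auto intro!: derivative_intros field_differentiable_mult
      field_differentiable_divide field_differentiable_diff)

lemma continuous_on_carmona: "continuous_on {z. Im z \<ge> 0} (carmona_m N)"
  unfolding carmona_m_def using denom_nz[of _ N] unfolding denom_def
  by (auto intro!: continuous_intros continuous_on_q)

lemma field_differentiable_carmona: "Im z > 0 \<Longrightarrow> carmona_m N field_differentiable at z"
  unfolding carmona_m_def using denom_nz[of z N] unfolding denom_def
  by (auto simp del: minus_add_distrib intro!: field_differentiable_divide field_differentiable_add
      field_differentiable_minus
     field_differentiable_mult field_differentiable_p field_differentiable_q)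

text \<open>The Poisson representation needs one bound on the whole closed half-plane, where 1 / Im
  z is useless near the real axis. For large |z| the polynomials p grow geometrically in the index
  and q / p stays bounded; the remaining half disc is compact.\<close>

lemma carmona_bounded: "\<exists>C. \<forall>z. Im z \<ge> 0 \<longrightarrow> cmod (carmona_m N z) \<le> C"
proof -
  define R where "R = 1 + (\<Sum>n\<le>N. 2 * b n + b n)"
  have R: "2 * b n + b n \<le> R" if "n \<le> N" for n
  proof -
    have "2 * b n + b n \<le> (\<Sum>n\<le>N. 2 * b n + b n)"
      by (rule member_le_sum) (use that b_pos in \<open>auto intro: less_imp_le add_nonneg_nonneg\<close>)
    then show ?thesis by (simp add: R_def)
  qed
  \<comment> \<open>Doubled because the recurrence compares |z| with \<open>b (Suc n)\<close> and
    \<open>b n\<close> together, and each of them is only covered by one copy of R.\<close>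
  define R' where "R' = R + R"
  have grow: "2 * cmod (p z n) \<le> cmod (p z (Suc n))" if z: "cmod z \<ge> R'" and "n \<le> N" for z n
    using \<open>n \<le> N\<close>
  proof (induction n)
    case 0
    have "2 * b 0 \<le> cmod z" using R[of 0] b_pos[of 0] z by (simp add: R'_def)
    then show ?case using b_pos[of 0] by (simp add: norm_divide field_simps)
  next
    case (Suc n)
    have a: "2 * b (Suc n) + b n \<le> cmod z"
      using R[of "Suc n"] R[of n] b_pos[of n] b_pos[of "Suc n"] z Suc.prems by (simp add: R'_def)
    have IH: "cmod (p z n) \<le> cmod (p z (Suc n))"
      using Suc by (smt (verit) norm_ge_zero Suc_leD)
    have "(2 * b (Suc n) + b n) * cmod (p z (Suc n)) \<le> cmod z * cmod (p z (Suc n))"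
      using a by (intro mult_right_mono) auto
    moreover have "b n * cmod (p z n) \<le> b n * cmod (p z (Suc n))"
      using IH b_pos[of n] by simp
    moreover have "cmod z * cmod (p z (Suc n)) - b n * cmod (p z n)
        \<le> cmod (z * p z (Suc n) - of_real (b n) * p z n)"
      using norm_triangle_ineq2[of "z * p z (Suc n)" "of_real (b n) * p z n"] b_pos[of n]
      by (simp add: norm_mult)
    ultimately show ?case
      using b_pos[of "Suc n"] by (simp add: norm_divide field_simps)
  qed
  have ge1: "1 \<le> cmod (p z n)" if z: "cmod z \<ge> R'" and "n \<le> Suc N" for z n
    using \<open>n \<le> Suc N\<close> by (induction n) (use grow[OF z] in \<open>fastforce+\<close>)
  define C where "C = (\<Sum>n\<le>N. 1 / b n)"
  \<comment> \<open>By the Wronskian, q / p changes by 1 / (b n p_n p_(n+1)) from n to n + 1, and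
    |p| >= 1 keeps this below 1 / b n.\<close>
  have qp: "cmod (q z n) \<le> (\<Sum>j<n. 1 / b j) * cmod (p z n)"
    if z: "cmod z \<ge> R'" and "n \<le> Suc N" for z n
    using \<open>n \<le> Suc N\<close>
  proof (induction n)
    case (Suc n)
    have nz: "p z n \<noteq> 0" "p z (Suc n) \<noteq> 0"
      using ge1[OF z, of n] ge1[OF z, of "Suc n"] Suc.prems by (auto simp del: jacobi_poly.simps)
    have "q z (Suc n) = p z (Suc n) * (q z n / p z n) + 1 / (of_real (b n) * p z n)"
      using wronskian[of n z] nz by (simp add: field_simps)
    then have "cmod (q z (Suc n)) \<le> cmod (p z (Suc n)) * (cmod (q z n) / cmod (p z n)) + 1 / (b n *
        cmod (p z n))"
      using norm_triangle_ineq[of "p z (Suc n) * (q z n / p z n)" "1 / (of_real (b n) * p z n)"]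
          b_pos[of n]
      by (simp add: norm_mult norm_divide)
    also have "\<dots> \<le> cmod (p z (Suc n)) * (\<Sum>j<n. 1 / b j) + cmod (p z (Suc n)) * (1 / b n)"
    proof (intro add_mono mult_left_mono)
      show "cmod (q z n) / cmod (p z n) \<le> (\<Sum>j<n. 1 / b j)"
        using Suc nz by (simp add: field_simps)
      have "1 / (b n * cmod (p z n)) \<le> 1 / b n"
        using ge1[OF z, of n] Suc.prems b_pos[of n] by (intro divide_left_mono mult_pos_pos) auto
      also have "\<dots> \<le> cmod (p z (Suc n)) * (1 / b n)"
        using ge1[OF z, of "Suc n"] Suc.prems b_pos[of n] by (simp add: field_simps)
      finally show "1 / (b n * cmod (p z n)) \<le> cmod (p z (Suc n)) * (1 / b n)" .
    qed auto
    finally show ?case by (simp add: algebra_simps)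
  qed simp
  \<comment> \<open>The numerator is at most 3/2 C |p_(N+1)| and the denominator at least |p_(N+1)|
    / 2, because |p_N| is at most half of |p_(N+1)|.\<close>
  have far: "cmod (carmona_m N z) \<le> 3 * C" if z: "cmod z \<ge> R'" for z
  proof -
    have C0: "0 \<le> C" unfolding C_def by (intro sum_nonneg) (use b_pos in \<open>auto intro: less_imp_le\<close>)
    have 1: "cmod (q z (Suc N)) \<le> C * cmod (p z (Suc N))"
      using qp[OF z, of "Suc N"] by (simp add: C_def lessThan_Suc_atMost)
    have "cmod (q z N) \<le> (\<Sum>j<N. 1 / b j) * cmod (p z N)" using qp[OF z, of N] by simp
    also have "\<dots> \<le> C * cmod (p z N)" unfolding C_def
      by (intro mult_right_mono sum_mono2) (use b_pos in \<open>auto intro: less_imp_le\<close>)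
    finally have 2: "cmod (q z N) \<le> C * cmod (p z N)" .
    have g: "2 * cmod (p z N) \<le> cmod (p z (Suc N))" by (rule grow[OF z]) simp
    have n1: "cmod (q z (Suc N) + \<i> * q z N) \<le> cmod (q z (Suc N)) + cmod (q z N)"
      using norm_triangle_ineq[of "q z (Suc N)" "\<i> * q z N"] by (simp add: norm_mult)
    have d1: "cmod (p z (Suc N)) - cmod (p z N) \<le> cmod (denom N z)"
      unfolding denom_def using norm_diff_ineq[of "p z (Suc N)" "\<i> * p z N"] by (simp add: norm_mult)
    have d0: "cmod (denom N z) > 0" using d1 g ge1[OF z, of N] by linarith
    have "C * cmod (p z N) \<le> C * (cmod (p z (Suc N)) / 2)" using g C0 by (intro mult_left_mono) auto
    moreover have "3 * C * (cmod (p z (Suc N)) / 2) \<le> 3 * C * cmod (denom N z)"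
      using d1 g C0 by (intro mult_left_mono) auto
    ultimately have "cmod (q z (Suc N) + \<i> * q z N) \<le> 3 * C * cmod (denom N z)"
      using 1 2 n1 by linarith
    moreover have "cmod (carmona_m N z) = cmod (q z (Suc N) + \<i> * q z N) / cmod (denom N z)"
      unfolding carmona_m_def norm_divide norm_minus_cancel ..
    ultimately show ?thesis
      using d0 by (simp add: divide_le_eq)
  qed
  have "compact (cball 0 R' \<inter> {z. Im z \<ge> 0})"
    by (intro compact_Int_closed compact_cball closed_halfspace_Im_ge)
  then have "compact (carmona_m N ` (cball 0 R' \<inter> {z. Im z \<ge> 0}))"
    by (intro compact_continuous_image continuous_on_subset[OF continuous_on_carmona]) auto
  then obtain D where "\<forall>w \<in> carmona_m N ` (cball 0 R' \<inter> {z. Im z \<ge> 0}). cmod w \<le> D"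
    using compact_imp_bounded bounded_iff by blast
  then have "\<forall>z. Im z \<ge> 0 \<longrightarrow> cmod (carmona_m N z) \<le> max D (3 * C)"
    using far by (force simp: le_max_iff_disj)
  then show ?thesis by blast
qed

section \<open>Shrinking of the Weyl discs\<close>

text \<open>Two Weyl solutions at the same z differ by (m - m') p, so their common l2 bound limits
  the distance of m and m' in terms of the partial sums of |p|^2.\<close>

lemma weyl_difference:
  assumes z: "Im z > 0"
    and "(\<Sum>n\<le>N. (cmod (weyl z m n))\<^sup>2) \<le> 1 / (Im z)\<^sup>2"
    and "(\<Sum>n\<le>N. (cmod (weyl z m' n))\<^sup>2) \<le> 1 / (Im z)\<^sup>2"
  shows "(cmod (m - m'))\<^sup>2 * (\<Sum>n\<le>N. (cmod (p z n))\<^sup>2) \<le> 4 / (Im z)\<^sup>2"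
proof -
  have "(cmod (m - m'))\<^sup>2 * (\<Sum>n\<le>N. (cmod (p z n))\<^sup>2)
      = (\<Sum>n\<le>N. (cmod (weyl z m n - weyl z m' n))\<^sup>2)"
    unfolding sum_distrib_left weyl_def
    by (intro sum.cong refl) (simp add: norm_mult flip: power_mult_distrib left_diff_distrib)
  also have "\<dots> \<le> (\<Sum>n\<le>N. 2 * (cmod (weyl z m n))\<^sup>2 + 2 * (cmod (weyl z m' n))\<^sup>2)"
  proof (rule sum_mono)
    fix n
    have "(cmod (weyl z m n - weyl z m' n))\<^sup>2 \<le> (cmod (weyl z m n) + cmod (weyl z m' n))\<^sup>2"
      by (intro power_mono norm_triangle_ineq4) simp
    then show "(cmod (weyl z m n - weyl z m' n))\<^sup>2 \<le> 2 * (cmod (weyl z m n))\<^sup>2 + 2 * (cmod (weyl z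
        m' n))\<^sup>2"
      using sum_squares_bound[of "cmod (weyl z m n)" "cmod (weyl z m' n)"] by (simp add: power2_sum)
  qed
  also have "\<dots> \<le> 4 / (Im z)\<^sup>2"
    using assms by (simp add: sum.distrib flip: sum_distrib_left)
  finally show ?thesis .
qed

text \<open>The sum in \<open>christoffel_darboux\<close> is at least 1, whence Im z <= b n |p_(n+1)
  p_n|. If the sums of |p|^2 were bounded, this would make 1 / b n summable.\<close>

lemma carleman:
  assumes z: "Im z > 0" and "\<not> summable (\<lambda>n. 1 / b n)"
  shows "\<exists>N0. \<forall>N\<ge>N0. M \<le> (\<Sum>n\<le>N. (cmod (p z n))\<^sup>2)"
proof (rule ccontr)
  assume neg: "\<not> ?thesis"
  let ?P = "\<lambda>n. (cmod (p z n))\<^sup>2"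
  have bd: "(\<Sum>n\<le>N. ?P n) \<le> M" for N
  proof -
    obtain N' where "N' \<ge> N" "(\<Sum>n\<le>N'. ?P n) < M" using neg by (metis not_le)
    moreover have "(\<Sum>n\<le>N. ?P n) \<le> (\<Sum>n\<le>N'. ?P n)"
      using \<open>N' \<ge> N\<close> by (intro sum_mono2) auto
    ultimately show ?thesis by simp
  qed
  have P: "summable ?P"
  proof (rule summableI_nonneg_bounded)
    show "(\<Sum>k<n. ?P k) \<le> M" for n
      by (rule order_trans[OF sum_mono2 bd[of n]]) auto
  qed simp
  have "summable (\<lambda>n. (?P (Suc n) + ?P n) / Im z)"
    using P by (intro summable_divide summable_add summable_Suc_iff[THEN iffD2])
  then have "summable (\<lambda>n. 1 / b n)"
  proof (rule summable_comparison_test')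
    fix n
    have "Im z * 1 \<le> Im z * (\<Sum>k\<le>n. ?P k)"
      by (rule mult_left_mono) (use sum_p_ge_1[of z n] z in auto)
    also have "\<dots> = b n * Im (p z (Suc n) * cnj (p z n))" by (rule christoffel_darboux[symmetric])
    also have "\<dots> \<le> b n * cmod (p z (Suc n) * cnj (p z n))"
      by (intro mult_left_mono order_trans[OF abs_ge_self abs_Im_le_cmod]) (use b_pos[of n] in auto)
    also have "\<dots> \<le> b n * (?P (Suc n) + ?P n)"
      using sum_squares_bound[of "cmod (p z (Suc n))" "cmod (p z n)"]
      by (intro mult_left_mono) (use b_pos[of n] in \<open>auto simp: norm_mult intro:
          order_trans[rotated] zero_le_mult_iff\<close>)
    finally show "norm (1 / b n) \<le> (?P (Suc n) + ?P n) / Im z"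
      using b_pos[of n] z by (simp add: field_simps)
  qed
  then show False using assms by simp
qed

end

section \<open>The graph of a Jacobi operator\<close>

lemma ell2_norm_nonneg [simp]: "x \<in> ell2 \<Longrightarrow> 0 \<le> ell2_norm x"
  by (simp add: ell2_norm_def ell2_def suminf_nonneg)

lemma ell2_norm_power2: "x \<in> ell2 \<Longrightarrow> (ell2_norm x)\<^sup>2 = (\<Sum>n. (cmod (x n))\<^sup>2)"
  by (simp add: ell2_norm_def ell2_def suminf_nonneg)

lemma ell2_scale: "x \<in> ell2 \<Longrightarrow> (\<lambda>n. c * x n) \<in> ell2"
  by (simp add: ell2_def norm_mult power_mult_distrib summable_mult)

lemma ell2_sum_le_norm: "x \<in> ell2 \<Longrightarrow> (\<Sum>n\<le>N. (cmod (x n))\<^sup>2) \<le> (ell2_norm x)\<^sup>2"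
  unfolding ell2_norm_power2 by (rule sum_le_suminf) (auto simp: ell2_def)

lemma ell2_component_le: assumes "x \<in> ell2" shows "cmod (x n) \<le> ell2_norm x"
proof (rule power2_le_imp_le)
  have "(cmod (x n))\<^sup>2 \<le> (\<Sum>k\<le>n. (cmod (x k))\<^sup>2)" by (rule member_le_sum) auto
  then show "(cmod (x n))\<^sup>2 \<le> (ell2_norm x)\<^sup>2" using ell2_sum_le_norm[OF assms, of n] by linarith
qed (simp add: assms)

lemma ell2_norm_add_scaled:
  assumes x: "x \<in> ell2" and y: "y \<in> ell2"
  shows "(ell2_norm (\<lambda>n. x n + c * y n))\<^sup>2 \<le> 2 * (ell2_norm x)\<^sup>2 + 2 * (cmod c)\<^sup>2 * (ell2_norm y)\<^sup>2"
proof -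
  have xy: "(\<lambda>n. x n + c * y n) \<in> ell2" by (intro ell2_add x ell2_scale y)
  have s: "summable (\<lambda>n. (cmod (x n))\<^sup>2)" "summable (\<lambda>n. (cmod (y n))\<^sup>2)" using x y by (auto simp:
      ell2_def)
  have "(\<Sum>n. (cmod (x n + c * y n))\<^sup>2) \<le> (\<Sum>n. 2 * (cmod (x n))\<^sup>2 + 2 * (cmod c)\<^sup>2 * (cmod (y n))\<^sup>2)"
  proof (rule suminf_le)
    fix n
    have "(cmod (x n + c * y n))\<^sup>2 \<le> (cmod (x n) + cmod c * cmod (y n))\<^sup>2"
      using norm_triangle_ineq[of "x n" "c * y n"] by (intro power_mono) (auto simp: norm_mult)
    then show "(cmod (x n + c * y n))\<^sup>2 \<le> 2 * (cmod (x n))\<^sup>2 + 2 * (cmod c)\<^sup>2 * (cmod (y n))\<^sup>2"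
      using sum_squares_bound[of "cmod (x n)" "cmod c * cmod (y n)"]
      by (simp add: power2_sum power_mult_distrib)
    show "summable (\<lambda>n. (cmod (x n + c * y n))\<^sup>2)" using xy by (simp add: ell2_def)
  qed (intro summable_add summable_mult s)
  also have "\<dots> = 2 * (\<Sum>n. (cmod (x n))\<^sup>2) + 2 * (cmod c)\<^sup>2 * (\<Sum>n. (cmod (y n))\<^sup>2)"
    using s by (simp add: suminf_add[symmetric] suminf_mult summable_mult mult.assoc)
  finally show ?thesis by (simp add: ell2_norm_power2 x y xy)
qed

lemma ell2_finite_support: "finite {n. x n \<noteq> 0} \<Longrightarrow> x \<in> ell2"
  unfolding ell2_def by (auto intro!: summable_finite[of "{n. x n \<noteq> 0}"])

lemma finite_support_basis_vec: "finite {n. basis_vec k n \<noteq> 0}"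
  by (rule finite_subset[of _ "{k}"]) (auto simp: basis_vec_def)

lemma basis_vec_ell2 [simp]: "basis_vec k \<in> ell2"
  by (intro ell2_finite_support finite_support_basis_vec)

lemma ell2_inner_summable: "x \<in> ell2 \<Longrightarrow> y \<in> ell2 \<Longrightarrow> summable (\<lambda>n. x n * cnj (y n))"
  by (rule summable_norm_cancel[OF ell2_summable_mult])

lemma ell2_inner_basis_vec: "ell2_inner x (basis_vec n) = x n"
proof -
  have "(\<lambda>k. x k * cnj (basis_vec n k)) = (\<lambda>k. if k = n then x k else 0)"
    by (auto simp: basis_vec_def)
  then show ?thesis unfolding ell2_inner_def
    using sums_single[of n x] by (simp add: sums_iff)
qed

lemma ell2_inner_cnj:
  assumes "x \<in> ell2" "y \<in> ell2"
  shows "cnj (ell2_inner x y) = ell2_inner y x"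
  using bounded_linear.suminf[OF bounded_linear_cnj ell2_inner_summable[OF assms]]
  by (simp add: ell2_inner_def mult.commute)

lemma ell2_inner_add_scaled:
  assumes "x \<in> ell2" "y \<in> ell2" "z \<in> ell2"
  shows "ell2_inner (\<lambda>n. x n + c * y n) z = ell2_inner x z + c * ell2_inner y z"
proof -
  have "(\<lambda>n. (x n + c * y n) * cnj (z n)) = (\<lambda>n. x n * cnj (z n) + c * (y n * cnj (z n)))"
    by (simp add: algebra_simps)
  then show ?thesis unfolding ell2_inner_def
    using ell2_inner_summable assms by (simp add: suminf_add[symmetric] suminf_mult summable_mult)
qed

lemma ell2_inner_scale:
  assumes "y \<in> ell2" "z \<in> ell2"
  shows "ell2_inner (\<lambda>n. c * y n) z = c * ell2_inner y z"
proof -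
  have "(\<lambda>n. c * y n * cnj (z n)) = (\<lambda>n. c * (y n * cnj (z n)))" by (simp add: mult.assoc)
  then show ?thesis unfolding ell2_inner_def
    using ell2_inner_summable assms by (simp add: suminf_mult)
qed

lemma ell2_inner_add_scaled_right:
  assumes "x \<in> ell2" "y \<in> ell2" "z \<in> ell2"
  shows "ell2_inner z (\<lambda>n. x n + c * y n) = ell2_inner z x + cnj c * ell2_inner z y"
  using arg_cong[OF ell2_inner_add_scaled[OF assms, of c], of cnj] assms
  by (simp add: ell2_inner_cnj ell2_add ell2_scale)

lemma ell2_inner_scale_right:
  assumes "y \<in> ell2" "z \<in> ell2"
  shows "ell2_inner z (\<lambda>n. c * y n) = cnj c * ell2_inner z y"
  using arg_cong[OF ell2_inner_scale[OF assms, of c], of cnj] assms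
  by (simp add: ell2_inner_cnj ell2_scale)

lemma ell2_norm_basis_vec [simp]: "ell2_norm (basis_vec k) = 1"
proof -
  have "complex_of_real ((ell2_norm (basis_vec k))\<^sup>2) = of_real 1"
    unfolding ell2_inner_self[OF basis_vec_ell2, symmetric] ell2_inner_basis_vec
    by (simp add: basis_vec_def)
  then have "(ell2_norm (basis_vec k))\<^sup>2 = 1" by (simp only: of_real_eq_iff)
  then show ?thesis using ell2_norm_nonneg[OF basis_vec_ell2, of k] by (simp add: power2_eq_1_iff)
qed

section \<open>Limits in the sequence space and the closed operator\<close>

lemma ell2_lim_component:
  assumes "ell2_lim u x"
  shows "(\<lambda>k. u k n) \<longlonglongrightarrow> x n"
proof -
  have "(\<lambda>k. u k n - x n) \<longlonglongrightarrow> 0"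
  proof (rule Lim_null_comparison)
    show "\<forall>\<^sub>F k in sequentially. norm (u k n - x n) \<le> ell2_norm (\<lambda>n. u k n - x n)"
      using assms ell2_component_le[OF ell2_diff, of "u _" x n] by (auto simp: ell2_lim_def)
  qed (use assms in \<open>simp add: ell2_lim_def\<close>)
  then show ?thesis by (simp add: LIM_zero_iff)
qed

lemma ell2_lim_const: "x \<in> ell2 \<Longrightarrow> ell2_lim (\<lambda>_. x) x"
  by (simp add: ell2_lim_def ell2_norm_def)

lemma ell2_lim_add_scaled:
  assumes u: "ell2_lim u x" and v: "ell2_lim v y"
  shows "ell2_lim (\<lambda>k n. u k n + c * v k n) (\<lambda>n. x n + c * y n)"
proof -
  let ?N = "\<lambda>k. ell2_norm (\<lambda>n. (u k n + c * v k n) - (x n + c * y n))"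
  have m: "u k \<in> ell2" "v k \<in> ell2" "x \<in> ell2" "y \<in> ell2" for k using u v by (auto simp: ell2_lim_def)
  have l: "(\<lambda>k. ell2_norm (\<lambda>n. u k n - x n)) \<longlonglongrightarrow> 0" "(\<lambda>k. ell2_norm (\<lambda>n. v k n - y n)) \<longlonglongrightarrow> 0"
    using u v by (auto simp: ell2_lim_def)
  have "(\<lambda>k. (?N k)\<^sup>2) \<longlonglongrightarrow> 0"
  proof (rule Lim_null_comparison)
    have "(\<lambda>k. 2 * (ell2_norm (\<lambda>n. u k n - x n))\<^sup>2 + 2 * (cmod c)\<^sup>2 * (ell2_norm (\<lambda>n. v k n - y
        n))\<^sup>2) \<longlonglongrightarrow> 2 * 0\<^sup>2 + 2 * (cmod c)\<^sup>2 * 0\<^sup>2"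
      by (intro tendsto_intros l)
    then show "(\<lambda>k. 2 * (ell2_norm (\<lambda>n. u k n - x n))\<^sup>2 + 2 * (cmod c)\<^sup>2 * (ell2_norm (\<lambda>n. v k n - y
        n))\<^sup>2) \<longlonglongrightarrow> 0"
      by simp
    have "?N k = ell2_norm (\<lambda>n. (u k n - x n) + c * (v k n - y n))" for k
      by (simp add: algebra_simps)
    then show "\<forall>\<^sub>F k in sequentially. norm ((?N k)\<^sup>2) \<le>
        2 * (ell2_norm (\<lambda>n. u k n - x n))\<^sup>2 + 2 * (cmod c)\<^sup>2 * (ell2_norm (\<lambda>n. v k n - y n))\<^sup>2"
      using ell2_norm_add_scaled[OF ell2_diff ell2_diff] m by simp
  qed
  then have "(\<lambda>k. sqrt ((?N k)\<^sup>2)) \<longlonglongrightarrow> sqrt 0" by (intro tendsto_real_sqrt)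
  then show ?thesis unfolding ell2_lim_def using m by (simp add: ell2_add ell2_scale
      tendsto_rabs_zero_iff)
qed

lemma jacobi_finite_iff: "(u, v) \<in> jacobi_finite b \<longleftrightarrow> finite {n. u n \<noteq> 0} \<and> v = jacobi_apply b u"
  by (auto simp: jacobi_finite_def)

lemma op_closureI:
  "(\<And>k. (u k, v k) \<in> G) \<Longrightarrow> ell2_lim u x \<Longrightarrow> ell2_lim v y \<Longrightarrow> (x, y) \<in> op_closure G"
  unfolding op_closure_def by blast

text \<open>Convergence in norm implies convergence of entries, and each entry of
  \<open>jacobi_apply b u\<close> involves at most two entries of u; hence the closure still acts by
  the formal matrix.\<close>

lemma jacobi_operatorD:
  assumes "(x, y) \<in> jacobi_operator b"
  shows "x \<in> ell2" "y \<in> ell2" "y = jacobi_apply b x"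
proof -
  obtain u v where uv: "\<And>k. (u k, v k) \<in> jacobi_finite b" "ell2_lim u x" "ell2_lim v y"
    using assms by (auto simp: jacobi_operator_def op_closure_def)
  show "x \<in> ell2" "y \<in> ell2" using uv by (auto simp: ell2_lim_def)
  have v: "v k = jacobi_apply b (u k)" for k using uv(1)[of k] by (simp add: jacobi_finite_iff)
  show "y = jacobi_apply b x"
  proof
    fix n
    have "(\<lambda>k. v k n) \<longlonglongrightarrow> jacobi_apply b x n"
      unfolding v jacobi_apply_def
      by (cases n) (auto intro!: tendsto_intros ell2_lim_component[OF uv(2)])
    then show "y n = jacobi_apply b x n" using ell2_lim_component[OF uv(3), of n] by (rule
        LIMSEQ_unique[rotated])
  qed
qed

text \<open>Linearity of the closure, so that the quadratic form may be evaluated at combinations of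
  a basis vector and a projected vector.\<close>

lemma jacobi_operator_add_scaled:
  assumes "(x, y) \<in> jacobi_operator b" "(x', y') \<in> jacobi_operator b"
  shows "(\<lambda>n. x n + c * x' n, \<lambda>n. y n + c * y' n) \<in> jacobi_operator b"
proof -
  obtain u v where uv: "\<And>k. (u k, v k) \<in> jacobi_finite b" "ell2_lim u x" "ell2_lim v y"
    using assms(1) by (auto simp: jacobi_operator_def op_closure_def)
  obtain u' v' where uv': "\<And>k. (u' k, v' k) \<in> jacobi_finite b" "ell2_lim u' x'" "ell2_lim v' y'"
    using assms(2) by (auto simp: jacobi_operator_def op_closure_def)
  have "(\<lambda>n. u k n + c * u' k n, \<lambda>n. v k n + c * v' k n) \<in> jacobi_finite b" for k
  proof -
    have fin: "finite {n. u k n \<noteq> 0}" "finite {n. u' k n \<noteq> 0}" and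
      v: "v k = jacobi_apply b (u k)" "v' k = jacobi_apply b (u' k)"
      using uv(1)[of k] uv'(1)[of k] unfolding jacobi_finite_iff by blast+
    have "finite {n. u k n + c * u' k n \<noteq> 0}"
      by (rule finite_subset[OF _ finite_UnI[OF fin]]) auto
    moreover have "(\<lambda>n. v k n + c * v' k n) = jacobi_apply b (\<lambda>n. u k n + c * u' k n)"
      by (rule ext) (simp only: v jacobi_apply_add_scaled)
    ultimately show ?thesis unfolding jacobi_finite_iff by blast
  qed
  then show ?thesis unfolding jacobi_operator_def
    by (rule op_closureI[OF _ ell2_lim_add_scaled[OF uv(2) uv'(2)] ell2_lim_add_scaled[OF uv(3)
        uv'(3)]])
qed

lemma jacobi_operator_basis_vec: "(basis_vec n, jacobi_apply b (basis_vec n)) \<in> jacobi_operator b"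
proof -
  have "finite {k. jacobi_apply b (basis_vec n) k \<noteq> 0}"
    by (rule finite_subset[of _ "{..Suc n}"])
       (auto simp: jacobi_apply_def basis_vec_def split: if_splits)
  then have "jacobi_apply b (basis_vec n) \<in> ell2" by (rule ell2_finite_support)
  moreover have "(basis_vec n, jacobi_apply b (basis_vec n)) \<in> jacobi_finite b"
    unfolding jacobi_finite_iff using finite_support_basis_vec by blast
  ultimately show ?thesis unfolding jacobi_operator_def
    by (intro op_closureI[where u = "\<lambda>_. basis_vec n" and v = "\<lambda>_. jacobi_apply b (basis_vec n)"]
         ell2_lim_const basis_vec_ell2)
qed

lemma ell2_inner_jacobi_apply_basis_vec:
  assumes "x \<in> ell2"
  shows "ell2_inner x (jacobi_apply b (basis_vec n)) = jacobi_apply b x n"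
proof (cases n)
  case 0
  then show ?thesis using assms
    by (simp add: jacobi_apply_basis_vec_0 ell2_inner_scale_right ell2_inner_basis_vec jacobi_apply_def)
next
  case (Suc m)
  have "jacobi_apply b (basis_vec n) =
      (\<lambda>k. of_real (b m) * basis_vec m k + of_real (b n) * basis_vec (Suc n) k)"
    using jacobi_apply_basis_vec[of n b] Suc by simp
  moreover have "ell2_inner x (\<lambda>k. of_real (b m) * basis_vec m k) = of_real (b m) * x m"
    using assms by (simp add: ell2_inner_scale_right ell2_inner_basis_vec)
  ultimately show ?thesis using Suc assms
    by (simp add: ell2_inner_add_scaled_right ell2_scale ell2_inner_basis_vec jacobi_apply_def)
qed

section \<open>The resolvent of the first basis vector\<close>

lemma jacobi_apply_sum:
  "jacobi_apply b (\<lambda>n. \<Sum>j<M. c j * x j n) n = (\<Sum>j<M. c j * jacobi_apply b (x j) n)"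
  by (simp add: jacobi_apply_def sum_distrib_left sum.distrib[symmetric] algebra_simps)

lemma resolvent_coeff_le: "Im z > 0 \<Longrightarrow> cmod (1 / (complex_of_real t - z)) \<le> 1 / Im z"
  using abs_Im_le_cmod[of "complex_of_real t - z"] unfolding norm_divide by (intro frac_le) auto

lemma cmod_diff_resolvents:
  assumes z: "Im z > 0"
  shows "cmod (1 / (complex_of_real s - z) - 1 / (complex_of_real t - z)) \<le> \<bar>t - s\<bar> / (Im z)\<^sup>2"
proof -
  have nz: "complex_of_real u - z \<noteq> 0" for u using z by (auto simp: complex_eq_iff)
  have "1 / (complex_of_real s - z) - 1 / (complex_of_real t - z)
      = of_real (t - s) * (1 / (complex_of_real s - z)) * (1 / (complex_of_real t - z))"
    using nz[of s] nz[of t] by (simp add: field_simps)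
  also have "cmod \<dots> = \<bar>t - s\<bar> * (cmod (1 / (complex_of_real s - z)) * cmod (1 / (complex_of_real t -
      z)))"
    by (simp only: norm_mult norm_of_real mult.assoc)
  also have "\<dots> \<le> \<bar>t - s\<bar> * (1 / Im z * (1 / Im z))"
    by (intro mult_left_mono mult_mono resolvent_coeff_le z) (use z in auto)
  finally show ?thesis by (simp add: power2_eq_square)
qed

section \<open>A partition of the line into short cells\<close>

text \<open>Indexing by a floor makes disjointness immediate and hands each point its index. The
  constraint - K <= t keeps the floor nonnegative, so \<open>nat\<close> does not truncate;
  \<open>node\<close> is the left end of the cell.\<close>

definition cell :: "nat \<Rightarrow> nat \<Rightarrow> real set" where
  "cell K j = {t. - real K \<le> t \<and> t < real K \<and> nat \<lfloor>(real K)\<^sup>2 * (t + real K)\<rfloor> = j}"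

definition node :: "nat \<Rightarrow> nat \<Rightarrow> real" where
  "node K j = real j / (real K)\<^sup>2 - real K"

lemma cell_borel [measurable]: "cell K j \<in> sets borel"
  unfolding cell_def by measurable

lemma cell_disjoint: "i \<noteq> j \<Longrightarrow> cell K i \<inter> cell K j = {}"
  by (auto simp: cell_def)

lemma cell_node:
  assumes "t \<in> cell K j" "K > 0"
  shows "\<bar>t - node K j\<bar> \<le> 1 / (real K)\<^sup>2"
proof -
  have nn: "0 \<le> (real K)\<^sup>2 * (t + real K)" using assms by (auto simp: cell_def intro!:
      mult_nonneg_nonneg)
  then have "real j \<le> (real K)\<^sup>2 * (t + real K)" "(real K)\<^sup>2 * (t + real K) < real j + 1"
    using assms by (auto simp: cell_def of_nat_nat)
  then have "real j / (real K)\<^sup>2 \<le> t + real K" "t + real K < real j / (real K)\<^sup>2 + 1 / (real K)\<^sup>2"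
    using assms(2) by (auto simp: field_simps)
  then show ?thesis unfolding node_def by linarith
qed

lemma cell_index:
  assumes "- real K \<le> t" "t < real K"
  shows "t \<in> cell K (nat \<lfloor>(real K)\<^sup>2 * (t + real K)\<rfloor>)" "nat \<lfloor>(real K)\<^sup>2 * (t + real K)\<rfloor> < 2 * K ^ 3"
proof -
  show "t \<in> cell K (nat \<lfloor>(real K)\<^sup>2 * (t + real K)\<rfloor>)" using assms by (simp add: cell_def)
  have K: "real K > 0" using assms by linarith
  have "(real K)\<^sup>2 * (t + real K) < (real K)\<^sup>2 * (2 * real K)"
    using assms K by (intro mult_strict_left_mono) auto
  also have "\<dots> = real (2 * K ^ 3)" by (simp add: power2_eq_square power3_eq_cube)
  finally have "\<lfloor>(real K)\<^sup>2 * (t + real K)\<rfloor> < int (2 * K ^ 3)" by (simp add: floor_less_iff)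
  then show "nat \<lfloor>(real K)\<^sup>2 * (t + real K)\<rfloor> < 2 * K ^ 3"
    using K by (subst nat_less_iff) (use assms in \<open>auto intro!: mult_nonneg_nonneg\<close>)
qed

lemma cell_Union: "(\<Union>j<2 * K ^ 3. cell K j) = {- real K..<real K}"
  using cell_index[of K] by (fastforce simp: cell_def)

lemma cell_empty: "j \<ge> 2 * K ^ 3 \<Longrightarrow> cell K j = {}"
  using cell_index(2)[of K] by (force simp: cell_def)

locale jacobi_resolution = jacobi_weights +
  fixes E :: "real set \<Rightarrow> (nat \<Rightarrow> complex) \<Rightarrow> (nat \<Rightarrow> complex)"
  assumes resolution: "is_spectral_resolution (jacobi_operator b) E"
begin

section \<open>Spectral projections and the quadratic form\<close>

lemma pvm: "projection_valued_measure E"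
  using resolution by (simp add: is_spectral_resolution_def)

lemma projection: "B \<in> sets borel \<Longrightarrow> orth_projection (E B)"
  using pvm by (simp add: projection_valued_measure_def)

lemma E_ell2 [simp]: "B \<in> sets borel \<Longrightarrow> x \<in> ell2 \<Longrightarrow> E B x \<in> ell2"
  using projection[of B] by (simp add: orth_projection_def)

lemma E_sym: "B \<in> sets borel \<Longrightarrow> x \<in> ell2 \<Longrightarrow> y \<in> ell2 \<Longrightarrow> ell2_inner (E B x) y = ell2_inner x (E B y)"
  using projection[of B] by (simp add: orth_projection_def)

lemma E_UNIV: "x \<in> ell2 \<Longrightarrow> E UNIV x = x"
  using pvm by (simp add: projection_valued_measure_def)

lemma E_Int: "B \<in> sets borel \<Longrightarrow> C \<in> sets borel \<Longrightarrow> x \<in> ell2 \<Longrightarrow> E B (E C x) = E (B \<inter> C) x"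
  using pvm by (simp add: projection_valued_measure_def)

abbreviation "spec \<equiv> spectral_measure E"

lemma emeasure_spec:
  assumes "x \<in> ell2" "B \<in> sets borel"
  shows "emeasure (spec x) B = ennreal ((ell2_norm (E B x))\<^sup>2)"
  using emeasure_spectral_measure(1)[OF pvm assms] orth_projection_inner[OF projection[OF assms(2)]
      assms(1)]
  by simp

lemma finite_measure_spec: "x \<in> ell2 \<Longrightarrow> finite_measure (spec x)"
  by (rule finite_measureI) (simp add: emeasure_spec)

lemma measure_spec:
  assumes "x \<in> ell2" "B \<in> sets borel"
  shows "measure (spec x) B = (ell2_norm (E B x))\<^sup>2"
  using emeasure_spec[OF assms] by (simp add: measure_def)

lemma measure_spec_UNIV: "x \<in> ell2 \<Longrightarrow> measure (spec x) UNIV = (ell2_norm x)\<^sup>2"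
  by (simp add: measure_spec E_UNIV)

lemma E_empty: assumes "x \<in> ell2" shows "E {} x = (\<lambda>_. 0)"
proof
  fix n
  have "ell2_norm (E {} x) = 0" using measure_spec[OF assms, of "{}"] by simp
  then show "E {} x n = 0" using ell2_component_le[of "E {} x" n] assms by simp
qed

text \<open>Multiplicativity E(B) E(I) = E(B \<inter> I) means that projecting the vector restricts
  its spectral measure.\<close>

lemma spec_E:
  assumes "x \<in> ell2" "I \<in> sets borel"
  shows "spec (E I x) = density (spec x) (\<lambda>t. ennreal (indicator I t))"
proof (rule measure_eqI)
  fix B assume "B \<in> sets (spec (E I x))"
  then have B: "B \<in> sets borel" by simp
  have "emeasure (density (spec x) (\<lambda>t. ennreal (indicator I t))) B =
      (\<integral>\<^sup>+ t. ennreal (indicator I t) * indicator B t \<partial>spec x)"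
    using B assms(2) by (intro emeasure_density) auto
  also have "\<dots> = (\<integral>\<^sup>+ t. indicator (B \<inter> I) t \<partial>spec x)"
    by (intro nn_integral_cong) (auto simp: indicator_def)
  also have "\<dots> = emeasure (spec x) (B \<inter> I)" using B assms(2) by simp
  finally show "emeasure (spec (E I x)) B = emeasure (density (spec x) (\<lambda>t. ennreal (indicator I t))) B"
    using assms B by (simp add: emeasure_spec E_Int)
qed simp

lemma domain_iff: "x \<in> Domain (jacobi_operator b) \<longleftrightarrow>
    x \<in> ell2 \<and> (\<integral>\<^sup>+ t. ennreal (t\<^sup>2) \<partial>spec x) < \<infinity>"
  using resolution by (auto simp: is_spectral_resolution_def)

text \<open>Integrability is recorded separately because the Bochner integral of a nonintegrable
  function is 0 by convention. It follows from |t| <= t^2 + 1, the second moment being finite on the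
  domain.\<close>

lemma form:
  assumes "(x, y) \<in> jacobi_operator b"
  shows "Re (ell2_inner y x) = (\<integral> t. t \<partial>spec x)" "integrable (spec x) (\<lambda>t. t)"
proof -
  have "\<forall>(x, y)\<in>jacobi_operator b. ell2_inner y x = of_real (\<integral> t. t \<partial>spec x)"
    using resolution by (simp add: is_spectral_resolution_def)
  with assms show "Re (ell2_inner y x) = (\<integral> t. t \<partial>spec x)" by fastforce
  have "x \<in> Domain (jacobi_operator b)" using assms by blast
  then have x: "x \<in> ell2" and fin: "(\<integral>\<^sup>+ t. ennreal (t\<^sup>2) \<partial>spec x) < \<infinity>" by (auto simp: domain_iff)
  interpret finite_measure "spec x" by (rule finite_measure_spec[OF x])
  have sq: "integrable (spec x) (\<lambda>t. t\<^sup>2)"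
    by (rule integrableI_nonneg) (use fin in \<open>auto simp: top.not_eq_extremum\<close>)
  show "integrable (spec x) (\<lambda>t. t)"
  proof (rule Bochner_Integration.integrable_bound)
    show "integrable (spec x) (\<lambda>t. t\<^sup>2 + 1)" by (intro Bochner_Integration.integrable_add sq
        integrable_const)
    show "AE t in spec x. norm t \<le> norm (t\<^sup>2 + 1)"
    proof (rule AE_I2)
      fix t :: real
      have "0 \<le> (\<bar>t\<bar> - 1)\<^sup>2" by simp
      then have "2 * \<bar>t\<bar> \<le> t\<^sup>2 + 1" unfolding power2_diff by simp
      then show "norm t \<le> norm (t\<^sup>2 + 1)" by simp
    qed
  qed simp
qed

text \<open>The second moment of the restricted measure is at most T^2 times the total mass. Once
  the vector is in the domain, its image can only be the formal one.\<close>

lemma E_bounded_in_domain: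
  assumes x: "x \<in> ell2" and I: "I \<in> sets borel" "I \<subseteq> {-T..T}"
  shows "(E I x, jacobi_apply b (E I x)) \<in> jacobi_operator b"
proof -
  have "(\<integral>\<^sup>+ t. ennreal (t\<^sup>2) \<partial>spec (E I x)) = (\<integral>\<^sup>+ t. ennreal (indicator I t) * ennreal (t\<^sup>2) \<partial>spec x)"
    unfolding spec_E[OF x I(1)] using I(1) by (intro nn_integral_density) auto
  also have "\<dots> \<le> (\<integral>\<^sup>+ t. ennreal (T\<^sup>2) \<partial>spec x)"
  proof (rule nn_integral_mono)
    fix t
    have "t\<^sup>2 \<le> T\<^sup>2" if "t \<in> I"
    proof -
      have "\<bar>t\<bar> \<le> T" using that I(2) by force
      then show ?thesis by (rule abs_le_square_iff[THEN iffD1, OF order_trans[OF _ abs_ge_self]])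
    qed
    then show "ennreal (indicator I t) * ennreal (t\<^sup>2) \<le> ennreal (T\<^sup>2)"
      by (auto simp: indicator_def intro!: ennreal_leI)
  qed
  also have "\<dots> < \<infinity>"
    using emeasure_spec[OF x, of UNIV] by (simp add: ennreal_mult_less_top)
  finally have "E I x \<in> Domain (jacobi_operator b)" using x I by (simp add: domain_iff)
  then obtain y where "(E I x, y) \<in> jacobi_operator b" by blast
  with jacobi_operatorD(3)[OF this] show ?thesis by simp
qed

text \<open>\<open>\<langle>(A - t0) x, x\<rangle>\<close> for \<open>(x, y)\<close> in the graph.\<close>

definition shifted_form :: "real \<Rightarrow> (nat \<Rightarrow> complex) \<Rightarrow> (nat \<Rightarrow> complex) \<Rightarrow> real" where
  "shifted_form t0 x y = Re (ell2_inner y x) - t0 * (ell2_norm x)\<^sup>2"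

lemma shifted_form_integral:
  assumes xy: "(x, y) \<in> jacobi_operator b" and I: "I \<in> sets borel"
  shows "shifted_form t0 x y =
     (\<integral> t. indicator I t * (t - t0) \<partial>spec x) + (\<integral> t. indicator (- I) t * (t - t0) \<partial>spec x)"
proof -
  have x: "x \<in> ell2" by (rule jacobi_operatorD(1)[OF xy])
  interpret finite_measure "spec x" by (rule finite_measure_spec[OF x])
  have i: "integrable (spec x) (\<lambda>t. t - t0)" by (intro Bochner_Integration.integrable_diff
      form(2)[OF xy] integrable_const)
  have "shifted_form t0 x y = (\<integral> t. t - t0 \<partial>spec x)"
    unfolding shifted_form_def form(1)[OF xy]
    by (subst Bochner_Integration.integral_diff[OF form(2)[OF xy] integrable_const]) (simp add:
        measure_spec_UNIV[OF x])
  also have "\<dots> = (\<integral> t. indicator I t * (t - t0) + indicator (- I) t * (t - t0) \<partial>spec x)"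
    by (intro Bochner_Integration.integral_cong) (auto simp: indicator_def)
  also have "\<dots> = (\<integral> t. indicator I t * (t - t0) \<partial>spec x) + (\<integral> t. indicator (- I) t * (t - t0) \<partial>spec x)"
    using I by (intro Bochner_Integration.integral_add integrable_mult_indicator[OF _ i,
        simplified]) auto
  finally show ?thesis .
qed

lemma local_integral_bound:
  assumes x: "x \<in> ell2" and I: "I \<in> sets borel" "\<And>t. t \<in> I \<Longrightarrow> \<bar>t - t0\<bar> \<le> \<delta>" and \<delta>: "0 \<le> \<delta>"
  shows "\<bar>\<integral> t. indicator I t * (t - t0) \<partial>spec x\<bar> \<le> \<delta> * (ell2_norm x)\<^sup>2"
proof -
  interpret finite_measure "spec x" by (rule finite_measure_spec[OF x])
  have b: "\<bar>indicator I t * (t - t0)\<bar> \<le> \<delta>" for t using I(2)[of t] \<delta> by (auto simp: indicator_def)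
  have [measurable]: "I \<in> sets borel" by fact
  have i: "integrable (spec x) (\<lambda>t. indicator I t * (t - t0))"
    by (rule integrable_const_bound[where B = \<delta>]) (use b in auto)
  have "\<bar>\<integral> t. indicator I t * (t - t0) \<partial>spec x\<bar> \<le> (\<integral> t. \<bar>indicator I t * (t - t0)\<bar> \<partial>spec x)"
    by (rule integral_abs_bound)
  also have "\<dots> \<le> (\<integral> t. \<delta> \<partial>spec x)"
    by (intro integral_mono integrable_abs i integrable_const b)
  also have "\<dots> = \<delta> * (ell2_norm x)\<^sup>2" by (simp add: measure_spec_UNIV[OF x])
  finally show ?thesis .
qed

text \<open>For C disjoint from I the projection E(C) annihilates E(I)x, so both cross terms and the
  square of the added vector drop out of the spectral measure of C.\<close>

lemma complement_integral_eq:
  assumes u: "u \<in> ell2" and x: "x \<in> ell2" and I: "I \<in> sets borel"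
  shows "(\<integral> t. indicator (- I) t * (t - t0) \<partial>spec (\<lambda>n. u n + c * E I x n)) =
         (\<integral> t. indicator (- I) t * (t - t0) \<partial>spec u)"
proof -
  define w where "w = (\<lambda>n. u n + c * E I x n)"
  have w: "w \<in> ell2" unfolding w_def by (intro ell2_add ell2_scale E_ell2 u x I)
  have "density (spec w) (\<lambda>t. ennreal (indicator (- I) t)) = density (spec u) (\<lambda>t. ennreal
      (indicator (- I) t))"
    unfolding spec_E[OF w borel_comp[OF I], symmetric] spec_E[OF u borel_comp[OF I], symmetric]
  proof (rule measure_eqI)
    fix B assume "B \<in> sets (spec (E (- I) w))"
    then have B: "B \<in> sets borel" by simp
    define C where "C = B \<inter> - I"
    have C: "C \<in> sets borel" "C \<inter> I = {}" using B I by (auto simp: C_def)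
    have 0: "E C (E I x) = (\<lambda>_. 0)" using C I x by (simp add: E_Int E_empty)
    have z: "ell2_inner (\<lambda>_. 0) v = 0" "ell2_inner v (\<lambda>_. 0) = 0" for v by (simp_all add:
        ell2_inner_def)
    have "ell2_inner (E C w) w = ell2_inner w (E C w)" using C w by (simp add: E_sym)
    also have "\<dots> = ell2_inner u (E C w) + c * ell2_inner (E I x) (E C w)"
      unfolding w_def by (rule ell2_inner_add_scaled) (use u x I C w in \<open>auto simp: w_def[symmetric]\<close>)
    also have "\<dots> = ell2_inner (E C u) w"
      using C u w x I by (simp add: E_sym[symmetric] 0 z)
    also have "\<dots> = ell2_inner (E C u) u + cnj c * ell2_inner (E C u) (E I x)"
      unfolding w_def by (rule ell2_inner_add_scaled_right) (use u x I C in auto)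
    also have "\<dots> = ell2_inner (E C u) u"
      using C u x I by (simp add: E_sym 0 z)
    finally have "emeasure (spec w) C = emeasure (spec u) C"
      using emeasure_spectral_measure(1)[OF pvm w C(1)] emeasure_spectral_measure(1)[OF pvm u C(1)]
          by simp
    then show "emeasure (spec (E (- I) w)) B = emeasure (spec (E (- I) u)) B"
      using w u B I C by (simp add: emeasure_spec E_Int C_def)
  qed simp
  then have "(\<integral> t. t - t0 \<partial>density (spec w) (\<lambda>t. ennreal (indicator (- I) t))) =
     (\<integral> t. t - t0 \<partial>density (spec u) (\<lambda>t. ennreal (indicator (- I) t)))" by simp
  then show ?thesis unfolding w_def using I by (subst (asm) (1 2) integral_density) auto
qed

text \<open>\<open>A - t0\<close> is small on the range of \<open>E I\<close> for a short interval \<open>I\<close> around \<open>t0\<close>. This is read off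
  the quadratic form at \<open>e\<^sub>n + c E(I)x\<close>: the part of the form outside \<open>I\<close> does not depend on \<open>c\<close>, and
  the phase of \<open>c\<close> is chosen so that the cross term is real.\<close>

lemma approximate_eigenvector:
  fixes t0 \<delta> :: real
  assumes x: "x \<in> ell2" and I: "I \<in> sets borel" "\<And>t. t \<in> I \<Longrightarrow> \<bar>t - t0\<bar> \<le> \<delta>" and \<delta>: "0 \<le> \<delta>"
  shows "cmod (jacobi_apply b (E I x) n - t0 * E I x n) \<le> 3 * \<delta> * ell2_norm (E I x)"
proof -
  define X where "X = E I x"
  define Y where "Y = jacobi_apply b X"
  define a where "a = Y n - t0 * X n"
  define r where "r = ell2_norm X"
  have X: "X \<in> ell2" unfolding X_def by (intro E_ell2 x I)
  have "I \<subseteq> {-(\<bar>t0\<bar> + \<delta>)..\<bar>t0\<bar> + \<delta>}" using I(2) by (force simp: abs_le_iff)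
  then have XY: "(X, Y) \<in> jacobi_operator b"
    unfolding X_def Y_def by (rule E_bounded_in_domain[OF x I(1)])
  have Y: "Y \<in> ell2" by (rule jacobi_operatorD(2)[OF XY])
  show ?thesis unfolding X_def[symmetric] Y_def[symmetric] a_def[symmetric] r_def[symmetric]
  proof (cases "r = 0 \<or> a = 0")
    case True
    have "a = 0" if "r = 0"
    proof -
      have "X k = 0" for k using ell2_component_le[OF X, of k] that by (simp add: r_def)
      then show ?thesis by (simp add: a_def Y_def jacobi_apply_def)
    qed
    with True show "cmod a \<le> 3 * \<delta> * r" using \<delta> ell2_norm_nonneg[OF X] by (auto simp: r_def)
  next
    case False
    then have r: "r > 0" and a: "a \<noteq> 0" using ell2_norm_nonneg[OF X] by (auto simp: r_def)
    \<comment> \<open>The modulus 1 / r makes c X a unit vector, so both quadratic terms stay of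
      order 1; the phase turns c a into the positive number |a| / r.\<close>
    define c where "c = cnj a / (cmod a * r)"
    have c: "cmod c = 1 / r" using r a by (simp add: c_def norm_divide norm_mult)
    have ca: "Re (c * a) = cmod a / r"
    proof -
      have "c * a = (a * cnj a) / (cmod a * r)" by (simp add: c_def mult.commute)
      also have "\<dots> = of_real (cmod a / r)"
        using r a by (simp add: complex_norm_square[symmetric] power2_eq_square)
      finally show ?thesis by simp
    qed
    define e where "e = basis_vec n"
    define J where "J = jacobi_apply b e"
    have eJ: "(e, J) \<in> jacobi_operator b" unfolding e_def J_def by (rule jacobi_operator_basis_vec)
    have e: "e \<in> ell2" and J: "J \<in> ell2" using jacobi_operatorD[OF eJ] by auto
    define w where "w = (\<lambda>k. e k + c * X k)"
    define W where "W = (\<lambda>k. J k + c * Y k)"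
    have wW: "(w, W) \<in> jacobi_operator b" unfolding w_def W_def by (rule
        jacobi_operator_add_scaled[OF eJ XY])
    have w: "w \<in> ell2" and W: "W \<in> ell2" using jacobi_operatorD[OF wW] by auto
    have Ye: "ell2_inner Y e = Y n" and Xe: "ell2_inner X e = X n" by (simp_all add: e_def
        ell2_inner_basis_vec)
    have "ell2_inner X J = Y n"
      unfolding J_def e_def Y_def by (rule ell2_inner_jacobi_apply_basis_vec[OF X])
    then have JX: "ell2_inner J X = cnj (Y n)" using ell2_inner_cnj[OF X J] by simp
    have eX: "ell2_inner e X = cnj (X n)" using ell2_inner_cnj[OF X e] Xe by simp
    have form_w: "ell2_inner W w = ell2_inner J e + cnj c * cnj (Y n) + c * Y n + c * cnj c *
        ell2_inner Y X"
      unfolding W_def using ell2_inner_add_scaled[OF J Y w, of c]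
      by (simp add: w_def ell2_inner_add_scaled_right e X J Y JX Ye algebra_simps)
    have norm_w: "ell2_inner w w = ell2_inner e e + cnj c * cnj (X n) + c * X n + c * cnj c *
        ell2_inner X X"
      using ell2_inner_add_scaled[OF e X w, of c]
      by (simp add: w_def ell2_inner_add_scaled_right e X eX Xe algebra_simps)
    have nsq: "(ell2_norm v)\<^sup>2 = Re (ell2_inner v v)" if "v \<in> ell2" for v using ell2_inner_self[OF
        that] by simp
    have ReJe: "Re (cnj c * cnj v) = Re (c * v)" for v by simp
    have cc: "Re (c * cnj c * v) = (cmod c)\<^sup>2 * Re v" for v
    proof -
      have "c * cnj c * v = of_real ((cmod c)\<^sup>2) * v" by (simp only: complex_norm_square)
      moreover have "Re (complex_of_real s * v) = s * Re v" for s by simp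
      ultimately show ?thesis by (simp only:)
    qed
    have expand: "shifted_form t0 w W = shifted_form t0 e J + (cmod c)\<^sup>2 * shifted_form t0 X Y + 2 *
        Re (c * a)"
      unfolding shifted_form_def nsq[OF w] nsq[OF e] nsq[OF X] form_w norm_w
      unfolding plus_complex.simps(1) cc ReJe a_def
      by (simp add: algebra_simps)
    have nw: "(ell2_norm w)\<^sup>2 \<le> 4"
      using ell2_norm_add_scaled[OF e X, of c] c r by (simp add: w_def e_def r_def[symmetric]
          power_divide)
    have sw: "shifted_form t0 w W = (\<integral> t. indicator I t * (t - t0) \<partial>spec w) + (\<integral> t. indicator (- I)
        t * (t - t0) \<partial>spec w)"
      by (rule shifted_form_integral[OF wW I(1)])
    have se: "shifted_form t0 e J = (\<integral> t. indicator I t * (t - t0) \<partial>spec e) + (\<integral> t. indicator (- I)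
        t * (t - t0) \<partial>spec e)"
      by (rule shifted_form_integral[OF eJ I(1)])
    have swe: "(\<integral> t. indicator (- I) t * (t - t0) \<partial>spec w) = (\<integral> t. indicator (- I) t * (t - t0)
        \<partial>spec e)"
      unfolding w_def X_def by (rule complement_integral_eq[OF e x I(1)])
    have bw: "\<bar>\<integral> t. indicator I t * (t - t0) \<partial>spec w\<bar> \<le> \<delta> * 4"
      using local_integral_bound[OF w I \<delta>] mult_left_mono[OF nw \<delta>] by linarith
    have be: "\<bar>\<integral> t. indicator I t * (t - t0) \<partial>spec e\<bar> \<le> \<delta>"
      using local_integral_bound[OF e I \<delta>] by (simp add: e_def)
    have bX: "\<bar>shifted_form t0 X Y\<bar> \<le> \<delta> * r\<^sup>2"
    proof -
      \<comment> \<open>X is the zero vector plus 1 times E(I)x, so outside I its spectral measure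
        is that of the zero vector.\<close>
      have "(\<integral> t. indicator (- I) t * (t - t0) \<partial>spec X) = (\<integral> t. indicator (- I) t * (t - t0) \<partial>spec
          (\<lambda>_. 0))"
        using complement_integral_eq[of "\<lambda>_. 0" x I 1 t0] x I(1) unfolding X_def by (simp add: ell2_def)
      also have "\<dots> = 0"
      proof -
        have "emeasure (spec (\<lambda>_. 0)) UNIV = 0"
          using emeasure_spec[of "\<lambda>_. 0" UNIV] E_UNIV[of "\<lambda>_. 0"] by (simp add: ell2_def ell2_norm_def)
        then have "AE t in spec (\<lambda>_. 0). indicator (- I) t * (t - t0) = 0"
          by (intro AE_I[where N = UNIV]) auto
        then show ?thesis by (rule integral_eq_zero_AE)
      qed
      finally have "shifted_form t0 X Y = (\<integral> t. indicator I t * (t - t0) \<partial>spec X)"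
        using shifted_form_integral[OF XY I(1), of t0] by simp
      then show ?thesis using local_integral_bound[OF X I \<delta>] by (simp add: r_def)
    qed
    have "(cmod c)\<^sup>2 * \<bar>shifted_form t0 X Y\<bar> \<le> (cmod c)\<^sup>2 * (\<delta> * r\<^sup>2)"
      by (rule mult_left_mono[OF bX]) simp
    also have "\<dots> = \<delta>" using r by (simp add: c power_divide)
    finally have "\<bar>(cmod c)\<^sup>2 * shifted_form t0 X Y\<bar> \<le> \<delta>" by (simp add: abs_mult)
    \<comment> \<open>The integrals over \<open>- I\<close> cancel by \<open>swe\<close>. What
      remains is at most 4 \<delta> from w, \<delta> from e and \<delta> from X; halving 6 \<delta>
      gives the constant 3.\<close>
    then have "2 * Re (c * a) \<le> 6 * \<delta>" using expand sw se swe bw be by linarith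
    then show "cmod a \<le> 3 * \<delta> * r" using r unfolding ca by (simp add: field_simps)
  qed
qed

text \<open>Additivity is given for infinite families only. Padding with empty sets makes the
  partial sums eventually constant, and entries of the norm limit are limits of entries.\<close>

lemma E_finite_Union:
  fixes C :: "nat \<Rightarrow> real set"
  assumes x: "x \<in> ell2" and C: "\<And>j. C j \<in> sets borel" "disjoint_family C" "\<And>j. j \<ge> M \<Longrightarrow> C j = {}"
  shows "(\<Sum>j<M. E (C j) x n) = E (\<Union>j<M. C j) x n"
proof -
  have lim: "ell2_lim (\<lambda>N n. \<Sum>i<N. E (C i) x n) (E (\<Union>i. C i) x)"
    using pvm C x unfolding projection_valued_measure_def by blast
  have "(\<Sum>i<N. E (C i) x n) = (\<Sum>i<M. E (C i) x n)" if "N \<ge> M" for N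
    using that C(3) E_empty[OF x] by (intro sum.mono_neutral_right) auto
  then have "\<forall>\<^sub>F N in sequentially. (\<Sum>i<N. E (C i) x n) = (\<Sum>i<M. E (C i) x n)"
    unfolding eventually_sequentially by blast
  then have "(\<lambda>N. \<Sum>i<N. E (C i) x n) \<longlonglongrightarrow> (\<Sum>i<M. E (C i) x n)"
    by (rule tendsto_eventually)
  moreover have "(\<Union>i. C i) = (\<Union>i<M. C i)" using C(3) by (force simp: not_le[symmetric])
  ultimately show ?thesis
    using LIMSEQ_unique[OF _ ell2_lim_component[OF lim, of n]] by simp
qed

section \<open>Riemann sums for the resolvent\<close>

abbreviation "e0 \<equiv> basis_vec 0"
abbreviation "\<mu> \<equiv> spec e0"

text \<open>A Riemann sum for \<open>\<integral> 1/(t - z) dE(t) e\<^sub>0\<close> over \<open>[-K, K)\<close>. The mesh \<open>1/K\<^sup>2\<close> makes the error of the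
  approximate eigenvectors summable: the \<open>2K\<^sup>3\<close> cells contribute at most \<open>3K\<^sup>-\<^sup>2 (2K\<^sup>3)\<^sup>1\<^sup>/\<^sup>2 \<rightarrow> 0\<close> by
  Cauchy-Schwarz.\<close>

definition approx_resolvent :: "complex \<Rightarrow> nat \<Rightarrow> nat \<Rightarrow> complex" where
  "approx_resolvent z K n = (\<Sum>j<2 * K ^ 3. 1 / (of_real (node K j) - z) * E (cell K j) e0 n)"

lemma cell_norms: "(\<Sum>j<2 * K ^ 3. (ell2_norm (E (cell K j) e0))\<^sup>2) \<le> 1"
proof -
  interpret finite_measure \<mu> by (rule finite_measure_spec) simp
  have "(\<Sum>j<2 * K ^ 3. (ell2_norm (E (cell K j) e0))\<^sup>2) = (\<Sum>j<2 * K ^ 3. measure \<mu> (cell K j))"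
    by (simp add: measure_spec)
  also have "\<dots> = measure \<mu> (\<Union>j<2 * K ^ 3. cell K j)"
    by (rule finite_measure_finite_Union[symmetric])
       (auto simp: disjoint_family_on_def cell_disjoint)
  also have "\<dots> \<le> measure \<mu> (space \<mu>)" by (rule bounded_measure)
  also have "\<dots> = 1" by (simp add: measure_spec_UNIV)
  finally show ?thesis .
qed

lemma approx_resolvent_ell2: "approx_resolvent z K \<in> ell2"
  unfolding approx_resolvent_def by (intro ell2_sum ell2_scale E_ell2) auto

text \<open>The vectors E(cell) e0 are mutually orthogonal with squared norms summing to at most 1,
  and all coefficients are at most 1 / Im z. This is the discrete counterpart of the resolvent
  bound.\<close>

lemma approx_resolvent_norm:
  assumes z: "Im z > 0"
  shows "(\<Sum>n\<le>N. (cmod (approx_resolvent z K n))\<^sup>2) \<le> 1 / (Im z)\<^sup>2"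
proof -
  define a where "a = (\<lambda>j. 1 / (complex_of_real (node K j) - z))"
  define x where "x = (\<lambda>j. E (cell K j) e0)"
  define M where "M = 2 * K ^ 3"
  define r where "r = approx_resolvent z K"
  have x: "x j \<in> ell2" for j by (simp add: x_def)
  have r: "r = (\<lambda>n. \<Sum>j<M. a j * x j n)" "r \<in> ell2"
    unfolding r_def by (simp_all add: approx_resolvent_ell2)
      (simp add: approx_resolvent_def[abs_def] a_def x_def M_def)
  have orth: "ell2_inner (x i) (x j) = (if i = j then of_real ((ell2_norm (x i))\<^sup>2) else 0)" for i j
  proof (cases "i = j")
    case False
    have "ell2_inner (x i) (x j) = ell2_inner e0 (E (cell K i \<inter> cell K j) e0)"
      by (simp add: x_def E_sym E_Int)
    then show ?thesis using False by (simp add: cell_disjoint E_empty) (simp add: ell2_inner_def)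
  qed (simp add: ell2_inner_self x)
  have inner_r: "ell2_inner r v = (\<Sum>j<M. a j * ell2_inner (x j) v)" if "v \<in> ell2" for v
    unfolding r(1) using that x by (subst ell2_inner_sum) (auto intro!: ell2_scale sum.cong simp:
        ell2_inner_scale)
  have xr: "ell2_inner (x i) r = cnj (a i) * of_real ((ell2_norm (x i))\<^sup>2)" if "i < M" for i
  proof -
    have "ell2_inner r (x i) = (\<Sum>j<M. if j = i then a i * of_real ((ell2_norm (x i))\<^sup>2) else 0)"
      unfolding inner_r[OF x] by (intro sum.cong refl) (auto simp: orth)
    also have "\<dots> = a i * of_real ((ell2_norm (x i))\<^sup>2)" using that by simp
    finally show ?thesis using ell2_inner_cnj[OF r(2) x, of i] by simp
  qed
  have "complex_of_real ((ell2_norm r)\<^sup>2) = ell2_inner r r" by (rule ell2_inner_self[OF r(2),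
      symmetric])
  also have "\<dots> = (\<Sum>j<M. of_real ((cmod (a j))\<^sup>2 * (ell2_norm (x j))\<^sup>2))"
    unfolding inner_r[OF r(2)]
  proof (intro sum.cong refl)
    fix j assume "j \<in> {..<M}"
    then have "a j * ell2_inner (x j) r = (a j * cnj (a j)) * of_real ((ell2_norm (x j))\<^sup>2)"
      by (simp add: xr)
    then show "a j * ell2_inner (x j) r = of_real ((cmod (a j))\<^sup>2 * (ell2_norm (x j))\<^sup>2)"
      by (simp only: complex_norm_square[symmetric] of_real_mult)
  qed
  finally have "(ell2_norm r)\<^sup>2 = (\<Sum>j<M. (cmod (a j))\<^sup>2 * (ell2_norm (x j))\<^sup>2)"
    unfolding of_real_sum[symmetric] of_real_eq_iff .
  also have "\<dots> \<le> (\<Sum>j<M. (1 / Im z)\<^sup>2 * (ell2_norm (x j))\<^sup>2)"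
    by (intro sum_mono mult_right_mono power_mono) (auto simp: a_def intro!: resolvent_coeff_le z)
  also have "\<dots> \<le> (1 / Im z)\<^sup>2 * 1"
    unfolding sum_distrib_left[symmetric] x_def M_def by (intro mult_left_mono cell_norms) simp
  finally show ?thesis
    using ell2_sum_le_norm[OF r(2), of N] by (simp add: r_def power_divide)
qed

text \<open>The coefficient a_j satisfies a_j (t_j - z) = 1 at the node t_j. Applying A - z to a_j
  x_j thus gives x_j plus a_j (A - t_j) x_j: the x_j add up to the projection onto [-K, K), the rest
  is the error of the approximate eigenvectors.\<close>

lemma approx_resolvent_error:
  assumes z: "Im z > 0" and K: "K > 0"
  shows "cmod (jacobi_apply b (approx_resolvent z K) n - z * approx_resolvent z K n
           - E {- real K..<real K} e0 n) \<le> 3 * sqrt 2 / (Im z * sqrt (real K))"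
proof -
  define a where "a = (\<lambda>j. 1 / (complex_of_real (node K j) - z))"
  define x where "x = (\<lambda>j. E (cell K j) e0)"
  define M where "M = 2 * K ^ 3"
  define \<delta> where "\<delta> = 1 / (real K)\<^sup>2"
  have at: "a j * of_real (node K j) = z * a j + 1" for j
  proof -
    have "complex_of_real (node K j) - z \<noteq> 0" using z by (auto simp: complex_eq_iff)
    then show ?thesis by (simp add: a_def field_simps)
  qed
  have "E {- real K..<real K} e0 n = (\<Sum>j<M. x j n)"
    unfolding x_def M_def cell_Union[symmetric]
    by (rule E_finite_Union[symmetric]) (auto simp: disjoint_family_on_def cell_disjoint cell_empty)
  moreover have "approx_resolvent z K = (\<lambda>n. \<Sum>j<M. a j * x j n)"
    by (simp add: approx_resolvent_def fun_eq_iff a_def x_def M_def)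
  ultimately have "jacobi_apply b (approx_resolvent z K) n - z * approx_resolvent z K n - E {- real
      K..<real K} e0 n
     = (\<Sum>j<M. a j * jacobi_apply b (x j) n - z * (a j * x j n) - x j n)"
    by (simp add: jacobi_apply_sum sum_distrib_left sum_subtractf)
  also have "\<dots> = (\<Sum>j<M. a j * (jacobi_apply b (x j) n - of_real (node K j) * x j n))"
  proof (intro sum.cong refl)
    fix j
    have "a j * (jacobi_apply b (x j) n - of_real (node K j) * x j n)
       = a j * jacobi_apply b (x j) n - (a j * of_real (node K j)) * x j n" by (simp add: algebra_simps)
    then show "a j * jacobi_apply b (x j) n - z * (a j * x j n) - x j n =
       a j * (jacobi_apply b (x j) n - of_real (node K j) * x j n)" unfolding at by (simp add:
           algebra_simps)
  qed
  also have "cmod \<dots> \<le> (\<Sum>j<M. 1 / Im z * (3 * \<delta> * ell2_norm (x j)))"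
  proof (rule sum_norm_le)
    fix j
    have "cmod (jacobi_apply b (x j) n - of_real (node K j) * x j n) \<le> 3 * \<delta> * ell2_norm (x j)"
      unfolding x_def \<delta>_def by (rule approximate_eigenvector) (use cell_node K in auto)
    then show "cmod (a j * (jacobi_apply b (x j) n - of_real (node K j) * x j n)) \<le> 1 / Im z * (3 *
        \<delta> * ell2_norm (x j))"
      unfolding norm_mult using z by (intro mult_mono) (auto simp: a_def intro!: resolvent_coeff_le)
  qed
  also have "\<dots> = 3 * \<delta> / Im z * (\<Sum>j<M. ell2_norm (x j))"
    unfolding sum_distrib_left by (intro sum.cong refl) simp
  also have "\<dots> \<le> 3 * \<delta> / Im z * sqrt (real M)"
  proof (rule mult_left_mono)
    have "(\<Sum>j<M. ell2_norm (x j))\<^sup>2 \<le> (\<Sum>j<M. (ell2_norm (x j))\<^sup>2) * card {..<M}"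
      by (rule sum_squared_le_sum_of_squares)
    also have "\<dots> \<le> 1 * real M"
      unfolding x_def M_def by (intro mult_mono cell_norms) auto
    finally show "(\<Sum>j<M. ell2_norm (x j)) \<le> sqrt (real M)" by (simp add: real_le_rsqrt)
  qed (use z in \<open>simp add: \<delta>_def\<close>)
  also have "\<dots> = 3 * sqrt 2 / (Im z * sqrt (real K))"
  proof -
    have "sqrt (real M) = sqrt 2 * sqrt (real K) * real K"
      by (simp add: M_def real_sqrt_mult power3_eq_cube)
    moreover have "(real K)\<^sup>2 = real K * (sqrt (real K) * sqrt (real K))" by (simp add:
        power2_eq_square)
    ultimately show ?thesis using K z by (simp add: \<delta>_def field_simps)
  qed
  finally show ?thesis .
qed

definition stieltjes :: "complex \<Rightarrow> complex" where
  "stieltjes z = (\<integral> t. 1 / (of_real t - z) \<partial>\<mu>)"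

text \<open>Entry 0 of E(B) e0 is \<mu>(B), so here the vector sum becomes a genuine Riemann sum,
  dominated by 1 / Im z.\<close>

lemma approx_resolvent_0_tendsto:
  assumes z: "Im z > 0"
  shows "(\<lambda>K. approx_resolvent z K 0) \<longlonglongrightarrow> stieltjes z"
proof -
  interpret finite_measure \<mu> by (rule finite_measure_spec) simp
  define a where "a = (\<lambda>K j. 1 / (complex_of_real (node K j) - z))"
  define g where "g = (\<lambda>K t. \<Sum>j<2 * K ^ 3. indicator (cell K j) t *\<^sub>R a K j)"
  have g_eq: "g K t = a K i" if "t \<in> cell K i" "i < 2 * K ^ 3" for K t i
  proof -
    have "g K t = (\<Sum>j<2 * K ^ 3. if j = i then a K i else 0)"
      unfolding g_def using that cell_disjoint[of _ i K]
      by (intro sum.cong refl) (auto simp: indicator_def)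
    then show ?thesis using that by simp
  qed
  have int: "approx_resolvent z K 0 = (\<integral> t. g K t \<partial>\<mu>)" for K
  proof -
    have "E (cell K j) e0 0 = of_real (measure \<mu> (cell K j))" for j
      using orth_projection_inner[OF projection[OF cell_borel] basis_vec_ell2, of K j 0]
      by (simp add: measure_spec ell2_inner_basis_vec)
    moreover have "(\<integral> t. g K t \<partial>\<mu>) = (\<Sum>j<2 * K ^ 3. (\<integral> t. indicator (cell K j) t *\<^sub>R a K j \<partial>\<mu>))"
      unfolding g_def by (intro Bochner_Integration.integral_sum) (auto simp: less_top[symmetric])
    ultimately show ?thesis
      by (simp add: approx_resolvent_def a_def scaleR_conv_of_real mult.commute)
  qed
  have "(\<lambda>K. \<integral> t. g K t \<partial>\<mu>) \<longlonglongrightarrow> (\<integral> t. 1 / (of_real t - z) \<partial>\<mu>)"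
  proof (rule integral_dominated_convergence[where w = "\<lambda>_. 1 / Im z"])
    show "(\<lambda>t. 1 / (complex_of_real t - z)) \<in> borel_measurable \<mu>" by measurable
    show "g K \<in> borel_measurable \<mu>" for K unfolding g_def by measurable
    show "integrable \<mu> (\<lambda>_. 1 / Im z)" by (rule integrable_const)
    show "AE t in \<mu>. norm (g K t) \<le> 1 / Im z" for K
    proof (rule AE_I2)
      fix t
      show "norm (g K t) \<le> 1 / Im z"
      proof (cases "- real K \<le> t \<and> t < real K")
        case True
        then show ?thesis using g_eq[OF cell_index] resolvent_coeff_le[OF z] by (simp add: a_def)
      next
        case False
        then have "g K t = 0" by (auto simp: g_def cell_def indicator_def)
        then show ?thesis using z by simp
      qed
    qed
    show "AE t in \<mu>. (\<lambda>K. g K t) \<longlonglongrightarrow> 1 / (of_real t - z)"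
    proof (rule AE_I2)
      fix t :: real
      have "(\<lambda>K. g K t - 1 / (of_real t - z)) \<longlonglongrightarrow> 0"
      proof (rule Lim_null_comparison)
        show "(\<lambda>K. 1 / (real K)\<^sup>2 / (Im z)\<^sup>2) \<longlonglongrightarrow> 0"
          using z by real_asymp
        obtain K0 :: nat where K0: "\<bar>t\<bar> < real K0" using reals_Archimedean2 by blast
        show "\<forall>\<^sub>F K in sequentially. norm (g K t - 1 / (of_real t - z)) \<le> 1 / (real K)\<^sup>2 / (Im z)\<^sup>2"
          unfolding eventually_sequentially
        proof (intro exI allI impI)
          fix K assume "K \<ge> K0"
          then have K: "- real K \<le> t" "t < real K" "K > 0" using K0 by linarith+
          define i where "i = nat \<lfloor>(real K)\<^sup>2 * (t + real K)\<rfloor>"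
          have i: "t \<in> cell K i" "i < 2 * K ^ 3" unfolding i_def by (rule cell_index[OF K(1,2)])+
          have "norm (g K t - 1 / (of_real t - z)) \<le> \<bar>t - node K i\<bar> / (Im z)\<^sup>2"
            unfolding g_eq[OF i] a_def by (rule cmod_diff_resolvents[OF z])
          also have "\<dots> \<le> 1 / (real K)\<^sup>2 / (Im z)\<^sup>2"
            by (intro divide_right_mono cell_node i K) simp
          finally show "norm (g K t - 1 / (of_real t - z)) \<le> 1 / (real K)\<^sup>2 / (Im z)\<^sup>2" .
        qed
      qed
      then show "(\<lambda>K. g K t) \<longlonglongrightarrow> 1 / (of_real t - z)" by (simp only: LIM_zero_iff)
    qed
  qed
  then show ?thesis by (simp only: int stieltjes_def)
qed

text \<open>The complementary projection has squared norm \<mu>(B) with B the complement of [-K, K),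
  which tends to 0 by continuity from above.\<close>

lemma E_exhaust: "(\<lambda>K. E {- real K..<real K} e0 n) \<longlonglongrightarrow> e0 n"
proof -
  interpret finite_measure \<mu> by (rule finite_measure_spec) simp
  let ?I = "\<lambda>K::nat. {- real K..<real K}"
  have split: "E (?I K) e0 n + E (- ?I K) e0 n = e0 n" for K
  proof -
    define C where "C = (\<lambda>j::nat. if j = 0 then ?I K else if j = 1 then - ?I K else {})"
    have "(\<Sum>j<2. E (C j) e0 n) = E (\<Union>j<2. C j) e0 n"
      by (rule E_finite_Union) (auto simp: C_def disjoint_family_on_def)
    moreover have "(\<Union>j<2::nat. C j) = UNIV" by (auto simp: C_def lessThan_nat_numeral)
    ultimately show ?thesis by (simp add: C_def E_UNIV numeral_2_eq_2)
  qed
  have "(\<lambda>K. measure \<mu> (- ?I K)) \<longlonglongrightarrow> measure \<mu> (\<Inter>K. - ?I K)"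
    by (rule finite_Lim_measure_decseq) (auto simp: decseq_def)
  moreover have "(\<Inter>K. - ?I K) = {}"
  proof -
    have "\<exists>K::nat. - real K \<le> t \<and> t < real K" for t
    proof -
      obtain K :: nat where "\<bar>t\<bar> < real K" using reals_Archimedean2 by blast
      then show ?thesis by (intro exI[of _ K]) linarith
    qed
    then show ?thesis by (auto, blast)
  qed
  ultimately have "(\<lambda>K. measure \<mu> (- ?I K)) \<longlonglongrightarrow> 0" by simp
  then have "(\<lambda>K. sqrt (measure \<mu> (- ?I K))) \<longlonglongrightarrow> sqrt 0" by (rule tendsto_real_sqrt)
  then have lim: "(\<lambda>K. sqrt (measure \<mu> (- ?I K))) \<longlonglongrightarrow> 0" by simp
  have le: "cmod (E (- ?I K) e0 n) \<le> sqrt (measure \<mu> (- ?I K))" for K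
  proof -
    have "- ?I K \<in> sets borel" by simp
    then show ?thesis using ell2_component_le[of "E (- ?I K) e0" n] by (simp add: measure_spec)
  qed
  have "(\<lambda>K. E (- ?I K) e0 n) \<longlonglongrightarrow> 0"
    by (rule Lim_null_comparison[OF always_eventually[OF allI[OF le]] lim])
  from tendsto_diff[OF tendsto_const[of "e0 n"] this]
  have "(\<lambda>K. e0 n - E (- ?I K) e0 n) \<longlonglongrightarrow> e0 n" by simp
  moreover have "e0 n - E (- ?I K) e0 n = E (?I K) e0 n" for K using split[of K] by (simp add:
      algebra_simps)
  ultimately show ?thesis by simp
qed

lemma approx_resolvent_equation:
  assumes z: "Im z > 0"
  shows "(\<lambda>K. jacobi_apply b (approx_resolvent z K) n - z * approx_resolvent z K n) \<longlonglongrightarrow> e0 n"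
proof -
  let ?d = "\<lambda>K. jacobi_apply b (approx_resolvent z K) n - z * approx_resolvent z K n"
  have "(\<lambda>K. ?d K - E {- real K..<real K} e0 n) \<longlonglongrightarrow> 0"
  proof (rule Lim_null_comparison)
    show "\<forall>\<^sub>F K in sequentially. norm (?d K - E {- real K..<real K} e0 n) \<le> 3 * sqrt 2 / (Im z *
        sqrt (real K))"
      using eventually_gt_at_top[of 0] by eventually_elim (rule approx_resolvent_error[OF z])
    show "(\<lambda>K. 3 * sqrt 2 / (Im z * sqrt (real K))) \<longlonglongrightarrow> 0" using z by real_asymp
  qed
  from tendsto_add[OF this E_exhaust[of n]] show ?thesis by simp
qed

text \<open>The limit of entry 0 is known and the equation holds in the limit row by row, so the
  second-order recurrence determines all further entries. The induction carries two consecutive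
  entries for this reason.\<close>

lemma approx_resolvent_tendsto:
  assumes z: "Im z > 0"
  shows "(\<lambda>K. approx_resolvent z K n) \<longlonglongrightarrow> weyl z (stieltjes z) n"
proof -
  let ?r = "\<lambda>K. approx_resolvent z K" and ?w = "weyl z (stieltjes z)"
  have "(\<lambda>K. ?r K n) \<longlonglongrightarrow> ?w n \<and> (\<lambda>K. ?r K (Suc n)) \<longlonglongrightarrow> ?w (Suc n)"
  proof (induction n)
    case 0
    have 0: "(\<lambda>K. ?r K 0) \<longlonglongrightarrow> ?w 0"
      using approx_resolvent_0_tendsto[OF z] by (simp add: weyl_def)
    have "(\<lambda>K. ((jacobi_apply b (?r K) 0 - z * ?r K 0) + z * ?r K 0) / of_real (b 0)) \<longlonglongrightarrow> (e0 0 + z *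
        ?w 0) / of_real (b 0)"
      by (intro tendsto_intros approx_resolvent_equation[OF z] 0) simp
    moreover have "(e0 0 + z * ?w 0) / of_real (b 0) = ?w (Suc 0)"
      using jacobi_apply_weyl[of z "stieltjes z" 0] by (simp add: jacobi_apply_def field_simps)
    ultimately show ?case using 0 by (simp add: jacobi_apply_def)
  next
    case (Suc n)
    have "(\<lambda>K. ((jacobi_apply b (?r K) (Suc n) - z * ?r K (Suc n)) + z * ?r K (Suc n) - of_real (b
        n) * ?r K n) / of_real (b (Suc n)))
        \<longlonglongrightarrow> (e0 (Suc n) + z * ?w (Suc n) - of_real (b n) * ?w n) / of_real (b (Suc n))"
      by (intro tendsto_intros approx_resolvent_equation[OF z] Suc.IH[THEN conjunct1] Suc.IH[THEN
          conjunct2]) simp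
    moreover have "(e0 (Suc n) + z * ?w (Suc n) - of_real (b n) * ?w n) / of_real (b (Suc n)) = ?w
        (Suc (Suc n))"
      using jacobi_apply_weyl[of z "stieltjes z" "Suc n"] by (simp add: jacobi_apply_def field_simps)
    ultimately show ?case using Suc by (simp add: jacobi_apply_def)
  qed
  then show ?thesis by simp
qed

text \<open>For fixed N only finitely many entries occur, so the bound on the Riemann sums survives
  the limit. It puts the Stieltjes transform on the same footing as \<open>carmona_m\<close> in
  \<open>weyl_difference\<close>.\<close>

lemma stieltjes_weyl_bound:
  assumes z: "Im z > 0"
  shows "(\<Sum>n\<le>N. (cmod (weyl z (stieltjes z) n))\<^sup>2) \<le> 1 / (Im z)\<^sup>2"
proof (rule LIMSEQ_le_const2)
  show "(\<lambda>K. \<Sum>n\<le>N. (cmod (approx_resolvent z K n))\<^sup>2) \<longlonglongrightarrow> (\<Sum>n\<le>N. (cmod (weyl z (stieltjes z) n))\<^sup>2)"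
    by (intro tendsto_intros approx_resolvent_tendsto z)
qed (use approx_resolvent_norm[OF z] in blast)

lemma Im_stieltjes:
  assumes y: "y > 0"
  shows "Im (stieltjes (Complex x y)) = (\<integral> t. y / ((t - x)\<^sup>2 + y\<^sup>2) \<partial>\<mu>)"
proof -
  interpret finite_measure \<mu> by (rule finite_measure_spec) simp
  have i: "integrable \<mu> (\<lambda>t. 1 / (complex_of_real t - Complex x y))"
    by (rule integrable_const_bound[where B = "1 / y"])
       (use resolvent_coeff_le[of "Complex x y"] y in auto)
  have "Im (stieltjes (Complex x y)) = (\<integral> t. Im (1 / (complex_of_real t - Complex x y)) \<partial>\<mu>)"
    unfolding stieltjes_def by (rule integral_Im[OF i, symmetric])
  also have "\<dots> = (\<integral> t. y / ((t - x)\<^sup>2 + y\<^sup>2) \<partial>\<mu>)"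
    by (intro Bochner_Integration.integral_cong refl) (simp add: Im_divide)
  finally show ?thesis .
qed

end

section \<open>Poisson kernels\<close>

text \<open>Unnormalized: the integral over the line is pi, which accounts for the factors pi
  below.\<close>

definition poisson :: "real \<Rightarrow> real \<Rightarrow> real \<Rightarrow> real" where
  "poisson y x t = y / ((t - x)\<^sup>2 + y\<^sup>2)"

lemma poisson_complex:
  "y > 0 \<Longrightarrow> complex_of_real (poisson y x t) =
     of_real y / ((of_real t - Complex x y) * (of_real t - cnj (Complex x y)))"
proof -
  have "(of_real t - Complex x y) * (of_real t - cnj (Complex x y)) = complex_of_real ((t - x)\<^sup>2 + y\<^sup>2)"
    by (simp add: complex_eq_iff power2_eq_square algebra_simps)
  then show ?thesis by (simp only: poisson_def of_real_divide)
qed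

section \<open>The Poisson integral by contour integration\<close>

definition half_disc :: "real \<Rightarrow> real \<Rightarrow> complex" where
  "half_disc R = linepath (- of_real R) (of_real R) +++ part_circlepath 0 R 0 pi"

lemma half_disc_integral_bound:
  fixes h :: "complex \<Rightarrow> complex"
  assumes cont: "continuous_on {z. Im z \<ge> 0} h"
    and diff: "\<And>z. Im z > 0 \<Longrightarrow> h field_differentiable at z"
    and bound: "\<And>z. Im z \<ge> 0 \<Longrightarrow> cmod (h z) \<le> C"
    and y: "y > 0" and R: "R > cmod (Complex x y)"
  shows "cmod (integral {-R..R} (\<lambda>t. of_real (poisson y x t) * h (of_real t)) -
           pi * winding_number (half_disc R) (Complex x y) * h (Complex x y))
         \<le> C * y * pi * (R / (R - cmod (Complex x y))\<^sup>2)"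
proof -
  define w where "w = Complex x y"
  \<comment> \<open>Only one of the two poles of the kernel is in the upper half-plane. The other
    one is absorbed into f, so that f(t) / (t - w) is the kernel times h on the real line and 2 \<i>
    f(w) = h(w).\<close>
  define f where "f = (\<lambda>z. h z * of_real y / (z - cnj w))"
  let ?H = "{z. Im z \<ge> 0}"
  let ?l = "linepath (- of_real R) (complex_of_real R)"
  let ?c = "part_circlepath 0 R 0 pi"
  have R0: "R > 0" using R by (smt (verit) norm_ge_zero)
  have [simp]: "Im w = y" "Re w = x" by (simp_all add: w_def)
  have C0: "C \<ge> 0" using bound[of 0] by (smt (verit) norm_ge_zero zero_complex.simps)
  have intH: "interior ?H = {z. Im z > 0}" using interior_halfspace_ge[of \<i> 0] by (simp add:
      inner_complex_def)
  have nzc: "z - cnj w \<noteq> 0" if "Im z \<ge> 0" for z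
    using that y by (auto simp: complex_eq_iff)
  have pl: "path_image ?l \<subseteq> ?H - {w}"
    using y by (auto simp: path_image_linepath closed_segment_def complex_eq_iff)
  have pc: "path_image ?c \<subseteq> ?H - {w}"
  proof
    fix z assume "z \<in> path_image ?c"
    then obtain t where t: "0 \<le> t" "t \<le> pi" "z = of_real R * exp (\<i> * of_real t)"
      by (auto simp: path_image_part_circlepath)
    have "Im z = R * sin t" by (simp add: t Im_exp)
    moreover have "cmod z = R" using R0 by (simp add: t norm_mult)
    ultimately show "z \<in> ?H - {w}" using R t R0 by (auto simp: w_def sin_ge_zero)
  qed
  have contf: "continuous_on ?H f" unfolding f_def
    using nzc by (auto intro!: continuous_intros cont)
  \<comment> \<open>The diameter runs along the boundary of the half-plane, where h is merely
    continuous; the weak form of Cauchy's formula asks for differentiability in the interior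
    only.\<close>
  have F: "((\<lambda>z. f z / (z - w)) has_contour_integral
       2 * pi * \<i> * winding_number (half_disc R) w * f w) (half_disc R)"
  proof (rule Cauchy_integral_formula_weak[where k = "{}" and S = ?H])
    show "f field_differentiable at z" if "z \<in> interior ?H - {}" for z
      unfolding f_def using that nzc[of z] intH
      by (auto intro!: field_differentiable_divide field_differentiable_mult diff
           field_differentiable_diff)
    show "path_image (half_disc R) \<subseteq> ?H - {w}"
      unfolding half_disc_def by (subst path_image_join) (use pl pc in auto)
    show "valid_path (half_disc R)"
      unfolding half_disc_def by (rule valid_path_join) auto
    show "pathfinish (half_disc R) = pathstart (half_disc R)"
      unfolding half_disc_def by (simp add: exp_pi_i')
  qed (use contf intH y convex_halfspace_Im_ge in auto)
  have cF: "continuous_on (?H - {w}) (\<lambda>z. f z / (z - w))"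
    by (intro continuous_intros continuous_on_subset[OF contf]) auto
  have il: "(\<lambda>z. f z / (z - w)) contour_integrable_on ?l"
    by (intro contour_integrable_continuous_linepath continuous_on_subset[OF cF] )
       (use pl in \<open>simp add: path_image_linepath\<close>)
  have ic: "(\<lambda>z. f z / (z - w)) contour_integrable_on ?c"
    by (intro contour_integrable_continuous_part_circlepath continuous_on_subset[OF cF] pc)
  have fw: "2 * \<i> * f w = h w"
  proof -
    have "w - cnj w = 2 * \<i> * of_real y" by (simp add: complex_eq_iff)
    then show ?thesis using y by (simp add: f_def)
  qed
  have kern: "f (of_real t) / (of_real t - w) = of_real (poisson y x t) * h (of_real t)" for t
    unfolding poisson_complex[OF y] w_def[symmetric] f_def by (simp add: mult_ac)
  have "contour_integral (half_disc R) (\<lambda>z. f z / (z - w)) =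
     contour_integral ?l (\<lambda>z. f z / (z - w)) + contour_integral ?c (\<lambda>z. f z / (z - w))"
    unfolding half_disc_def by (rule contour_integral_join[OF il ic]) auto
  moreover have "contour_integral ?l (\<lambda>z. f z / (z - w)) =
      integral {-R..R} (\<lambda>t. of_real (poisson y x t) * h (of_real t))"
  proof -
    have "((\<lambda>z. f z / (z - w)) has_contour_integral (contour_integral ?l (\<lambda>z. f z / (z - w)))) ?l"
      using il by (rule has_contour_integral_integral)
    then have "((\<lambda>t. f (of_real t) / (of_real t - w)) has_integral
       (contour_integral ?l (\<lambda>z. f z / (z - w)))) {-R..R}"
      by (subst (asm) has_contour_integral_linepath_Reals_iff) (use R0 in auto)
    then show ?thesis unfolding kern by (simp add: integral_unique)
  qed
  moreover have "contour_integral (half_disc R) (\<lambda>z. f z / (z - w)) =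
      pi * winding_number (half_disc R) w * h w"
    unfolding contour_integral_unique[OF F] fw[symmetric] by (simp only: of_real_mult
        of_real_numeral mult_ac)
  moreover have "cmod (contour_integral ?c (\<lambda>z. f z / (z - w))) \<le> C * y / (R - cmod w)\<^sup>2 * R * (pi - 0)"
  proof (rule has_contour_integral_bound_part_circlepath[OF has_contour_integral_integral[OF ic]])
    fix z assume z: "z \<in> path_image ?c"
    then have "Im z \<ge> 0" using pc by auto
    moreover have "cmod z = R" using in_path_image_part_circlepath[OF z] R0 by simp
    moreover have "R - cmod w \<le> cmod (z - w)" "R - cmod w \<le> cmod (z - cnj w)"
      using norm_triangle_ineq2[of z w] norm_triangle_ineq2[of z "cnj w"] \<open>cmod z = R\<close> by auto
    ultimately have "cmod (h z) * y / (cmod (z - cnj w) * cmod (z - w)) \<le> C * y / ((R - cmod w) * (R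
        - cmod w))"
      using R y bound[of z] C0 unfolding w_def[symmetric] by (intro frac_le mult_mono mult_pos_pos) auto
    then show "cmod (f z / (z - w)) \<le> C * y / (R - cmod w)\<^sup>2"
      using y by (simp add: f_def norm_divide norm_mult power2_eq_square)
  qed (use R0 C0 y in auto)
  ultimately show ?thesis
    unfolding w_def[symmetric]
    by (metis (no_types, lifting) add_diff_cancel_left' diff_zero mult.assoc mult.commute
        norm_minus_commute
      times_divide_eq_left times_divide_eq_right)
qed

lemma half_disc_error_tendsto_0: "((\<lambda>R::real. D * (R / (R - c)\<^sup>2)) \<longlongrightarrow> 0) at_top"
proof -
  have "((\<lambda>R::real. R / (R - c)\<^sup>2) \<longlongrightarrow> 0) at_top" by real_asymp
  from tendsto_mult_left[OF this, of D] show ?thesis by simp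
qed

lemma integral_poisson_tendsto:
  assumes "y > 0"
  shows "((\<lambda>R. integral {-R..R} (poisson y x)) \<longlongrightarrow> pi) at_top"
proof -
  have "integral {-R..R} (poisson y x) = arctan ((R - x) / y) - arctan ((- R - x) / y)" if "R \<ge> 0" for R
  proof (rule integral_unique, rule fundamental_theorem_of_calculus)
    fix t
    have "((\<lambda>t. arctan ((t - x) / y)) has_real_derivative poisson y x t) (at t)"
      unfolding poisson_def using assms
      by (auto intro!: derivative_eq_intros simp: field_simps power2_eq_square)
    then show "((\<lambda>t. arctan ((t - x) / y)) has_vector_derivative poisson y x t) (at t within {-R..R})"
      by (simp add: has_real_derivative_iff_has_vector_derivative has_vector_derivative_at_within)
  qed (use that in auto)
  then have e: "\<forall>\<^sub>F R in at_top. arctan ((R - x) / y) - arctan ((- R - x) / y) = integral {-R..R}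
      (poisson y x)"
    by (intro eventually_mono[OF eventually_ge_at_top[of 0]]) auto
  have "((\<lambda>R. arctan ((R - x) / y) - arctan ((- R - x) / y)) \<longlongrightarrow> pi / 2 - (- (pi / 2))) at_top"
  proof (intro tendsto_diff)
    show "((\<lambda>R. arctan ((R - x) / y)) \<longlongrightarrow> pi / 2) at_top"
      by (rule filterlim_compose[OF tendsto_arctan_at_top]) (use assms in real_asymp)
    show "((\<lambda>R. arctan ((- R - x) / y)) \<longlongrightarrow> - (pi / 2)) at_top"
      by (rule filterlim_compose[OF tendsto_arctan_at_bot]) (use assms in real_asymp)
  qed
  then show ?thesis using e by (auto elim: Lim_transform_eventually)
qed

lemma poisson_continuous [continuous_intros]:
  "y > 0 \<Longrightarrow> continuous_on A (poisson y x)"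
  unfolding poisson_def by (intro continuous_intros) (smt (verit) zero_le_power2 zero_less_power)

text \<open>The winding number of the half disc is not computed: comparing with the constant function
  \<open>1\<close> shows that it tends to \<open>1\<close>, which is enough.\<close>

lemma poisson_tendsto:
  fixes h :: "complex \<Rightarrow> complex"
  assumes cont: "continuous_on {z. Im z \<ge> 0} h"
    and diff: "\<And>z. Im z > 0 \<Longrightarrow> h field_differentiable at z"
    and bound: "\<And>z. Im z \<ge> 0 \<Longrightarrow> cmod (h z) \<le> C"
    and y: "y > 0"
  shows "((\<lambda>R. integral {-R..R} (\<lambda>t. of_real (poisson y x t) * h (of_real t)))
           \<longlongrightarrow> pi * h (Complex x y)) at_top"
proof -
  let ?w = "Complex x y" and ?n = "\<lambda>R. winding_number (half_disc R) (Complex x y)"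
  have ev: "\<forall>\<^sub>F R in at_top. R > cmod ?w" by (rule eventually_gt_at_top)
  have "((\<lambda>R. integral {-R..R} (\<lambda>t. of_real (poisson y x t) * 1) - pi * ?n R * 1) \<longlongrightarrow> 0) at_top"
    using half_disc_integral_bound[of "\<lambda>_. 1" 1 y x] y
    by (intro Lim_null_comparison[OF _ half_disc_error_tendsto_0[of "1 * y * pi" "cmod ?w"]]
        eventually_mono[OF ev])
       auto
  moreover have "integral {-R..R} (\<lambda>t. complex_of_real (poisson y x t) * 1) = of_real (integral
      {-R..R} (poisson y x))" for R
  proof -
    have "(poisson y x has_integral integral {-R..R} (poisson y x)) {-R..R}"
      by (intro integrable_integral integrable_continuous_real poisson_continuous y)
    from integral_unique[OF has_integral_of_real[OF this]] show ?thesis by simp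
  qed
  ultimately have "((\<lambda>R. complex_of_real (integral {-R..R} (poisson y x)) - pi * ?n R) \<longlongrightarrow> 0) at_top"
    by simp
  moreover have "((\<lambda>R. complex_of_real (integral {-R..R} (poisson y x))) \<longlongrightarrow> of_real pi) at_top"
    by (intro tendsto_of_real integral_poisson_tendsto y)
  ultimately have "((\<lambda>R. pi * ?n R) \<longlongrightarrow> of_real pi - 0) at_top"
    using tendsto_diff by fastforce
  then have n: "((\<lambda>R. pi * ?n R * h ?w) \<longlongrightarrow> of_real pi * h ?w) at_top"
    using tendsto_mult_right by fastforce
  have "((\<lambda>R. integral {-R..R} (\<lambda>t. of_real (poisson y x t) * h (of_real t)) - pi * ?n R * h ?w) \<longlongrightarrow>
      0) at_top"
    using half_disc_integral_bound[OF assms]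
    by (intro Lim_null_comparison[OF _ half_disc_error_tendsto_0[of "C * y * pi" "cmod ?w"]]
        eventually_mono[OF ev])
       auto
  from tendsto_add[OF this n] show ?thesis by simp
qed

lemma nn_integral_lborel_eq_limit:
  fixes g :: "real \<Rightarrow> real"
  assumes g: "continuous_on UNIV g" "\<And>t. 0 \<le> g t"
    and lim: "((\<lambda>R. integral {-R..R} g) \<longlongrightarrow> l) at_top"
  shows "(\<integral>\<^sup>+ t. ennreal (g t) \<partial>lborel) = ennreal l"
proof -
  have [measurable]: "g \<in> borel_measurable borel" by (rule borel_measurable_continuous_onI[OF g(1)])
  let ?I = "\<lambda>n::nat. {- real n..real n}"
  have eq: "(\<integral>\<^sup>+ t. ennreal (g t) * indicator (?I n) t \<partial>lborel) = ennreal (integral (?I n) g)" for n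
  proof -
    have i: "set_integrable lborel (?I n) g"
      by (rule borel_integrable_atLeastAtMost') (rule continuous_on_subset[OF g(1)], simp)
    have "(\<integral>\<^sup>+ t. ennreal (g t) * indicator (?I n) t \<partial>lborel) =
        (\<integral>\<^sup>+ t. ennreal (indicator (?I n) t * g t) \<partial>lborel)"
      by (intro nn_integral_cong) (auto simp: indicator_def)
    also have "\<dots> = ennreal (\<integral> t. indicator (?I n) t * g t \<partial>lborel)"
      using i g(2) by (intro nn_integral_eq_integral) (auto simp: set_integrable_def)
    also have "(\<integral> t. indicator (?I n) t * g t \<partial>lborel) = integral (?I n) g"
      using set_borel_integral_eq_integral(2)[OF i] by (simp add: set_lebesgue_integral_def)
    finally show ?thesis .
  qed
  have "(\<integral>\<^sup>+ t. ennreal (g t) \<partial>lborel) = (\<integral>\<^sup>+ t. (SUP n. ennreal (g t) * indicator (?I n) t) \<partial>lborel)"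
  proof (intro nn_integral_cong antisym)
    fix t
    obtain n :: nat where "\<bar>t\<bar> \<le> real n" using real_arch_simple by blast
    then have "ennreal (g t) = ennreal (g t) * indicator (?I n) t" by (auto simp: indicator_def
        abs_le_iff)
    also have "\<dots> \<le> (SUP n. ennreal (g t) * indicator (?I n) t)" by (rule SUP_upper) simp
    finally show "ennreal (g t) \<le> (SUP n. ennreal (g t) * indicator (?I n) t)" .
  qed (auto intro!: SUP_least simp: indicator_def)
  also have "\<dots> = (SUP n. \<integral>\<^sup>+ t. ennreal (g t) * indicator (?I n) t \<partial>lborel)"
    by (intro nn_integral_monotone_convergence_SUP)
       (auto simp: incseq_def le_fun_def indicator_def)
  also have "\<dots> = (SUP n. ennreal (integral (?I n) g))" by (simp only: eq)
  also have "\<dots> = ennreal l"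
  proof (rule LIMSEQ_unique[OF LIMSEQ_SUP])
    show "incseq (\<lambda>n. ennreal (integral (?I n) g))"
      unfolding incseq_def
      by (auto intro!: ennreal_leI integral_subset_le integrable_continuous_real g
           continuous_on_subset[OF g(1)])
    show "(\<lambda>n. ennreal (integral (?I n) g)) \<longlonglongrightarrow> ennreal l"
      by (intro tendsto_ennrealI filterlim_compose[OF lim filterlim_real_sequentially])
  qed
  finally show ?thesis .
qed

lemma nn_integral_poisson: "y > 0 \<Longrightarrow> (\<integral>\<^sup>+ t. ennreal (poisson y x t) \<partial>lborel) = ennreal pi"
  by (intro nn_integral_lborel_eq_limit poisson_continuous integral_poisson_tendsto)
     (auto simp: poisson_def)

lemma poisson_Im_tendsto:
  fixes h :: "complex \<Rightarrow> complex"
  assumes cont: "continuous_on {z. Im z \<ge> 0} h"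
    and diff: "\<And>z. Im z > 0 \<Longrightarrow> h field_differentiable at z"
    and bound: "\<And>z. Im z \<ge> 0 \<Longrightarrow> cmod (h z) \<le> C"
    and y: "y > 0"
  shows "((\<lambda>R. integral {-R..R} (\<lambda>t. poisson y x t * Im (h (of_real t)))) \<longlongrightarrow> pi * Im (h (Complex x
      y))) at_top"
proof -
  have ch: "continuous_on A (\<lambda>t. h (complex_of_real t))" for A
    by (rule continuous_on_compose2[OF cont]) (auto intro!: continuous_intros)
  have "Im (integral {-R..R} (\<lambda>t. of_real (poisson y x t) * h (of_real t)))
      = integral {-R..R} (\<lambda>t. poisson y x t * Im (h (of_real t)))" for R
  proof -
    have "(\<lambda>t. of_real (poisson y x t) * h (of_real t)) integrable_on {-R..R}"
      by (intro integrable_continuous_real continuous_intros y ch)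
    from integral_linear[OF this bounded_linear_Im]
    show ?thesis by (simp add: o_def)
  qed
  then show ?thesis
    using tendsto_Im[OF poisson_tendsto[OF cont diff bound y, of x]] by simp
qed

text \<open>The contour argument gives a limit of integrals over [-R, R]; nonnegativity of Im h on
  the real line turns this limit into a Lebesgue integral by monotone convergence.\<close>

lemma poisson_representation:
  fixes h :: "complex \<Rightarrow> complex"
  assumes cont: "continuous_on {z. Im z \<ge> 0} h"
    and diff: "\<And>z. Im z > 0 \<Longrightarrow> h field_differentiable at z"
    and bound: "\<And>z. Im z \<ge> 0 \<Longrightarrow> cmod (h z) \<le> C"
    and nonneg: "\<And>t. 0 \<le> Im (h (of_real t))"
    and y: "y > 0"
  shows "(\<integral>\<^sup>+ t. ennreal (poisson y x t * Im (h (of_real t))) \<partial>lborel) = ennreal (pi * Im (h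
      (Complex x y)))"
proof (rule nn_integral_lborel_eq_limit)
  have ch: "continuous_on A (\<lambda>t. h (complex_of_real t))" for A
    by (rule continuous_on_compose2[OF cont]) (auto intro!: continuous_intros)
  show "continuous_on UNIV (\<lambda>t. poisson y x t * Im (h (of_real t)))"
    by (intro continuous_intros y ch)
  show "0 \<le> poisson y x t * Im (h (of_real t))" for t
    using nonneg y by (auto simp: poisson_def intro!: mult_nonneg_nonneg)
  show "((\<lambda>R. integral {-R..R} (\<lambda>t. poisson y x t * Im (h (of_real t)))) \<longlongrightarrow> pi * Im (h (Complex x
      y))) at_top"
    by (rule poisson_Im_tendsto[OF cont diff bound y])
qed

lemma poisson_nonneg: "y > 0 \<Longrightarrow> 0 \<le> poisson y x t"
  by (simp add: poisson_def)

lemma poisson_sym: "poisson y x t = poisson y t x"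
  by (simp add: poisson_def power2_commute)

lemma poisson_le: "y > 0 \<Longrightarrow> poisson y x t \<le> 1 / y"
proof -
  assume y: "y > 0"
  have "y / ((t - x)\<^sup>2 + y\<^sup>2) \<le> y / y\<^sup>2"
    using y by (intro divide_left_mono mult_pos_pos add_nonneg_pos) auto
  then show ?thesis using y by (simp add: poisson_def power2_eq_square)
qed

lemma poisson_measurable [measurable]: "poisson y x \<in> borel_measurable borel"
  unfolding poisson_def by measurable

section \<open>Poisson smoothing and weak convergence\<close>

definition poisson_smooth :: "real \<Rightarrow> (real \<Rightarrow> real) \<Rightarrow> real \<Rightarrow> real" where
  "poisson_smooth y \<phi> x = (\<integral> t. \<phi> t * poisson y x t \<partial>lborel) / pi"

lemma poisson_integrable: "y > 0 \<Longrightarrow> integrable lborel (poisson y x)"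
  using nn_integral_poisson[of y x] by (intro integrableI_nonneg) (auto simp: poisson_nonneg)

lemma poisson_integral: "y > 0 \<Longrightarrow> (\<integral> t. poisson y x t \<partial>lborel) = pi"
  using nn_integral_poisson[of y x] by (subst integral_eq_nn_integral) (auto simp: poisson_nonneg)

lemma poisson_mult_integrable:
  fixes \<phi> :: "real \<Rightarrow> real"
  assumes "y > 0" "\<phi> \<in> borel_measurable borel" "\<And>t. \<bar>\<phi> t\<bar> \<le> M"
  shows "integrable lborel (\<lambda>t. \<phi> t * poisson y x t)"
proof (rule Bochner_Integration.integrable_bound)
  show "integrable lborel (\<lambda>t. M * poisson y x t)"
    by (intro integrable_mult_right poisson_integrable assms)
  show "AE t in lborel. norm (\<phi> t * poisson y x t) \<le> norm (M * poisson y x t)"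
    using assms(3) poisson_nonneg[OF assms(1), of x]
    by (auto simp: abs_mult intro!: mult_right_mono order_trans[OF _ abs_ge_self])
qed (use assms in measurable)

lemma poisson_scaled:
  assumes "y > 0"
  shows "y * poisson y x (x + y * t) = poisson 1 0 t"
proof -
  have "(x + y * t - x)\<^sup>2 + y\<^sup>2 = y * (y * (t\<^sup>2 + 1))"
    by (simp add: power2_eq_square algebra_simps)
  then show ?thesis using assms by (simp add: poisson_def)
qed

text \<open>Rescaling moves y from the kernel into the argument of the test function, leaving a
  fixed kernel for dominated convergence.\<close>

lemma poisson_smooth_eq:
  fixes \<phi> :: "real \<Rightarrow> real"
  assumes y: "y > 0"
  shows "poisson_smooth y \<phi> x = (\<integral> t. \<phi> (x + y * t) * poisson 1 0 t \<partial>lborel) / pi"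
proof -
  have "(\<integral> t. \<phi> t * poisson y x t \<partial>lborel) = \<bar>y\<bar> *\<^sub>R (\<integral> t. \<phi> (x + y * t) * poisson y x (x + y * t)
      \<partial>lborel)"
    by (rule lborel_integral_real_affine) (use y in simp)
  also have "\<dots> = (\<integral> t. \<phi> (x + y * t) * (y * poisson y x (x + y * t)) \<partial>lborel)"
    using y by (simp add: mult_ac flip: integral_mult_right_zero)
  finally show ?thesis unfolding poisson_smooth_def poisson_scaled[OF y] by simp
qed

lemma borel_measurable_lipschitz:
  fixes \<phi> :: "real \<Rightarrow> real"
  assumes L: "\<And>s t. \<bar>\<phi> s - \<phi> t\<bar> \<le> L * \<bar>s - t\<bar>"
  shows "\<phi> \<in> borel_measurable borel"
proof (rule borel_measurable_continuous_onI)
  have "0 \<le> L" using L[of 1 0] by simp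
  then have "L-lipschitz_on UNIV \<phi>" using L by (auto intro!: lipschitz_onI simp: dist_real_def)
  then show "continuous_on UNIV \<phi>" by (rule lipschitz_on_continuous_on)
qed

lemma poisson_smooth_uniform:
  fixes \<phi> :: "real \<Rightarrow> real"
  assumes L: "\<And>s t. \<bar>\<phi> s - \<phi> t\<bar> \<le> L * \<bar>s - t\<bar>" and M: "\<And>t. \<bar>\<phi> t\<bar> \<le> M"
    and e: "e > 0"
  shows "\<exists>y>0. \<forall>x. \<bar>poisson_smooth y \<phi> x - \<phi> x\<bar> \<le> e"
proof -
  have "0 \<le> L" using L[of 1 0] by simp
  have M0: "0 \<le> M" using M[of 0] by linarith
  have [measurable]: "\<phi> \<in> borel_measurable borel" by (rule borel_measurable_lipschitz[OF L])
  \<comment> \<open>Bounds |\<phi>(x + y t) - \<phi> x| times the kernel for y = 1 / (n + 1),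
    uniformly in x. The cap 2 M is essential: |t| times the kernel is not integrable.\<close>
  define g where "g = (\<lambda>(n::nat) t. min (L * \<bar>t\<bar> / Suc n) (2 * M) * poisson 1 0 t)"
  have "(\<lambda>n. \<integral> t. g n t \<partial>lborel) \<longlonglongrightarrow> (\<integral> (t::real). 0 \<partial>lborel)"
  proof (rule integral_dominated_convergence[where w = "\<lambda>t. 2 * M * poisson 1 0 t"])
    show "integrable lborel (\<lambda>t. 2 * M * poisson 1 0 t)"
      by (intro integrable_mult_right poisson_integrable) simp
    show "AE t in lborel. (\<lambda>n. g n t) \<longlonglongrightarrow> 0"
    proof (rule AE_I2)
      fix t
      have "(\<lambda>n. L * \<bar>t\<bar> / Suc n) \<longlonglongrightarrow> 0"
        by (rule LIMSEQ_Suc[OF lim_const_over_n])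
      then have "(\<lambda>n. min (L * \<bar>t\<bar> / Suc n) (2 * M) * poisson 1 0 t) \<longlonglongrightarrow> min 0 (2 * M) * poisson 1 0 t"
        by (intro tendsto_intros)
      then show "(\<lambda>n. g n t) \<longlonglongrightarrow> 0" using M0 by (simp add: g_def)
    qed
    show "AE t in lborel. norm (g n t) \<le> 2 * M * poisson 1 0 t" for n
      using M0 \<open>0 \<le> L\<close> poisson_nonneg[of 1 0]
      by (intro AE_I2) (auto simp: g_def abs_mult intro!: mult_right_mono)
    show "g n \<in> borel_measurable lborel" for n unfolding g_def by measurable
  qed simp
  then have "\<forall>\<^sub>F n in sequentially. (\<integral> t. g n t \<partial>lborel) < e * pi"
    by (intro order_tendstoD(2)) (use e in auto)
  then obtain n where n: "(\<integral> t. g n t \<partial>lborel) < e * pi"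
    by (auto simp: eventually_sequentially)
  define y where "y = 1 / real (Suc n)"
  have y: "y > 0" by (simp add: y_def)
  have "\<bar>poisson_smooth y \<phi> x - \<phi> x\<bar> \<le> e" for x
  proof -
    have i1: "integrable lborel (\<lambda>t. \<phi> (x + y * t) * poisson 1 0 t)"
      by (rule poisson_mult_integrable[where M = M]) (use M in auto)
    have i2: "integrable lborel (\<lambda>t. \<phi> x * poisson 1 0 t)"
      by (intro integrable_mult_right poisson_integrable) simp
    have ig: "integrable lborel (g n)"
      unfolding g_def
    proof (rule poisson_mult_integrable[where M = "2 * M"])
      fix t :: real
      have "0 \<le> L * \<bar>t\<bar> / Suc n" using \<open>0 \<le> L\<close> by simp
      then show "\<bar>min (L * \<bar>t\<bar> / Suc n) (2 * M)\<bar> \<le> 2 * M" using M0 by linarith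
      show "(\<lambda>t. min (L * \<bar>t\<bar> / Suc n) (2 * M)) \<in> borel_measurable borel"
        by measurable
    qed simp
    have eq: "pi * (poisson_smooth y \<phi> x - \<phi> x) = (\<integral> t. \<phi> (x + y * t) * poisson 1 0 t - \<phi> x *
        poisson 1 0 t \<partial>lborel)"
      unfolding poisson_smooth_eq[OF y] Bochner_Integration.integral_diff[OF i1 i2]
      by (simp add: poisson_integral field_simps)
    have "\<bar>pi * (poisson_smooth y \<phi> x - \<phi> x)\<bar> \<le> (\<integral> t. \<bar>\<phi> (x + y * t) * poisson 1 0 t - \<phi> x * poisson
        1 0 t\<bar> \<partial>lborel)"
      unfolding eq by (rule integral_abs_bound)
    also have "\<dots> \<le> (\<integral> t. g n t \<partial>lborel)"
    proof (rule integral_mono)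
      show "integrable lborel (\<lambda>t. \<bar>\<phi> (x + y * t) * poisson 1 0 t - \<phi> x * poisson 1 0 t\<bar>)"
        by (intro integrable_abs Bochner_Integration.integrable_diff i1 i2)
      show "integrable lborel (g n)" by (rule ig)
      fix t
      have "\<bar>\<phi> (x + y * t) - \<phi> x\<bar> \<le> L * \<bar>t\<bar> / Suc n"
      proof -
        have "\<bar>\<phi> (x + y * t) - \<phi> x\<bar> \<le> L * \<bar>y * t\<bar>" using L[of "x + y * t" x] by simp
        also have "\<bar>y * t\<bar> = \<bar>t\<bar> / Suc n" unfolding y_def abs_mult by simp
        finally show ?thesis by simp
      qed
      moreover have "\<bar>\<phi> (x + y * t) - \<phi> x\<bar> \<le> 2 * M"
        using M[of "x + y * t"] M[of x] by linarith
      ultimately have "\<bar>\<phi> (x + y * t) - \<phi> x\<bar> * poisson 1 0 t \<le> g n t"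
        unfolding g_def by (intro mult_right_mono poisson_nonneg) auto
      then show "\<bar>\<phi> (x + y * t) * poisson 1 0 t - \<phi> x * poisson 1 0 t\<bar> \<le> g n t"
        using poisson_nonneg[of 1 0 t] unfolding left_diff_distrib[symmetric] abs_mult by simp
    qed
    finally have "pi * \<bar>poisson_smooth y \<phi> x - \<phi> x\<bar> \<le> (\<integral> t. g n t \<partial>lborel)" by (simp add: abs_mult)
    then have "pi * \<bar>poisson_smooth y \<phi> x - \<phi> x\<bar> \<le> pi * e"
      using n unfolding mult.commute[of e pi] by linarith
    then show ?thesis by (rule mult_left_le_imp_le) simp
  qed
  with y show ?thesis by blast
qed

text \<open>By Fubini and the symmetry of the kernel, smoothing the test function is the same as
  smoothing the measure, and the latter is a Poisson integral.\<close>

lemma poisson_smooth_integral: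
  fixes \<phi> :: "real \<Rightarrow> real" and M :: "real measure"
  assumes "finite_measure M" and [measurable_cong]: "sets M = sets borel" and y: "y > 0"
    and [measurable]: "\<phi> \<in> borel_measurable borel" and nonneg: "\<And>t. 0 \<le> \<phi> t"
    and fin: "integrable lborel \<phi>" and B: "\<And>t. \<phi> t \<le> B"
  shows "(\<integral> x. poisson_smooth y \<phi> x \<partial>M) = (\<integral> t. \<phi> t * (\<integral> x. poisson y t x \<partial>M) \<partial>lborel) / pi"
    and "integrable M (poisson_smooth y \<phi>)"
proof -
  interpret M: finite_measure M by fact
  interpret P: pair_sigma_finite M lborel ..
  have m: "(\<lambda>(x, t). \<phi> t * poisson y x t) \<in> borel_measurable (M \<Otimes>\<^sub>M lborel)"
    unfolding poisson_def by measurable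
  have i: "integrable (M \<Otimes>\<^sub>M lborel) (\<lambda>(x, t). \<phi> t * poisson y x t)"
  proof (rule P.Fubini_integrable[OF m])
    have B0: "0 \<le> B" using nonneg[of 0] B[of 0] by linarith
    have "(\<integral> t. norm (case (x, t) of (x, t) \<Rightarrow> \<phi> t * poisson y x t) \<partial>lborel) = pi * poisson_smooth y
        \<phi> x" for x
      unfolding poisson_smooth_def by (simp add: abs_mult nonneg poisson_nonneg[OF y])
    moreover have "integrable M (poisson_smooth y \<phi>)"
    proof (rule M.integrable_const_bound[where B = B])
      have le: "(\<integral> t. \<phi> t * poisson y x t \<partial>lborel) \<le> (\<integral> t. B * poisson y x t \<partial>lborel)" for x
        by (intro integral_mono poisson_mult_integrable[where M = B] integrable_mult_right
            poisson_integrable mult_right_mono y B)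
           (use nonneg B poisson_nonneg[OF y] in auto)
      have "0 \<le> (\<integral> t. \<phi> t * poisson y x t \<partial>lborel)" for x
        by (rule Bochner_Integration.integral_nonneg) (use nonneg poisson_nonneg[OF y] in auto)
      then have "0 \<le> poisson_smooth y \<phi> x" for x unfolding poisson_smooth_def by simp
      moreover have "poisson_smooth y \<phi> x \<le> B" for x
        using le[of x] by (simp add: poisson_smooth_def poisson_integral[OF y] field_simps)
      ultimately show "AE x in M. norm (poisson_smooth y \<phi> x) \<le> B" by simp
      show "poisson_smooth y \<phi> \<in> borel_measurable M"
        unfolding poisson_smooth_def poisson_def by measurable
    qed
    ultimately show "integrable M (\<lambda>x. \<integral> t. norm (case (x, t) of (x, t) \<Rightarrow> \<phi> t * poisson y x t) \<partial>lborel)"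
      by simp
    show "AE x in M. integrable lborel (\<lambda>t. case (x, t) of (x, t) \<Rightarrow> \<phi> t * poisson y x t)"
      by (intro AE_I2) (use poisson_mult_integrable[OF y, of \<phi> B] nonneg B in simp)
  qed
  have "(\<integral> x. poisson_smooth y \<phi> x \<partial>M) = (\<integral> x. (\<integral> t. \<phi> t * poisson y x t \<partial>lborel) \<partial>M) / pi"
    by (simp add: poisson_smooth_def)
  also have "(\<integral> x. (\<integral> t. \<phi> t * poisson y x t \<partial>lborel) \<partial>M) = (\<integral> t. (\<integral> x. \<phi> t * poisson y x t \<partial>M)
      \<partial>lborel)"
    using P.Fubini_integral[OF i] by simp
  finally show "(\<integral> x. poisson_smooth y \<phi> x \<partial>M) = (\<integral> t. \<phi> t * (\<integral> x. poisson y t x \<partial>M) \<partial>lborel) / pi"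
    by (simp add: poisson_sym[of y])
  show "integrable M (poisson_smooth y \<phi>)"
  proof -
    have "poisson_smooth y \<phi> = (\<lambda>x. (\<integral> t. \<phi> t * poisson y x t \<partial>lborel) / pi)"
      by (rule ext) (rule poisson_smooth_def)
    then show ?thesis using P.integrable_fst'[OF i] by simp
  qed
qed

text \<open>For the smoothed function, Poisson integrals converge pointwise and are at most 1 / y,
  so \<phi> / y dominates. Replacing \<phi> by its smoothing costs a uniform error, the same for all
  measures of mass at most 1.\<close>

lemma weak_convergence_from_poisson:
  fixes \<phi> :: "real \<Rightarrow> real" and \<mu> :: "real measure" and \<nu> :: "nat \<Rightarrow> real measure"
  assumes mu: "finite_measure \<mu>" "sets \<mu> = sets borel" "measure \<mu> UNIV \<le> 1"
    and nu: "\<And>k. finite_measure (\<nu> k)" "\<And>k. sets (\<nu> k) = sets borel" "\<And>k. measure (\<nu> k) UNIV \<le> 1"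
    and lim: "\<And>x y. y > 0 \<Longrightarrow> (\<lambda>k. \<integral> t. poisson y x t \<partial>\<nu> k) \<longlonglongrightarrow> (\<integral> t. poisson y x t \<partial>\<mu>)"
    and L: "\<And>s t. \<bar>\<phi> s - \<phi> t\<bar> \<le> L * \<bar>s - t\<bar>" and B: "\<And>t. \<phi> t \<le> B"
    and nonneg: "\<And>t. 0 \<le> \<phi> t" and fin: "integrable lborel \<phi>"
  shows "(\<lambda>k. \<integral> t. \<phi> t \<partial>\<nu> k) \<longlonglongrightarrow> (\<integral> t. \<phi> t \<partial>\<mu>)"
proof -
  have \<phi>_meas [measurable]: "\<phi> \<in> borel_measurable borel" using fin by simp
  have Babs: "\<bar>\<phi> t\<bar> \<le> B" for t using B nonneg by simp
  have close: "\<bar>(\<integral> t. \<phi> t \<partial>M) - (\<integral> t. poisson_smooth y \<phi> t \<partial>M)\<bar> \<le> e"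
    if "finite_measure M" "sets M = sets borel" "measure M UNIV \<le> 1" "y > 0"
      "\<And>x. \<bar>poisson_smooth y \<phi> x - \<phi> x\<bar> \<le> e" for M :: "real measure" and y e
  proof -
    interpret M: finite_measure M by fact
    have sp: "space M = UNIV" using sets_eq_imp_space_eq[OF that(2)] by simp
    have [measurable_cong]: "sets M = sets borel" by fact
    have ip: "integrable M \<phi>" by (rule M.integrable_const_bound[where B = B]) (use Babs in auto)
    have ips: "integrable M (poisson_smooth y \<phi>)"
      by (rule poisson_smooth_integral(2)[OF that(1,2,4) _ nonneg fin B]) simp
    have "\<bar>(\<integral> t. \<phi> t \<partial>M) - (\<integral> t. poisson_smooth y \<phi> t \<partial>M)\<bar> = \<bar>\<integral> t. \<phi> t - poisson_smooth y \<phi> t \<partial>M\<bar>"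
      by (simp add: ip ips)
    also have "\<dots> \<le> (\<integral> t. \<bar>\<phi> t - poisson_smooth y \<phi> t\<bar> \<partial>M)" by (rule integral_abs_bound)
    also have "\<dots> \<le> (\<integral> t. e \<partial>M)"
      by (intro integral_mono integrable_abs Bochner_Integration.integrable_diff ip ips)
         (use that(5) in \<open>auto simp: abs_minus_commute\<close>)
    also have "\<dots> = e * measure M UNIV" by (simp add: sp mult.commute)
    also have "\<dots> \<le> e" using that(3) order_trans[OF abs_ge_zero that(5)[of 0]] by (simp add:
        mult_left_le)
    finally show ?thesis .
  qed
  have smooth: "(\<lambda>k. \<integral> t. poisson_smooth y \<phi> t \<partial>\<nu> k) \<longlonglongrightarrow> (\<integral> t. poisson_smooth y \<phi> t \<partial>\<mu>)" if y: "y > 0"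
      for y
  proof -
    have m: "(\<lambda>x. \<integral> t. poisson y x t \<partial>M) \<in> borel_measurable lborel" "\<bar>\<integral> t. poisson y x t \<partial>M\<bar> \<le> 1 / y"
      if "finite_measure M" "sets M = sets borel" "measure M UNIV \<le> 1" for M x
    proof -
      interpret M: finite_measure M by fact
      have [measurable_cong]: "sets M = sets borel" by fact
      show "(\<lambda>x. \<integral> t. poisson y x t \<partial>M) \<in> borel_measurable lborel"
        unfolding poisson_def by measurable
      have sp: "space M = UNIV" using sets_eq_imp_space_eq[OF that(2)] by simp
      have ipo: "integrable M (poisson y x)"
        by (rule M.integrable_const_bound[where B = "1 / y"]) (use poisson_le[OF y]
            poisson_nonneg[OF y] in auto)
      have "(\<integral> t. poisson y x t \<partial>M) \<le> (\<integral> t. 1 / y \<partial>M)"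
        by (intro integral_mono ipo) (use poisson_le[OF y] in auto)
      also have "\<dots> = 1 / y * measure M UNIV" by (simp add: sp)
      also have "\<dots> \<le> 1 / y" using that(3) y by (simp add: divide_right_mono)
      finally have "(\<integral> t. poisson y x t \<partial>M) \<le> 1 / y" .
      moreover have "0 \<le> (\<integral> t. poisson y x t \<partial>M)" by (intro Bochner_Integration.integral_nonneg
          poisson_nonneg y)
      ultimately show "\<bar>\<integral> t. poisson y x t \<partial>M\<bar> \<le> 1 / y" by simp
    qed
    have "(\<lambda>k. \<integral> t. \<phi> t * (\<integral> x. poisson y t x \<partial>\<nu> k) \<partial>lborel) \<longlonglongrightarrow> (\<integral> t. \<phi> t * (\<integral> x. poisson y t x \<partial>\<mu>)
        \<partial>lborel)"
    proof (rule integral_dominated_convergence[where w = "\<lambda>t. \<phi> t * (1 / y)"])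
      show "integrable lborel (\<lambda>t. \<phi> t * (1 / y))" by (intro integrable_mult_left fin)
      show "AE t in lborel. (\<lambda>k. \<phi> t * (\<integral> x. poisson y t x \<partial>\<nu> k)) \<longlonglongrightarrow> \<phi> t * (\<integral> x. poisson y t x \<partial>\<mu>)"
        by (intro AE_I2 tendsto_mult_left lim y)
      show "AE t in lborel. norm (\<phi> t * (\<integral> x. poisson y t x \<partial>\<nu> k)) \<le> \<phi> t * (1 / y)" for k
        unfolding real_norm_def abs_mult
        by (intro AE_I2 mult_mono m(2)[OF nu(1) nu(2) nu(3)]) (use nonneg in auto)
      have \<phi>_l: "\<phi> \<in> borel_measurable lborel" by simp
      show "(\<lambda>t. \<phi> t * (\<integral> x. poisson y t x \<partial>\<mu>)) \<in> borel_measurable lborel"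
        by (rule borel_measurable_times[OF \<phi>_l m(1)[OF mu]])
      show "(\<lambda>t. \<phi> t * (\<integral> x. poisson y t x \<partial>\<nu> k)) \<in> borel_measurable lborel" for k
        by (rule borel_measurable_times[OF \<phi>_l m(1)[OF nu(1) nu(2) nu(3)]])
    qed
    from tendsto_divide[OF this tendsto_const[of pi]] show ?thesis
      unfolding poisson_smooth_integral(1)[OF mu(1,2) y \<phi>_meas nonneg fin B]
        poisson_smooth_integral(1)[OF nu(1,2) y \<phi>_meas nonneg fin B] by simp
  qed
  show ?thesis
  proof (rule LIMSEQ_I)
    fix e :: real assume e: "e > 0"
    obtain y where y: "y > 0" "\<And>x. \<bar>poisson_smooth y \<phi> x - \<phi> x\<bar> \<le> e / 4"
      using poisson_smooth_uniform[OF L Babs, of "e / 4"] e by auto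
    from LIMSEQ_D[OF smooth[OF y(1)], of "e / 4"] e obtain k0 where
      k0: "\<And>k. k \<ge> k0 \<Longrightarrow> \<bar>(\<integral> t. poisson_smooth y \<phi> t \<partial>\<nu> k) - (\<integral> t. poisson_smooth y \<phi> t \<partial>\<mu>)\<bar> < e / 4"
      by auto
    have "\<bar>(\<integral> t. \<phi> t \<partial>\<nu> k) - (\<integral> t. \<phi> t \<partial>\<mu>)\<bar> < e" if "k \<ge> k0" for k
      using k0[OF that] close[OF nu(1) nu(2) nu(3) y, of k] close[OF mu y] e by linarith
    then show "\<exists>no. \<forall>n\<ge>no. norm ((\<integral> t. \<phi> t \<partial>\<nu> n) - (\<integral> t. \<phi> t \<partial>\<mu>)) < e"
      by auto
  qed
qed

section \<open>Asymptotics along pairs of equal weights\<close>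

lemma abs_mult_le_sum_squares: "\<bar>a * c\<bar> \<le> a\<^sup>2 + (c::real)\<^sup>2"
proof -
  have "2 * \<bar>a\<bar> * \<bar>c\<bar> \<le> \<bar>a\<bar>\<^sup>2 + \<bar>c\<bar>\<^sup>2" by (rule sum_squares_bound)
  moreover have "0 \<le> \<bar>a\<bar> * \<bar>c\<bar>" by simp
  ultimately show ?thesis unfolding abs_mult power2_abs by linarith
qed

lemma quadratic_step_bound:
  fixes a c :: real
  shows "(M * \<bar>a\<bar> + \<bar>c\<bar>)\<^sup>2 \<le> (M\<^sup>2 + 1) * (a\<^sup>2 + c\<^sup>2)"
proof -
  have "(M\<^sup>2 + 1) * (a\<^sup>2 + c\<^sup>2) - (M * \<bar>a\<bar> + \<bar>c\<bar>)\<^sup>2 = (M * \<bar>c\<bar> - \<bar>a\<bar>)\<^sup>2"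
    by (simp add: power2_eq_square algebra_simps flip: abs_mult)
  then show ?thesis using zero_le_power2[of "M * \<bar>c\<bar> - \<bar>a\<bar>"] by linarith
qed

lemma abs_ln_le:
  fixes t :: real
  assumes "\<bar>t\<bar> \<le> 1 / 2"
  shows "\<bar>ln (1 + t)\<bar> \<le> 2 * \<bar>t\<bar>"
proof -
  have "\<bar>ln (1 + t) - t\<bar> \<le> 2 * t\<^sup>2" by (rule abs_ln_one_plus_x_minus_x_bound[OF assms])
  also have "2 * t\<^sup>2 = 2 * \<bar>t\<bar> * \<bar>t\<bar>" by (simp add: power2_eq_square)
  also have "\<dots> \<le> 1 * \<bar>t\<bar>" using assms by (intro mult_right_mono) auto
  finally show ?thesis by linarith
qed

text \<open>Turns relative errors into additive ones, to which the M-test applies.\<close>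

lemma abs_ln_diff_le:
  fixes a a' :: real
  assumes "0 < a" "\<bar>a' - a\<bar> \<le> r * a" "r \<le> 1 / 2"
  shows "\<bar>ln a' - ln a\<bar> \<le> 2 * r" "0 < a'"
proof -
  have "r * a \<le> a / 2" using assms mult_right_mono[of r "1/2" a] by simp
  then show a': "0 < a'" using assms by linarith
  have t: "\<bar>a' / a - 1\<bar> \<le> r"
    using assms by (simp add: field_simps abs_le_iff)
  then have "\<bar>ln (1 + (a' / a - 1))\<bar> \<le> 2 * \<bar>a' / a - 1\<bar>" using assms by (intro abs_ln_le) auto
  then show "\<bar>ln a' - ln a\<bar> \<le> 2 * r" using t a' assms by (simp add: ln_div)
qed

text \<open>\<open>s k\<close> is the common value of the \<open>k\<close>-th pair of equal weights; \<open>v k\<close> and \<open>u k\<close> are the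
  orthogonal polynomials whose indices are those of the second weight of the pair and its successor.\<close>

locale pair_recurrence =
  fixes s :: "nat \<Rightarrow> real" and u v :: "nat \<Rightarrow> real \<Rightarrow> real"
  assumes s_ge_1: "1 \<le> s k"
    and v_rec: "s (Suc k) * v (Suc k) x = x * u k x - s k * v k x"
    and u_rec: "s (Suc k) * u (Suc k) x = x * v (Suc k) x - s (Suc k) * u k x"
    and uv_nz: "0 < (u k x)\<^sup>2 + (v k x)\<^sup>2"
    and u_cont: "continuous_on A (u k)"
    and v_cont: "continuous_on A (v k)"
    and s_mono: "s k \<le> s (Suc k)"
    and s_doubling: "s (Suc k) \<le> 2 * s k"
    and s_concave: "s (Suc (Suc k)) - s (Suc k) \<le> s (Suc k) - s k"
    and s_diff_tendsto: "(\<lambda>k. s (Suc k) - s k) \<longlonglongrightarrow> 0"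
    and s_tendsto: "filterlim s at_top sequentially"
    and s_summable: "summable (\<lambda>k. (s (Suc k) - s k)\<^sup>2 / s k)"
begin

definition d where "d k = s (Suc k) - s k"
definition amp where "amp k x = s k * ((u k x)\<^sup>2 + (v k x)\<^sup>2)"

text \<open>The generalized Turan determinant \<open>s (u\<^sup>2 + v\<^sup>2) - x u v\<close> would be constant for constant
  weights. Its increment contains the term \<open>d (u\<^sup>2 - v\<^sup>2)\<close>, which is not summable but oscillates;
  the last summand removes it by summation by parts.\<close>

definition turan where
  "turan k x = amp k x - x * (u k x * v k x) + d k * s (Suc k) / x * (u k x * v k x)"

lemma s_pos: "0 < s k" using s_ge_1[of k] by simp

lemma d_nonneg: "0 \<le> d k" using s_mono[of k] by (simp add: d_def)

lemma s_Suc: "s (Suc k) = s k + d k" by (simp add: d_def)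

lemma amp_pos: "0 < amp k x"
  unfolding amp_def using s_pos uv_nz by simp

text \<open>The uncorrected form changes by a term D (U^2 - V^2) (fact 3), and the correction by - D
  (U^2 - V'^2) (fact 4). Their sum D (V'^2 - V^2) is small because V' is close to - V when the
  weight is large.\<close>

lemma turan_step:
  assumes "x \<noteq> 0"
  shows "turan (Suc k) x - turan k x =
     d k * ((v (Suc k) x)\<^sup>2 - (v k x)\<^sup>2)
     + d k / s (Suc k) * (x * (u k x * v k x) + d k * (v k x)\<^sup>2)
     - (d k)\<^sup>2 / x * (u k x * v k x)
     + (d (Suc k) * s (Suc (Suc k)) - d k * s (Suc k)) / x * (u (Suc k) x * v (Suc k) x)"
proof -
  define S where "S = s (Suc k)"
  define D where "D = d k"
  have sk: "s k = S - D" by (simp add: S_def D_def d_def)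
  have S: "S \<noteq> 0" using s_pos[of "Suc k"] by (simp add: S_def)
  define U where "U = u k x" define V where "V = v k x"
  define V' where "V' = v (Suc k) x" define U' where "U' = u (Suc k) x"
  have vr: "S * V' = x * U - (S - D) * V"
    using v_rec[of k x] by (simp add: S_def[symmetric] sk U_def V_def V'_def)
  have ur: "S * U' = x * V' - S * U"
    using u_rec[of k x] by (simp add: S_def[symmetric] U_def U'_def V'_def)
  \<comment> \<open>From (U, V') to (U', V') both weights are S, so the form is invariant: the left
    side equals S (U^2 + V'^2) - x U V', and \<open>vr\<close> simplifies it.\<close>
  have 1: "S * (U'\<^sup>2 + V'\<^sup>2) - x * (U' * V') = S * U\<^sup>2 - (S - D) * (V * V')"
  proof -
    have "S * (S * (U'\<^sup>2 + V'\<^sup>2) - x * (U' * V')) = (S * U')\<^sup>2 - x * (S * U') * V' + (S * V')\<^sup>2"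
      by (simp add: algebra_simps power2_eq_square)
    also have "\<dots> = S * (S * U\<^sup>2) + (S * V') * (S * V') - x * U * (S * V')"
      unfolding ur by (simp add: algebra_simps power2_eq_square)
    also have "\<dots> = S * (S * U\<^sup>2 - (S - D) * (V * V'))"
      unfolding vr[symmetric] using vr by algebra
    finally show ?thesis using S by simp
  qed
  have 2: "S * (U' * V' - U * V) = - D * (U * V) - x * (U\<^sup>2 - V'\<^sup>2)"
    using vr ur by algebra
  have 3: "(S * U\<^sup>2 - (S - D) * (V * V')) - ((S - D) * (U\<^sup>2 + V\<^sup>2) - x * (U * V))
      = D * (U\<^sup>2 - V\<^sup>2) + D / S * (x * (U * V) + D * V\<^sup>2)"
  proof -
    have "S * ((S * U\<^sup>2 - (S - D) * (V * V')) - ((S - D) * (U\<^sup>2 + V\<^sup>2) - x * (U * V)))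
      = S * (D * (U\<^sup>2 - V\<^sup>2)) + D * (x * (U * V) + D * V\<^sup>2)"
      using vr by algebra
    then show ?thesis using S by (simp add: field_simps)
  qed
  have 4: "D * S / x * (U' * V' - U * V) = - D\<^sup>2 / x * (U * V) - D * (U\<^sup>2 - V'\<^sup>2)"
  proof -
    have "D * S / x * (U' * V' - U * V) = D / x * (S * (U' * V' - U * V))" by simp
    also have "\<dots> = - D\<^sup>2 / x * (U * V) - D * (U\<^sup>2 - V'\<^sup>2)"
      unfolding 2 using assms by (simp add: field_simps power2_eq_square)
    finally show ?thesis .
  qed
  have e: "turan (Suc k) x = (S * (U'\<^sup>2 + V'\<^sup>2) - x * (U' * V')) + d (Suc k) * s (Suc (Suc k)) / x *
      (U' * V')"
    "turan k x = ((S - D) * (U\<^sup>2 + V\<^sup>2) - x * (U * V)) + D * S / x * (U * V)"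
    by (simp_all add: turan_def amp_def S_def[symmetric] sk U_def V_def V'_def U'_def D_def[symmetric])
  have "turan (Suc k) x - turan k x =
     (D * (U\<^sup>2 - V\<^sup>2) + D / S * (x * (U * V) + D * V\<^sup>2)) + D * S / x * (U' * V' - U * V)
      + (d (Suc k) * s (Suc (Suc k)) - D * S) / x * (U' * V')"
    unfolding e 1 3[symmetric] by (simp add: algebra_simps diff_divide_distrib)
  also have "\<dots> = D * (V'\<^sup>2 - V\<^sup>2) + D / S * (x * (U * V) + D * V\<^sup>2) - D\<^sup>2 / x * (U * V)
     + (d (Suc k) * s (Suc (Suc k)) - D * S) / x * (U' * V')"
    unfolding 4 by (simp add: algebra_simps)
  finally show ?thesis by (simp add: S_def D_def U_def V_def U'_def V'_def)
qed

text \<open>Here c and M bound |x| from below and above, and (M^2 + 1) (M^2 + 3) is the growth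
  factor of \<open>next_norm_bound\<close>. The grouping isolates three summable sequences.\<close>

definition rho :: "real \<Rightarrow> real \<Rightarrow> nat \<Rightarrow> real" where
  "rho c M k = (M\<^sup>2 + 2 * M) * (d k / (s k * s (Suc k)))
     + (3 + 1 / c + (M\<^sup>2 + 1) * (M\<^sup>2 + 3) / c) * ((d k)\<^sup>2 / s k)
     + 2 * ((M\<^sup>2 + 1) * (M\<^sup>2 + 3)) / c * (d k - d (Suc k))"

lemma d_antimono: "d (Suc k) \<le> d k"
  using s_concave[of k] by (simp add: d_def)

text \<open>The first sequence telescopes as 1 / s k - 1 / s (k + 1) with s tending to infinity, the
  third one telescopes with d tending to 0, and the middle one is summable by assumption.\<close>

lemma summable_rho: "summable (rho c M)"
proof -
  have "summable (\<lambda>k. 1 / s k - 1 / s (Suc k))"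
    by (rule telescope_summable'[where c = 0])
       (intro tendsto_divide_0[OF tendsto_const] filterlim_at_top_imp_at_infinity s_tendsto)
  moreover have "1 / s k - 1 / s (Suc k) = d k / (s k * s (Suc k))" for k
    using s_pos[of k] s_pos[of "Suc k"] by (simp add: d_def field_simps)
  ultimately have 1: "summable (\<lambda>k. d k / (s k * s (Suc k)))" by simp
  have 2: "summable (\<lambda>k. d k - d (Suc k))"
    by (rule telescope_summable'[where c = 0]) (use s_diff_tendsto in \<open>simp add: d_def\<close>)
  have 3: "summable (\<lambda>k. (d k)\<^sup>2 / s k)" using s_summable by (simp add: d_def)
  show ?thesis unfolding rho_def by (intro summable_add summable_mult 1 2 3)
qed

text \<open>Since s is at least 1 and increasing, each half step costs a factor M^2 + 1 by
  Cauchy-Schwarz: (M^2 + 1) for v and (M^2 + 1) (M^2 + 2) for u, which add up to the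
  constant.\<close>

lemma next_norm_bound:
  assumes "\<bar>x\<bar> \<le> M"
  shows "(u (Suc k) x)\<^sup>2 + (v (Suc k) x)\<^sup>2 \<le> (M\<^sup>2 + 1) * (M\<^sup>2 + 3) * ((u k x)\<^sup>2 + (v k x)\<^sup>2)"
proof -
  let ?Q = "(u k x)\<^sup>2 + (v k x)\<^sup>2"
  have M0: "M \<ge> 0" using assms by linarith
  have S: "1 \<le> s (Suc k)" "s k \<le> s (Suc k)" "0 < s k" using s_ge_1 s_mono s_pos by auto
  have "v (Suc k) x = x / s (Suc k) * u k x - s k / s (Suc k) * v k x"
    using v_rec[of k x] S by (simp add: field_simps)
  then have "\<bar>v (Suc k) x\<bar> \<le> \<bar>x / s (Suc k) * u k x\<bar> + \<bar>s k / s (Suc k) * v k x\<bar>"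
    by (metis abs_triangle_ineq4)
  also have "\<dots> \<le> M * \<bar>u k x\<bar> + 1 * \<bar>v k x\<bar>"
    unfolding abs_mult
  proof (intro add_mono mult_right_mono)
    have "\<bar>x\<bar> / s (Suc k) \<le> \<bar>x\<bar> / 1" using S by (intro divide_left_mono) auto
    then show "\<bar>x / s (Suc k)\<bar> \<le> M" using assms S by (simp add: abs_divide)
    show "\<bar>s k / s (Suc k)\<bar> \<le> 1" using S by simp
  qed auto
  finally have v: "\<bar>v (Suc k) x\<bar> \<le> M * \<bar>u k x\<bar> + \<bar>v k x\<bar>" by simp
  have "(v (Suc k) x)\<^sup>2 = \<bar>v (Suc k) x\<bar>\<^sup>2" by simp
  also have "\<dots> \<le> (M * \<bar>u k x\<bar> + \<bar>v k x\<bar>)\<^sup>2" by (rule power_mono[OF v]) simp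
  also have "\<dots> \<le> (M\<^sup>2 + 1) * ?Q" by (rule quadratic_step_bound)
  finally have v2: "(v (Suc k) x)\<^sup>2 \<le> (M\<^sup>2 + 1) * ?Q" .
  have "u (Suc k) x = x / s (Suc k) * v (Suc k) x - u k x"
    using u_rec[of k x] S by (simp add: field_simps)
  then have "\<bar>u (Suc k) x\<bar> \<le> \<bar>x / s (Suc k) * v (Suc k) x\<bar> + \<bar>u k x\<bar>"
    by (metis abs_triangle_ineq4)
  also have "\<dots> \<le> M * \<bar>v (Suc k) x\<bar> + \<bar>u k x\<bar>"
    unfolding abs_mult
  proof (intro add_mono mult_right_mono)
    have "\<bar>x\<bar> / s (Suc k) \<le> \<bar>x\<bar> / 1" using S by (intro divide_left_mono) auto
    then show "\<bar>x / s (Suc k)\<bar> \<le> M" using assms S by (simp add: abs_divide)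
  qed auto
  finally have u: "\<bar>u (Suc k) x\<bar> \<le> M * \<bar>v (Suc k) x\<bar> + \<bar>u k x\<bar>" .
  have "(u (Suc k) x)\<^sup>2 = \<bar>u (Suc k) x\<bar>\<^sup>2" by simp
  also have "\<dots> \<le> (M * \<bar>v (Suc k) x\<bar> + \<bar>u k x\<bar>)\<^sup>2" by (rule power_mono[OF u]) simp
  also have "\<dots> \<le> (M\<^sup>2 + 1) * ((v (Suc k) x)\<^sup>2 + (u k x)\<^sup>2)" by (rule quadratic_step_bound)
  also have "\<dots> \<le> (M\<^sup>2 + 1) * ((M\<^sup>2 + 1) * ?Q + ?Q)"
    using v2 by (intro mult_left_mono add_mono) auto
  finally show ?thesis using v2 by (simp add: algebra_simps)
qed

lemma turan_increment:
  assumes c: "0 < c" "c \<le> \<bar>x\<bar>" and M: "\<bar>x\<bar> \<le> M"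
  shows "\<bar>turan (Suc k) x - turan k x\<bar> \<le> rho c M k * amp k x"
proof -
  define Q where "Q = (u k x)\<^sup>2 + (v k x)\<^sup>2"
  define S where "S = s (Suc k)"
  define D where "D = d k"
  define D' where "D' = d (Suc k)"
  define G where "G = (M\<^sup>2 + 1) * (M\<^sup>2 + 3)"
  have x0: "x \<noteq> 0" and M0: "0 \<le> M" using c M by auto
  have s: "0 < s k" and S: "0 < S" "1 \<le> S" "s k \<le> S" "S \<le> 2 * s k" "S = s k + D"
    using s_pos s_ge_1 s_mono s_doubling by (auto simp: S_def D_def s_Suc[symmetric])
  have D: "0 \<le> D" "0 \<le> D'" "D' \<le> D" using d_nonneg d_antimono by (auto simp: D_def D'_def)
  have Q: "0 \<le> Q" by (simp add: Q_def)
  have G: "0 \<le> G" by (simp add: G_def)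
  have A: "amp k x = s k * Q" by (simp add: amp_def Q_def)
  have uv: "\<bar>u k x * v k x\<bar> \<le> Q" unfolding Q_def by (rule abs_mult_le_sum_squares)
  have uv2: "2 * \<bar>u k x * v k x\<bar> \<le> Q"
    unfolding Q_def using sum_squares_bound[of "\<bar>u k x\<bar>" "\<bar>v k x\<bar>"] by (simp add: abs_mult)
  have uQ: "(u k x)\<^sup>2 \<le> Q" and vQ: "(v k x)\<^sup>2 \<le> Q" by (simp_all add: Q_def)
  have x2: "x\<^sup>2 \<le> M\<^sup>2" using M by (rule abs_le_square_iff[THEN iffD1, OF order_trans[OF _ abs_ge_self]])

  \<comment> \<open>Squaring the recurrence for S v' brings in s^2 - S^2 = - D (s + S). All terms
    are then of order at most S rather than S^2, which gains a factor 1 / S.\<close>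
  have t1: "\<bar>D * ((v (Suc k) x)\<^sup>2 - (v k x)\<^sup>2)\<bar> \<le> D * ((M\<^sup>2 + M + 2 * D) * Q / S)"
  proof -
    have "S * v (Suc k) x = x * u k x - s k * v k x" using v_rec by (simp add: S_def)
    then have "S\<^sup>2 * ((v (Suc k) x)\<^sup>2 - (v k x)\<^sup>2)
        = x\<^sup>2 * (u k x)\<^sup>2 - x * s k * (2 * (u k x * v k x)) - (D * (s k + S)) * (v k x)\<^sup>2"
      using S(5) by algebra
    then have "\<bar>S\<^sup>2 * ((v (Suc k) x)\<^sup>2 - (v k x)\<^sup>2)\<bar>
        \<le> \<bar>x\<^sup>2 * (u k x)\<^sup>2\<bar> + \<bar>x * s k * (2 * (u k x * v k x))\<bar> + \<bar>(D * (s k + S)) * (v k x)\<^sup>2\<bar>"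
      by linarith
    also have "\<dots> \<le> M\<^sup>2 * Q + M * S * Q + (D * (2 * S)) * Q"
    proof (intro add_mono)
      show "\<bar>x\<^sup>2 * (u k x)\<^sup>2\<bar> \<le> M\<^sup>2 * Q" using x2 uQ by (simp add: abs_mult mult_mono)
      show "\<bar>x * s k * (2 * (u k x * v k x))\<bar> \<le> M * S * Q"
        unfolding abs_mult using M uv2 s S Q M0 by (intro mult_mono) (auto simp: abs_mult)
      show "\<bar>(D * (s k + S)) * (v k x)\<^sup>2\<bar> \<le> (D * (2 * S)) * Q"
        unfolding abs_mult using D s S vQ by (intro mult_mono) auto
    qed
    also have "\<dots> \<le> S * ((M\<^sup>2 + M + 2 * D) * Q)"
      using mult_right_mono[OF S(2), of "M\<^sup>2 * Q"] Q by (simp add: algebra_simps)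
    finally have "S * (S * \<bar>(v (Suc k) x)\<^sup>2 - (v k x)\<^sup>2\<bar>) \<le> S * ((M\<^sup>2 + M + 2 * D) * Q)"
      using S by (simp add: abs_mult power2_eq_square mult.assoc)
    from mult_left_le_imp_le[OF this S(1)]
    have "\<bar>(v (Suc k) x)\<^sup>2 - (v k x)\<^sup>2\<bar> \<le> (M\<^sup>2 + M + 2 * D) * Q / S"
      by (simp only: pos_le_divide_eq[OF S(1)] mult.commute[of S])
    from mult_left_mono[OF this D(1)] show ?thesis using D by (simp add: abs_mult)
  qed
  have t2: "\<bar>D / S * (x * (u k x * v k x) + D * (v k x)\<^sup>2)\<bar> \<le> D / S * ((M + D) * Q)"
  proof -
    have "\<bar>x * (u k x * v k x) + D * (v k x)\<^sup>2\<bar> \<le> \<bar>x * (u k x * v k x)\<bar> + \<bar>D * (v k x)\<^sup>2\<bar>"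
      by (rule abs_triangle_ineq)
    also have "\<dots> \<le> M * Q + D * Q"
      using M M0 uv D vQ by (intro add_mono) (auto simp: abs_mult intro!: mult_mono)
    finally have "\<bar>x * (u k x * v k x) + D * (v k x)\<^sup>2\<bar> \<le> (M + D) * Q" by (simp add: algebra_simps)
    from mult_left_mono[OF this, of "D / S"] show ?thesis using D S by (simp add: abs_mult)
  qed
  have t3: "\<bar>D\<^sup>2 / x * (u k x * v k x)\<bar> \<le> D\<^sup>2 / c * Q"
  proof -
    have "D\<^sup>2 / \<bar>x\<bar> \<le> D\<^sup>2 / c" using c by (intro divide_left_mono) auto
    then show ?thesis unfolding abs_mult[of "D\<^sup>2 / x"] using uv c
      by (intro mult_mono) (auto simp: abs_divide)
  qed
  have t4: "\<bar>(D' * s (Suc (Suc k)) - D * S) / x * (u (Suc k) x * v (Suc k) x)\<bar>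
      \<le> ((D - D') * (2 * s k) + D\<^sup>2) / c * (G * Q)"
  proof -
    \<comment> \<open>Summation by parts: the increment of d s is a second difference of s times S,
      plus a square of a first difference.\<close>
    have "D' * s (Suc (Suc k)) - D * S = - ((D - D') * S) + D'\<^sup>2"
      by (simp add: s_Suc[of "Suc k"] D'_def S_def algebra_simps power2_eq_square)
    also have "\<bar>\<dots>\<bar> \<le> (D - D') * S + D'\<^sup>2"
      using D S abs_triangle_ineq[of "- ((D - D') * S)" "D'\<^sup>2"] by (simp add: abs_mult)
    also have "\<dots> \<le> (D - D') * (2 * s k) + D\<^sup>2"
      using D S by (intro add_mono mult_left_mono power_mono) auto
    finally have 1: "\<bar>(D' * s (Suc (Suc k)) - D * S) / x\<bar> \<le> ((D - D') * (2 * s k) + D\<^sup>2) / c"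
      unfolding abs_divide using c by (intro frac_le) auto
    have "\<bar>u (Suc k) x * v (Suc k) x\<bar> \<le> G * Q"
      using abs_mult_le_sum_squares[of "u (Suc k) x" "v (Suc k) x"] next_norm_bound[OF M, of k] by
          (simp add: G_def Q_def)
    then show ?thesis unfolding abs_mult[of "_ / x"]
      by (intro mult_mono 1 order_trans[OF abs_ge_zero 1]) auto
  qed
  have "\<bar>turan (Suc k) x - turan k x\<bar> \<le> D * ((M\<^sup>2 + M + 2 * D) * Q / S) + D / S * ((M + D) * Q)
      + D\<^sup>2 / c * Q + ((D - D') * (2 * s k) + D\<^sup>2) / c * (G * Q)"
    using t1 t2 t3 t4 unfolding turan_step[OF x0] D_def[symmetric] S_def[symmetric] D'_def[symmetric]
    by linarith
  also have "\<dots> = ((M\<^sup>2 + 2 * M) * (D / S) + 3 * (D\<^sup>2 / S) + (1 / c + G / c) * D\<^sup>2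
      + 2 * G / c * (D - D') * s k) * Q"
    using c S by (simp add: field_simps power2_eq_square)
  also have "\<dots> \<le> ((M\<^sup>2 + 2 * M) * (D / S) + 3 * D\<^sup>2 + (1 / c + G / c) * D\<^sup>2
      + 2 * G / c * (D - D') * s k) * Q"
  proof (rule mult_right_mono[OF _ Q])
    have "D\<^sup>2 / S \<le> D\<^sup>2 / 1" using S by (intro divide_left_mono) auto
    then show "(M\<^sup>2 + 2 * M) * (D / S) + 3 * (D\<^sup>2 / S) + (1 / c + G / c) * D\<^sup>2 + 2 * G / c * (D -
        D') * s k
        \<le> (M\<^sup>2 + 2 * M) * (D / S) + 3 * D\<^sup>2 + (1 / c + G / c) * D\<^sup>2 + 2 * G / c * (D - D') * s k"
      by simp
  qed
  also have "\<dots> = rho c M k * amp k x"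
  proof -
    define X Y where "X = D / (s k * S)" and "Y = D\<^sup>2 / s k"
    have e: "D / S = X * s k" "D\<^sup>2 = Y * s k" using s S by (simp_all add: X_def Y_def)
    have r: "rho c M k = (M\<^sup>2 + 2 * M) * X + (3 + 1 / c + G / c) * Y + 2 * G / c * (D - D')"
      by (simp add: rho_def X_def Y_def D_def D'_def S_def G_def)
    show ?thesis unfolding A r e by (simp add: algebra_simps)
  qed
  finally show ?thesis .
qed

text \<open>Both corrections are small relative to the amplitude: x u v by a factor 1 / s, and the
  last summand by a factor d because \<open>s_doubling\<close> absorbs the ratio of weights.\<close>

lemma turan_amp:
  assumes c: "0 < c" "c \<le> \<bar>x\<bar>" and M: "\<bar>x\<bar> \<le> M"
  shows "\<bar>turan k x - amp k x\<bar> \<le> (M / s k + 2 * d k / c) * amp k x"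
proof -
  let ?Q = "(u k x)\<^sup>2 + (v k x)\<^sup>2"
  have s: "0 < s k" "0 < s (Suc k)" using s_pos by auto
  have "turan k x - amp k x = (d k * s (Suc k) / x - x) * (u k x * v k x)"
    by (simp add: turan_def algebra_simps)
  also have "\<bar>\<dots>\<bar> \<le> (d k * (2 * s k) / c + M) * ?Q"
    unfolding abs_mult[of "_ - _"]
  proof (intro mult_mono abs_mult_le_sum_squares)
    have "\<bar>d k * s (Suc k) / x\<bar> \<le> d k * (2 * s k) / c"
      unfolding abs_divide abs_mult using c d_nonneg[of k] s s_doubling[of k]
      by (intro frac_le mult_mono) auto
    then show "\<bar>d k * s (Suc k) / x - x\<bar> \<le> d k * (2 * s k) / c + M" using M by linarith
    then show "0 \<le> d k * (2 * s k) / c + M" by linarith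
  qed auto
  also have "\<dots> = (M / s k + 2 * d k / c) * amp k x"
    using s c by (simp add: amp_def field_simps)
  finally show ?thesis .
qed

lemma continuous_on_amp: "continuous_on A (amp k)"
  unfolding amp_def by (intro continuous_intros u_cont v_cont)

text \<open>Increments of \<open>turan\<close> are relative errors \<open>rho\<close>, so its
  logarithms form a uniformly convergent series. Working with logarithms yields positivity of the
  limit together with convergence.\<close>

lemma ln_amp_uniform_limit:
  assumes c: "0 < c"
  shows "\<exists>L. uniform_limit {x. c \<le> \<bar>x\<bar> \<and> \<bar>x\<bar> \<le> M} (\<lambda>k x. ln (amp k x)) L sequentially"
proof -
  define A where "A = {x. c \<le> \<bar>x\<bar> \<and> \<bar>x\<bar> \<le> M}"
  define \<sigma> where "\<sigma> = (\<lambda>k. M / s k + 2 * d k / c)"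
  have "(\<lambda>k. 2 * d k / c) \<longlonglongrightarrow> 2 * 0 / c"
    using s_diff_tendsto unfolding d_def by (intro tendsto_intros) (use c in auto)
  moreover have "(\<lambda>k. M / s k) \<longlonglongrightarrow> 0"
    by (intro tendsto_divide_0[OF tendsto_const] filterlim_at_top_imp_at_infinity s_tendsto)
  ultimately have sig: "\<sigma> \<longlonglongrightarrow> 0" unfolding \<sigma>_def using tendsto_add by fastforce
  have rho0: "rho c M \<longlonglongrightarrow> 0" by (rule summable_LIMSEQ_zero[OF summable_rho])
  \<comment> \<open>With \<sigma> < 1/2 the determinant is at least half the amplitude, hence its
    increments are at most 2 \<open>rho\<close> times itself; \<open>rho\<close> < 1/4 then keeps
    this below the 1/2 of \<open>abs_ln_diff_le\<close>.\<close>
  obtain K where K: "\<And>k. k \<ge> K \<Longrightarrow> \<sigma> k < 1 / 2" "\<And>k. k \<ge> K \<Longrightarrow> rho c M k < 1 / 4"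
  proof -
    have "\<forall>\<^sub>F k in sequentially. \<sigma> k < 1 / 2 \<and> rho c M k < 1 / 4"
      by (intro eventually_conj order_tendstoD(2)[OF sig] order_tendstoD(2)[OF rho0]) auto
    then show thesis using that unfolding eventually_sequentially by blast
  qed
  have ln_ta: "\<bar>ln (turan k x) - ln (amp k x)\<bar> \<le> 2 * \<sigma> k" "0 < turan k x"
    if "k \<ge> K" "x \<in> A" for k x
    using abs_ln_diff_le[OF amp_pos turan_amp[OF c, of x M k]] K(1)[of k] that
    by (auto simp: A_def \<sigma>_def)
  have step: "\<bar>ln (turan (Suc k) x) - ln (turan k x)\<bar> \<le> 4 * rho c M k" if "k \<ge> K" "x \<in> A" for k x
  proof -
    have t: "\<bar>turan (Suc k) x - turan k x\<bar> \<le> rho c M k * amp k x"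
      by (rule turan_increment[OF c]) (use that in \<open>auto simp: A_def\<close>)
    then have r: "0 \<le> rho c M k" using amp_pos[of k x] by (smt (verit) zero_le_mult_iff)
    have "\<sigma> k * amp k x \<le> 1 / 2 * amp k x"
      using K(1)[OF that(1)] amp_pos[of k x] by (intro mult_right_mono) auto
    then have "amp k x \<le> 2 * turan k x"
      using turan_amp[OF c, of x M k] that(2) unfolding A_def \<sigma>_def mem_Collect_eq by linarith
    from mult_left_mono[OF this r] t have "\<bar>turan (Suc k) x - turan k x\<bar> \<le> (2 * rho c M k) * turan k x"
      by linarith
    from abs_ln_diff_le(1)[OF ln_ta(2)[OF that] this] K(2)[OF that(1)] show ?thesis by simp
  qed
  define f where "f = (\<lambda>n x. ln (turan (Suc (n + K)) x) - ln (turan (n + K) x))"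
  have "uniform_limit A (\<lambda>n x. \<Sum>i<n. f i x) (\<lambda>x. suminf (\<lambda>i. f i x)) sequentially"
    by (rule Weierstrass_m_test[where M = "\<lambda>n. 4 * rho c M (n + K)"])
       (use step in \<open>auto simp: f_def intro!: summable_mult summable_ignore_initial_segment
           summable_rho\<close>)
  moreover have "(\<Sum>i<n. f i x) = ln (turan (n + K) x) - ln (turan K x)" for n x
    by (induction n) (auto simp: f_def)
  ultimately have 1: "uniform_limit A (\<lambda>n x. ln (turan (n + K) x) - ln (turan K x)) (\<lambda>x. suminf (\<lambda>i.
      f i x)) sequentially"
    by simp
  have 2: "uniform_limit A (\<lambda>n x. ln (amp (n + K) x) - ln (turan (n + K) x)) (\<lambda>x. 0) sequentially"
  proof (rule uniform_limitI)
    fix e :: real assume "e > 0"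
    have "(\<lambda>n. \<sigma> (n + K)) \<longlonglongrightarrow> 0" by (rule LIMSEQ_ignore_initial_segment[OF sig])
    from order_tendstoD(2)[OF this, of "e / 2"] \<open>e > 0\<close>
    have "\<forall>\<^sub>F n in sequentially. \<sigma> (n + K) < e / 2" by simp
    then show "\<forall>\<^sub>F n in sequentially. \<forall>x\<in>A. dist (ln (amp (n + K) x) - ln (turan (n + K) x)) 0 < e"
    proof eventually_elim
      case (elim n)
      show ?case
      proof
        fix x assume "x \<in> A"
        then show "dist (ln (amp (n + K) x) - ln (turan (n + K) x)) 0 < e"
          using elim ln_ta(1)[of "n + K" x] by (simp add: dist_real_def abs_minus_commute)
      qed
    qed
  qed
  have "uniform_limit A (\<lambda>n x. (ln (turan (n + K) x) - ln (turan K x)) + (ln (amp (n + K) x) - ln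
      (turan (n + K) x)) + ln (turan K x))
     (\<lambda>x. suminf (\<lambda>i. f i x) + 0 + ln (turan K x)) sequentially"
    by (intro uniform_limit_add 1 2 uniform_limit_const)
  then have 3: "uniform_limit A (\<lambda>n x. ln (amp (n + K) x)) (\<lambda>x. suminf (\<lambda>i. f i x) + 0 + ln (turan K
      x)) sequentially"
    by simp
  have "uniform_limit A (\<lambda>k x. ln (amp k x)) (\<lambda>x. suminf (\<lambda>i. f i x) + 0 + ln (turan K x)) sequentially"
  proof (rule uniform_limitI)
    fix e :: real assume "e > 0"
    from uniform_limitD[OF 3 this]
    show "\<forall>\<^sub>F k in sequentially. \<forall>x\<in>A. dist (ln (amp k x)) (suminf (\<lambda>i. f i x) + 0 + ln (turan K x))
        < e"
      by (rule eventually_sequentially_seg[THEN iffD1])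
  qed
  then show ?thesis unfolding A_def by blast
qed

section \<open>The limit amplitude\<close>

text \<open>A pointwise \<open>lim\<close>, so that one function serves all c and M. Its value at 0
  carries no information.\<close>

definition log_amp where "log_amp x = lim (\<lambda>k. ln (amp k x))"

lemma ln_amp_limit:
  fixes c M :: real
  defines "A \<equiv> {x. c \<le> \<bar>x\<bar> \<and> \<bar>x\<bar> \<le> M}"
  assumes c: "0 < c"
  shows "uniform_limit A (\<lambda>k x. ln (amp k x)) log_amp sequentially"
    and "continuous_on A log_amp"
proof -
  obtain L where L: "uniform_limit A (\<lambda>k x. ln (amp k x)) L sequentially"
    using ln_amp_uniform_limit[OF c] unfolding A_def by blast
  have "log_amp x = L x" if "x \<in> A" for x
    using tendsto_uniform_limitI[OF L that] unfolding log_amp_def by (rule limI)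
  then show lim: "uniform_limit A (\<lambda>k x. ln (amp k x)) log_amp sequentially"
    using L by (subst uniform_limit_cong'[where g = "\<lambda>k x. ln (amp k x)" and i = L]) auto
  show "continuous_on A log_amp"
    by (rule uniform_limit_theorem[OF _ lim])
       (use amp_pos in \<open>auto intro!: always_eventually continuous_on_ln continuous_on_amp simp:
           less_imp_neq[THEN not_sym]\<close>)
qed

lemma amp_tendsto: "x \<noteq> 0 \<Longrightarrow> (\<lambda>k. amp k x) \<longlonglongrightarrow> exp (log_amp x)"
proof -
  assume "x \<noteq> 0"
  then have "(\<lambda>k. ln (amp k x)) \<longlonglongrightarrow> log_amp x"
    by (intro tendsto_uniform_limitI[OF ln_amp_limit(1)[of "\<bar>x\<bar>" "\<bar>x\<bar>"]]) auto
  from tendsto_exp[OF this] show ?thesis using amp_pos by simp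
qed

lemma continuous_on_log_amp: "continuous_on (- {0}) log_amp"
proof -
  have "isCont log_amp x" if "x \<noteq> 0" for x
  proof -
    let ?c = "\<bar>x\<bar> / 2" and ?M = "2 * \<bar>x\<bar>"
    have "x \<in> {y. ?c < \<bar>y\<bar> \<and> \<bar>y\<bar> < ?M}" using that by auto
    moreover have "open {y::real. ?c < \<bar>y\<bar> \<and> \<bar>y\<bar> < ?M}"
      by (intro open_Collect_conj open_Collect_less continuous_intros)
    moreover have "continuous_on {y. ?c < \<bar>y\<bar> \<and> \<bar>y\<bar> < ?M} log_amp"
      by (rule continuous_on_subset[OF ln_amp_limit(2)[of ?c ?M]]) (use that in auto)
    ultimately show ?thesis using continuous_on_eq_continuous_at by blast
  qed
  then show ?thesis by (simp add: continuous_at_imp_continuous_on)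
qed

text \<open>Supplies the dominating constant for the approximating densities on a compact set:
  \<open>log_amp\<close> is bounded there and eventually within distance 1 of the
  logarithms.\<close>

lemma amp_eventually_bounded_below:
  assumes c: "0 < c"
  shows "\<exists>\<delta>>0. \<forall>\<^sub>F k in sequentially. \<forall>x. c \<le> \<bar>x\<bar> \<and> \<bar>x\<bar> \<le> M \<longrightarrow> \<delta> \<le> amp k x"
proof -
  let ?A = "{x::real. c \<le> \<bar>x\<bar> \<and> \<bar>x\<bar> \<le> M}"
  have "closed ?A" by (intro closed_Collect_conj closed_Collect_le continuous_intros)
  moreover have "bounded ?A" by (rule boundedI[of _ M]) auto
  ultimately have "compact ?A" by (simp add: compact_eq_bounded_closed)
  then have "bounded (log_amp ` ?A)"
    by (intro compact_imp_bounded compact_continuous_image ln_amp_limit(2) c)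
  then obtain B where B: "\<And>x. x \<in> ?A \<Longrightarrow> \<bar>log_amp x\<bar> \<le> B" unfolding bounded_iff by auto
  have "\<forall>\<^sub>F k in sequentially. \<forall>x\<in>?A. dist (ln (amp k x)) (log_amp x) < 1"
    by (rule uniform_limitD[OF ln_amp_limit(1)[OF c]]) simp
  then have "\<forall>\<^sub>F k in sequentially. \<forall>x. c \<le> \<bar>x\<bar> \<and> \<bar>x\<bar> \<le> M \<longrightarrow> exp (- B - 1) \<le> amp k x"
  proof eventually_elim
    case (elim k)
    show ?case
    proof (intro allI impI)
      fix x assume "c \<le> \<bar>x\<bar> \<and> \<bar>x\<bar> \<le> M"
      then have "- B - 1 \<le> ln (amp k x)" using elim B[of x] by (force simp: dist_real_def)
      then show "exp (- B - 1) \<le> amp k x" using amp_pos[of k x] by (simp add: ln_ge_iff)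
    qed
  qed
  then show ?thesis by (intro exI[of _ "exp (- B - 1)"]) auto
qed

end

section \<open>The spectral density\<close>

text \<open>A bounded h with nonnegative boundary values of Im h is the Poisson extension of them;
  the decay of h along the imaginary axis controls the total mass.\<close>

lemma herglotz_measure:
  fixes h :: "complex \<Rightarrow> complex"
  assumes cont: "continuous_on {z. Im z \<ge> 0} h"
    and diff: "\<And>z. Im z > 0 \<Longrightarrow> h field_differentiable at z"
    and bound: "\<And>z. Im z \<ge> 0 \<Longrightarrow> cmod (h z) \<le> C"
    and nonneg: "\<And>t. 0 \<le> Im (h (of_real t))"
    and decay: "\<And>z. Im z > 0 \<Longrightarrow> cmod (h z) \<le> 1 / Im z"
  defines "\<nu> \<equiv> density lborel (\<lambda>t. ennreal (Im (h (of_real t)) / pi))"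
  shows "finite_measure \<nu>" "measure \<nu> UNIV \<le> 1"
    and "\<And>x y. y > 0 \<Longrightarrow> (\<integral> t. poisson y x t \<partial>\<nu>) = Im (h (Complex x y))"
proof -
  define g where "g = (\<lambda>t. Im (h (of_real t)) / pi)"
  have "continuous_on UNIV (\<lambda>t. h (complex_of_real t))"
    by (rule continuous_on_compose2[OF cont]) (auto intro!: continuous_intros)
  then have g_cont: "continuous_on UNIV g" unfolding g_def by (intro continuous_intros) auto
  have [measurable]: "g \<in> borel_measurable borel" by (rule borel_measurable_continuous_onI[OF g_cont])
  have g0: "0 \<le> g t" for t using nonneg by (simp add: g_def)
  have \<nu>: "\<nu> = density lborel (\<lambda>t. ennreal (g t))" by (simp add: \<nu>_def g_def)
  have rep: "(\<integral>\<^sup>+ t. ennreal (poisson y x t) \<partial>\<nu>) = ennreal (Im (h (Complex x y)))" if y: "y > 0" for x y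
  proof -
    have "(\<integral>\<^sup>+ t. ennreal (poisson y x t) \<partial>\<nu>) = (\<integral>\<^sup>+ t. ennreal (g t) * ennreal (poisson y x t)
        \<partial>lborel)"
      unfolding \<nu> by (intro nn_integral_density) auto
    also have "\<dots> = (\<integral>\<^sup>+ t. ennreal (1 / pi) * ennreal (poisson y x t * Im (h (of_real t))) \<partial>lborel)"
    proof (intro nn_integral_cong)
      fix t
      have "ennreal (g t) * ennreal (poisson y x t) = ennreal (g t * poisson y x t)"
        by (rule ennreal_mult[symmetric, OF g0 poisson_nonneg[OF y]])
      also have "g t * poisson y x t = 1 / pi * (poisson y x t * Im (h (of_real t)))" by (simp add:
          g_def)
      also have "ennreal \<dots> = ennreal (1 / pi) * ennreal (poisson y x t * Im (h (of_real t)))"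
        by (rule ennreal_mult') simp
      finally show "ennreal (g t) * ennreal (poisson y x t) = ennreal (1 / pi) * ennreal (poisson y
          x t * Im (h (of_real t)))" .
    qed
    also have "\<dots> = ennreal (1 / pi) * (\<integral>\<^sup>+ t. ennreal (poisson y x t * Im (h (of_real t))) \<partial>lborel)"
    proof (rule nn_integral_cmult)
      have "(\<lambda>t. ennreal (poisson y x t * (pi * g t))) \<in> borel_measurable lborel" by measurable
      then show "(\<lambda>t. ennreal (poisson y x t * Im (h (of_real t)))) \<in> borel_measurable lborel" by
          (simp add: g_def)
    qed
    also have "\<dots> = ennreal (Im (h (Complex x y)))"
    proof -
      have "(\<integral>\<^sup>+ t. ennreal (poisson y x t * Im (h (of_real t))) \<partial>lborel) = ennreal (pi * Im (h
          (Complex x y)))"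
        by (rule poisson_representation[OF cont diff bound nonneg y])
      then show ?thesis by (simp flip: ennreal_mult')
    qed
    finally show ?thesis .
  qed
  \<comment> \<open>\<open>ennreal\<close> sends negative numbers to 0, so reading off a real
    integral from \<open>rep\<close> requires the sign of Im h in the open half-plane as
    well.\<close>
  have Im_nonneg: "0 \<le> Im (h (Complex x y))" if y: "y > 0" for x y
  proof -
    have "((\<lambda>R. integral {-R..R} (\<lambda>t. poisson y x t * Im (h (of_real t)))) \<longlongrightarrow> pi * Im (h (Complex x
        y))) at_top"
      by (rule poisson_Im_tendsto[OF cont diff bound y])
    then have "0 \<le> pi * Im (h (Complex x y))"
      by (rule tendsto_lowerbound)
         (use nonneg poisson_nonneg[OF y] in \<open>auto intro!: always_eventually
             Henstock_Kurzweil_Integration.integral_nonneg mult_nonneg_nonneg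
            integrable_continuous_real continuous_intros y continuous_on_compose2[OF cont]\<close>)
    then show ?thesis unfolding zero_le_mult_iff using pi_gt_zero by linarith
  qed
  have mass: "emeasure \<nu> UNIV \<le> 1"
  proof -
    \<comment> \<open>For fixed t these kernels tend to 1, while n times Im h at height n is at most
      1 by \<open>decay\<close>; Fatou's lemma then bounds the mass. \<open>Suc n\<close> keeps the
      height positive.\<close>
    let ?P = "\<lambda>n t. ennreal (real (Suc n) * poisson (real (Suc n)) 0 t)"
    have "emeasure \<nu> UNIV = (\<integral>\<^sup>+ t. 1 \<partial>\<nu>)" by (simp add: \<nu>)
    also have "\<dots> = (\<integral>\<^sup>+ t. liminf (\<lambda>n. ?P n t) \<partial>\<nu>)"
    proof (intro nn_integral_cong)
      fix t
      have "(\<lambda>n. real (Suc n) * poisson (real (Suc n)) 0 t) \<longlonglongrightarrow> 1"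
        unfolding poisson_def by real_asymp
      then have "(\<lambda>n. ?P n t) \<longlonglongrightarrow> ennreal 1" by (rule tendsto_ennrealI)
      then show "1 = liminf (\<lambda>n. ?P n t)" using lim_imp_Liminf[of sequentially] by fastforce
    qed
    also have "\<dots> \<le> liminf (\<lambda>n. \<integral>\<^sup>+ t. ?P n t \<partial>\<nu>)"
      by (rule nn_integral_liminf) (simp add: \<nu>)
    also have "\<dots> \<le> liminf (\<lambda>n. 1)"
    proof (intro Liminf_mono always_eventually allI)
      fix n
      have "(\<integral>\<^sup>+ t. ?P n t \<partial>\<nu>) = ennreal (real (Suc n)) * (\<integral>\<^sup>+ t. ennreal (poisson (real (Suc n)) 0
          t) \<partial>\<nu>)"
        by (subst nn_integral_cmult[symmetric]) (auto simp: \<nu> poisson_nonneg ennreal_mult' simp del: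
            of_nat_Suc)
      also have "\<dots> = ennreal (real (Suc n) * Im (h (Complex 0 (real (Suc n)))))"
        by (subst rep) (auto simp: ennreal_mult' simp del: of_nat_Suc)
      also have "\<dots> \<le> ennreal 1"
      proof (rule ennreal_leI)
        have "Im (h (Complex 0 (real (Suc n)))) \<le> 1 / real (Suc n)"
          using decay[of "Complex 0 (real (Suc n))"] abs_Im_le_cmod[of "h (Complex 0 (real (Suc
              n)))"] by simp
        then show "real (Suc n) * Im (h (Complex 0 (real (Suc n)))) \<le> 1" by (simp add: field_simps)
      qed
      finally show "(\<integral>\<^sup>+ t. ?P n t \<partial>\<nu>) \<le> 1" by simp
    qed
    also have "\<dots> = 1" by (simp add: Liminf_const)
    finally show ?thesis .
  qed
  show fin: "finite_measure \<nu>"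
  proof (rule finite_measureI)
    show "emeasure \<nu> (space \<nu>) \<noteq> \<infinity>" using mass by (auto simp: \<nu> top_unique)
  qed
  show "measure \<nu> UNIV \<le> 1"
    using mass unfolding measure_def by (metis enn2real_leI ennreal_1 zero_le_one)
  show "(\<integral> t. poisson y x t \<partial>\<nu>) = Im (h (Complex x y))" if y: "y > 0" for x y
  proof (subst integral_eq_nn_integral)
    show "enn2real (\<integral>\<^sup>+ t. ennreal (poisson y x t) \<partial>\<nu>) = Im (h (Complex x y))"
      unfolding rep[OF y] using Im_nonneg[OF y] by simp
  qed (use poisson_nonneg[OF y] in \<open>auto simp: \<nu>\<close>)
qed

section \<open>Measures determined by Lipschitz functions\<close>

text \<open>The Lipschitz functions min 1 (n dist(t, - U)) increase to the indicator of U. The whole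
  line is excluded since \<open>infdist\<close> to the empty set is 0 by convention.\<close>

lemma emeasure_open_from_lipschitz:
  fixes \<mu> \<nu> :: "real measure"
  assumes "sets \<mu> = sets borel" "sets \<nu> = sets borel" and U: "open U" "U \<noteq> UNIV"
    and eq: "\<And>\<phi> L. (\<And>s t. \<bar>\<phi> s - \<phi> t\<bar> \<le> L * \<bar>s - t\<bar>) \<Longrightarrow> (\<And>t. 0 \<le> \<phi> t) \<Longrightarrow> (\<And>t. \<phi> t \<le> 1) \<Longrightarrow>
        (\<And>t. t \<notin> U \<Longrightarrow> \<phi> t = 0) \<Longrightarrow> (\<integral>\<^sup>+ t. ennreal (\<phi> t) \<partial>\<mu>) = (\<integral>\<^sup>+ t. ennreal (\<phi> t) \<partial>\<nu>)"
  shows "emeasure \<mu> U = emeasure \<nu> U"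
proof -
  define \<phi> where "\<phi> = (\<lambda>(n::nat) t. min 1 (real n * infdist t (- U)))"
  have lip: "\<bar>\<phi> n s - \<phi> n t\<bar> \<le> real n * \<bar>s - t\<bar>" for n s t
  proof -
    have "\<bar>infdist s (- U) - infdist t (- U)\<bar> \<le> \<bar>s - t\<bar>"
      using infdist_triangle_abs[of s "- U" t] by (simp add: dist_real_def)
    then have "\<bar>real n * infdist s (- U) - real n * infdist t (- U)\<bar> \<le> real n * \<bar>s - t\<bar>"
      by (simp add: abs_mult mult_left_mono flip: right_diff_distrib)
    then show ?thesis unfolding \<phi>_def by linarith
  qed
  have pos: "infdist t (- U) > 0" if "t \<in> U" for t
    using U that in_closed_iff_infdist_zero[of "- U" t] infdist_nonneg[of t "- U"] by force
  have \<phi>_meas: "\<phi> n \<in> borel_measurable borel" for n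
    unfolding \<phi>_def by (intro borel_measurable_continuous_onI continuous_intros)
  have ind: "(SUP n. ennreal (\<phi> n t)) = indicator U t" for t
  proof (cases "t \<in> U")
    case True
    obtain n :: nat where "1 / infdist t (- U) < real n" using reals_Archimedean2 by blast
    then have "\<phi> n t = 1" using pos[OF True] by (simp add: \<phi>_def field_simps)
    then have "1 \<le> (SUP n. ennreal (\<phi> n t))" by (intro SUP_upper2[of n]) auto
    moreover have "(SUP n. ennreal (\<phi> n t)) \<le> 1" by (intro SUP_least) (simp add: \<phi>_def)
    ultimately show ?thesis using True by simp
  next
    case False
    then show ?thesis by (simp add: \<phi>_def infdist_zero)
  qed
  have lim: "emeasure M U = (SUP n. \<integral>\<^sup>+ t. ennreal (\<phi> n t) \<partial>M)" if M: "sets M = sets borel" for M ::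
      "real measure"
  proof -
    have [measurable_cong]: "sets M = sets borel" by fact
    have [measurable]: "\<phi> n \<in> borel_measurable borel" for n by (rule \<phi>_meas)
    have "emeasure M U = (\<integral>\<^sup>+ t. indicator U t \<partial>M)"
      using U(1) by (simp add: M)
    also have "\<dots> = (\<integral>\<^sup>+ t. (SUP n. ennreal (\<phi> n t)) \<partial>M)" by (simp add: ind)
    also have "\<dots> = (SUP n. \<integral>\<^sup>+ t. ennreal (\<phi> n t) \<partial>M)"
    proof (rule nn_integral_monotone_convergence_SUP)
      show "incseq (\<lambda>n t. ennreal (\<phi> n t))"
        unfolding incseq_def le_fun_def \<phi>_def
        by (intro allI impI ennreal_leI min.mono order_refl mult_right_mono) (auto simp: infdist_nonneg)
    qed measurable
    finally show ?thesis .
  qed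
  have "(\<integral>\<^sup>+ t. ennreal (\<phi> n t) \<partial>\<mu>) = (\<integral>\<^sup>+ t. ennreal (\<phi> n t) \<partial>\<nu>)" for n
    by (rule eq[OF lip]) (auto simp: \<phi>_def infdist_nonneg infdist_zero)
  then show ?thesis by (simp add: lim assms(1,2))
qed

text \<open>Nothing bounds the second measure near 0. Both are therefore restricted to
  \<open>J n\<close>, where finiteness of \<mu> lets agreement on half-lines decide, and
  \<open>J n\<close> increases to the complement of 0.\<close>

lemma emeasure_eq_away_from_0:
  fixes \<mu> \<nu> :: "real measure"
  assumes mu: "finite_measure \<mu>" and sets: "sets \<mu> = sets borel" "sets \<nu> = sets borel"
    and eq: "\<And>U c M. open U \<Longrightarrow> 0 < c \<Longrightarrow> U \<subseteq> {x. c \<le> \<bar>x\<bar> \<and> \<bar>x\<bar> \<le> M} \<Longrightarrow> emeasure \<mu> U = emeasure \<nu> U"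
    and B: "B \<in> sets borel" "B \<subseteq> - {0}"
  shows "emeasure \<mu> B = emeasure \<nu> B"
proof -
  interpret finite_measure \<mu> by fact
  define J where "J = (\<lambda>n::nat. {x::real. 1 / real (Suc n) < \<bar>x\<bar> \<and> \<bar>x\<bar> < real (Suc n)})"
  have J_open: "open (J n)" for n
    unfolding J_def by (intro open_Collect_conj open_Collect_less continuous_intros)
  then have J: "J n \<in> sets borel" for n by (rule borel_open)
  have "emeasure \<mu> (B \<inter> J n) = emeasure \<nu> (B \<inter> J n)" for n
  proof -
    let ?d = "\<lambda>M. density M (indicator (J n))"
    have d: "emeasure (?d M) C = emeasure M (C \<inter> J n)" if "sets M = sets borel" "C \<in> sets borel" for M C
    proof -
      have "emeasure (?d M) C = (\<integral>\<^sup>+ t. indicator (J n) t * indicator C t \<partial>M)"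
        using that J by (intro emeasure_density) (auto simp: measurable_cong_sets[OF that(1) refl])
      also have "\<dots> = (\<integral>\<^sup>+ t. indicator (C \<inter> J n) t \<partial>M)"
        by (intro nn_integral_cong) (auto simp: indicator_def)
      also have "\<dots> = emeasure M (C \<inter> J n)" using that J by (simp add: that(1))
      finally show ?thesis .
    qed
    have "?d \<mu> = ?d \<nu>"
    proof (rule measure_eqI_lessThan)
      fix x :: real
      show "emeasure (?d \<mu>) {x<..} < \<infinity>" using d[OF sets(1)] by (simp add: less_top[symmetric])
      have "emeasure \<mu> ({x<..} \<inter> J n) = emeasure \<nu> ({x<..} \<inter> J n)"
        by (rule eq[where c = "1 / real (Suc n)" and M = "real (Suc n)", OF open_Int[OF
            open_greaterThan J_open]])
           (auto simp: J_def)
      then show "emeasure (?d \<mu>) {x<..} = emeasure (?d \<nu>) {x<..}" by (simp add: d sets)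
    qed (use sets in auto)
    then show ?thesis using d[OF sets(1) B(1)] d[OF sets(2) B(1)] by simp
  qed
  moreover have "emeasure M B = (SUP n. emeasure M (B \<inter> J n))" if "sets M = sets borel" for M
  proof -
    have "\<forall>t. t \<noteq> 0 \<longrightarrow> t \<in> (\<Union>n. J n)"
    proof (intro allI impI)
      fix t :: real assume "t \<noteq> 0"
      obtain n :: nat where n: "max \<bar>t\<bar> (1 / \<bar>t\<bar>) < real n" using reals_Archimedean2 by blast
      then have "1 / real (Suc n) < \<bar>t\<bar>" "\<bar>t\<bar> < real (Suc n)"
        using \<open>t \<noteq> 0\<close> by (auto simp: field_simps)
      then show "t \<in> (\<Union>n. J n)" unfolding J_def by blast
    qed
    then have "B \<subseteq> (\<Union>n. J n)" using B(2) by blast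
    then have Beq: "B = (\<Union>n. B \<inter> J n)" by blast
    have inc: "incseq (\<lambda>n. B \<inter> J n)"
    proof (rule incseq_SucI)
      fix n
      have "1 / real (Suc (Suc n)) \<le> 1 / real (Suc n)" by (intro divide_left_mono) auto
      then show "B \<inter> J n \<subseteq> B \<inter> J (Suc n)" unfolding J_def by auto
    qed
    have "range (\<lambda>n. B \<inter> J n) \<subseteq> sets M" using B(1) J that by auto
    from SUP_emeasure_incseq[OF this inc] Beq show ?thesis by metis
  qed
  ultimately show ?thesis using sets by simp
qed

section \<open>The weights with power growth\<close>

locale jacobi_pairs = jacobi_resolution b E
  for b :: "nat \<Rightarrow> real" and E +
  fixes \<alpha> :: real
  assumes alpha: "0 < \<alpha>" "\<alpha> < 1"
    and b_odd: "\<And>k. k \<ge> 1 \<Longrightarrow> b (2 * k - 1) = real k powr \<alpha>"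
    and b_even: "\<And>k. k \<ge> 1 \<Longrightarrow> b (2 * k) = real k powr \<alpha>"
begin

text \<open>Mean value theorem; the derivative is decreasing because \<alpha> - 1 < 0.\<close>

lemma powr_increment:
  assumes "0 < (t::real)"
  shows "\<alpha> * (t + 1) powr (\<alpha> - 1) \<le> (t + 1) powr \<alpha> - t powr \<alpha>"
    and "(t + 1) powr \<alpha> - t powr \<alpha> \<le> \<alpha> * t powr (\<alpha> - 1)"
proof -
  have "\<exists>z>t. z < t + 1 \<and> (t + 1) powr \<alpha> - t powr \<alpha> = (t + 1 - t) * (\<alpha> * z powr (\<alpha> - 1))"
    by (rule MVT2) (use assms in \<open>auto intro!: derivative_eq_intros\<close>)
  then obtain z where z: "t < z" "z < t + 1" "(t + 1) powr \<alpha> - t powr \<alpha> = \<alpha> * z powr (\<alpha> - 1)" by auto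
  show "\<alpha> * (t + 1) powr (\<alpha> - 1) \<le> (t + 1) powr \<alpha> - t powr \<alpha>"
    unfolding z(3) using z assms alpha by (intro mult_left_mono powr_mono2') auto
  show "(t + 1) powr \<alpha> - t powr \<alpha> \<le> \<alpha> * t powr (\<alpha> - 1)"
    unfolding z(3) using z assms alpha by (intro mult_left_mono powr_mono2') auto
qed

text \<open>The pairs are counted from 0, so s k is the common value of b at 2k + 1 and 2k + 2, and
  \<open>b 0\<close> lies outside every pair. With N = 2k + 2 the amplitude is b N times the sum of
  squares in \<open>Im_carmona_real\<close>.\<close>

definition s where "s k = real (Suc k) powr \<alpha>"
definition u where "u k x = p (x::real) (2 * k + 3)"
definition v where "v k x = p (x::real) (2 * k + 2)"

lemma b_s: "b (2 * k + 2) = s k" "b (2 * k + 1) = s k"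
  using b_odd[of "Suc k"] b_even[of "Suc k"] by (simp_all add: s_def)

text \<open>The upper bound at \<open>Suc k\<close> coincides with the lower bound at k; this is
  what proves concavity of s.\<close>

lemma s_incr: "0 \<le> s (Suc k) - s k" "s (Suc k) - s k \<le> \<alpha> * real (Suc k) powr (\<alpha> - 1)"
  "\<alpha> * real (Suc (Suc k)) powr (\<alpha> - 1) \<le> s (Suc k) - s k"
proof -
  show "s (Suc k) - s k \<le> \<alpha> * real (Suc k) powr (\<alpha> - 1)"
    using powr_increment(2)[of "real (Suc k)"] by (simp add: s_def add.commute)
  show *: "\<alpha> * real (Suc (Suc k)) powr (\<alpha> - 1) \<le> s (Suc k) - s k"
    using powr_increment(1)[of "real (Suc k)"] by (simp add: s_def add.commute)
  have "0 \<le> \<alpha> * real (Suc (Suc k)) powr (\<alpha> - 1)" using alpha by simp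
  with * show "0 \<le> s (Suc k) - s k" by linarith
qed

sublocale pairs: pair_recurrence s u v
proof
  fix k :: nat and x :: real and A :: "real set"
  show "1 \<le> s k" unfolding s_def using alpha by (intro ge_one_powr_ge_zero) auto
  show "s (Suc k) * v (Suc k) x = x * u k x - s k * v k x"
    using b_s(2)[of "Suc k"] b_s(1)[of k] b_pos[of "2 * k + 3"]
    by (simp add: u_def v_def eval_nat_numeral)
  show "s (Suc k) * u (Suc k) x = x * v (Suc k) x - s (Suc k) * u k x"
    using b_s(1)[of "Suc k"] b_s(2)[of "Suc k"] b_pos[of "2 * k + 4"]
    by (simp add: u_def v_def eval_nat_numeral)
  show "0 < (u k x)\<^sup>2 + (v k x)\<^sup>2"
    using carmona_denominator_pos[of x "2 * k + 2"] by (simp add: u_def v_def eval_nat_numeral)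
  show "continuous_on A (u k)" "continuous_on A (v k)"
    unfolding u_def v_def by (rule continuous_on_p)+
  show "s k \<le> s (Suc k)" using s_incr(1)[of k] by simp
  show "s (Suc k) \<le> 2 * s k"
  proof -
    have "s (Suc k) \<le> (2 * real (Suc k)) powr \<alpha>"
      unfolding s_def using alpha by (intro powr_mono2) auto
    also have "\<dots> = 2 powr \<alpha> * s k" unfolding s_def by (rule powr_mult; simp)
    also have "\<dots> \<le> 2 powr 1 * s k"
      using alpha by (intro mult_right_mono powr_mono) (auto simp: s_def)
    finally show ?thesis by simp
  qed
  show "s (Suc (Suc k)) - s (Suc k) \<le> s (Suc k) - s k"
    using s_incr(2)[of "Suc k"] s_incr(3)[of k] by linarith
  show "(\<lambda>k. s (Suc k) - s k) \<longlonglongrightarrow> 0"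
  proof (rule tendsto_sandwich[of "\<lambda>_. 0"])
    have "(\<lambda>k. real (Suc k) powr (\<alpha> - 1)) \<longlonglongrightarrow> 0"
      by (rule LIMSEQ_Suc) (use alpha in \<open>intro tendsto_neg_powr filterlim_real_sequentially; simp\<close>)
    from tendsto_mult_left[OF this, of \<alpha>]
    show "(\<lambda>k. \<alpha> * real (Suc k) powr (\<alpha> - 1)) \<longlonglongrightarrow> 0" by simp
  qed (use s_incr in auto)
  show "filterlim s at_top sequentially"
    unfolding s_def using alpha by real_asymp
  show "summable (\<lambda>k. (s (Suc k) - s k)\<^sup>2 / s k)"
  proof (rule summable_comparison_test')
    \<comment> \<open>The exponent is 2 (\<alpha> - 1) - \<alpha> = \<alpha> - 2, which is below -1
      because \<alpha> < 1.\<close>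
    have "summable (\<lambda>n. real n powr (\<alpha> - 2))" using alpha by (simp add: summable_real_powr_iff)
    then have "summable (\<lambda>n. real (Suc n) powr (\<alpha> - 2))" by (subst summable_Suc_iff)
    then show "summable (\<lambda>k. \<alpha>\<^sup>2 * real (Suc k) powr (\<alpha> - 2))" by (rule summable_mult)
    fix k
    have s: "0 < s k" by (simp add: s_def)
    have "(s (Suc k) - s k)\<^sup>2 / s k \<le> (\<alpha> * real (Suc k) powr (\<alpha> - 1))\<^sup>2 / s k"
      using s_incr[of k] s by (intro divide_right_mono power_mono) auto
    also have "\<dots> = \<alpha>\<^sup>2 * real (Suc k) powr (\<alpha> - 2)"
    proof -
      have "(real (Suc k) powr (\<alpha> - 1))\<^sup>2 / real (Suc k) powr \<alpha> = real (Suc k) powr (\<alpha> - 1 + (\<alpha> - 1)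
          - \<alpha>)"
        unfolding power2_eq_square powr_add powr_diff[of _ "\<alpha> - 1 + (\<alpha> - 1)"] ..
      then show ?thesis by (simp add: s_def power_mult_distrib times_divide_eq_right[symmetric] del:
          times_divide_eq_right)
    qed
    finally show "norm ((s (Suc k) - s k)\<^sup>2 / s k) \<le> \<alpha>\<^sup>2 * real (Suc k) powr (\<alpha> - 2)" using s by simp
  qed
qed

text \<open>For n >= 1 the weight is at most n powr \<alpha>, so comparison is with the divergent
  series of n powr (- \<alpha>). The arbitrary weight at 0 is skipped.\<close>

lemma not_summable_inverse_weights: "\<not> summable (\<lambda>n. 1 / b n)"
proof
  assume "summable (\<lambda>n. 1 / b n)"
  then have "summable (\<lambda>n. real n powr (- \<alpha>))"
  proof (rule summable_comparison_test'[where N = 1])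
    fix n :: nat assume n: "n \<ge> 1"
    have "b n \<le> real n powr \<alpha>"
    proof (cases "even n")
      case True
      then obtain k where k: "n = 2 * k" by blast
      then have "b n = real k powr \<alpha>" using n b_even[of k] by simp
      also have "\<dots> \<le> real n powr \<alpha>" using k alpha by (intro powr_mono2) auto
      finally show ?thesis .
    next
      case False
      then obtain k where k: "n = 2 * k + 1" using oddE by blast
      then have "b n = real (k + 1) powr \<alpha>" using b_odd[of "k + 1"] by simp
      also have "\<dots> \<le> real n powr \<alpha>" using k alpha by (intro powr_mono2) auto
      finally show ?thesis .
    qed
    then show "norm (real n powr (- \<alpha>)) \<le> 1 / b n"
      using b_pos[of n] n by (simp add: powr_minus field_simps)
  qed
  then show False using alpha by (simp add: summable_real_powr_iff)
qed

definition approx_measure :: "nat \<Rightarrow> real measure" where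
  "approx_measure k = density lborel (\<lambda>x. ennreal (1 / (pi * pairs.amp k x)))"

lemma approx_measure_carmona:
  "approx_measure k = density lborel (\<lambda>x. ennreal (Im (carmona_m (2 * k + 2) (of_real x)) / pi))"
proof -
  have "Im (carmona_m (2 * k + 2) (of_real x)) = 1 / pairs.amp k x" for x
    unfolding Im_carmona_real b_s pairs.amp_def by (simp add: u_def v_def eval_nat_numeral add.commute)
  then show ?thesis by (simp add: approx_measure_def mult.commute)
qed

lemma approx_measure_props:
  "finite_measure (approx_measure k)" "measure (approx_measure k) UNIV \<le> 1"
  "y > 0 \<Longrightarrow> (\<integral> t. poisson y x t \<partial>approx_measure k) = Im (carmona_m (2 * k + 2) (Complex x y))"
proof -
  obtain C where C: "\<And>z. Im z \<ge> 0 \<Longrightarrow> cmod (carmona_m (2 * k + 2) z) \<le> C"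
    using carmona_bounded[of "2 * k + 2"] by blast
  have nn: "0 \<le> Im (carmona_m (2 * k + 2) (of_real t))" for t
    unfolding Im_carmona_real using b_pos[of "2 * k + 2"] carmona_denominator_pos[of t "2 * k + 2"]
        by simp
  note H = herglotz_measure[OF continuous_on_carmona field_differentiable_carmona C nn
      carmona_bounds(1), folded approx_measure_carmona]
  show "finite_measure (approx_measure k)" by (rule H(1))
  show "measure (approx_measure k) UNIV \<le> 1" by (rule H(2))
  show "y > 0 \<Longrightarrow> (\<integral> t. poisson y x t \<partial>approx_measure k) = Im (carmona_m (2 * k + 2) (Complex x y))"
      by (rule H(3))
qed

text \<open>Both values parametrize Weyl solutions with the same l2 bound, and
  \<open>carleman\<close> makes the denominator in \<open>weyl_difference\<close> arbitrarily
  large.\<close>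

lemma carmona_tendsto_stieltjes:
  assumes z: "Im z > 0"
  shows "(\<lambda>k. carmona_m (2 * k + 2) z) \<longlonglongrightarrow> stieltjes z"
proof (rule LIMSEQ_I)
  fix e :: real assume e: "e > 0"
  \<comment> \<open>The summand 1 makes the inequality strict: times e^2 the threshold exceeds 4 /
    (Im z)^2 by e^2.\<close>
  obtain N0 where N0: "\<And>N. N \<ge> N0 \<Longrightarrow> 4 / (Im z)\<^sup>2 / e\<^sup>2 + 1 \<le> (\<Sum>n\<le>N. (cmod (p z n))\<^sup>2)"
    using carleman[OF z not_summable_inverse_weights] by blast
  have "cmod (carmona_m (2 * k + 2) z - stieltjes z) < e" if "k \<ge> N0" for k
  proof (rule ccontr)
    let ?d = "cmod (carmona_m (2 * k + 2) z - stieltjes z)" and ?P = "\<Sum>n\<le>2 * k + 2. (cmod (p z n))\<^sup>2"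
    assume "\<not> ?thesis"
    then have "e\<^sup>2 \<le> ?d\<^sup>2" using e by (intro power_mono) auto
    then have "e\<^sup>2 * (4 / (Im z)\<^sup>2 / e\<^sup>2 + 1) \<le> ?d\<^sup>2 * ?P"
      using N0[of "2 * k + 2"] that e by (intro mult_mono) (auto intro!: add_nonneg_nonneg)
    also have "\<dots> \<le> 4 / (Im z)\<^sup>2"
      by (rule weyl_difference[OF z carmona_bounds(2)[OF z] stieltjes_weyl_bound[OF z]])
    finally show False using e by (simp add: distrib_left)
  qed
  then show "\<exists>no. \<forall>k\<ge>no. norm (carmona_m (2 * k + 2) z - stieltjes z) < e" by blast
qed

text \<open>The limit of the approximating densities off 0. The exponential keeps it positive at 0
  too, where its value is a mere convention.\<close>

definition spectral_density :: "real \<Rightarrow> real" where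
  "spectral_density x = exp (- pairs.log_amp x) / pi"

lemma spectral_density_pos: "0 < spectral_density x"
  by (simp add: spectral_density_def)

lemma continuous_on_spectral_density: "continuous_on (- {0}) spectral_density"
  unfolding spectral_density_def by (intro continuous_intros pairs.continuous_on_log_amp) auto

lemma spectral_density_measurable [measurable]: "spectral_density \<in> borel_measurable borel"
  by (rule borel_measurable_continuous_countable_exceptions[of "{0}"])
     (auto intro: continuous_on_subset[OF continuous_on_spectral_density])

lemma approx_density_tendsto:
  "x \<noteq> 0 \<Longrightarrow> (\<lambda>k. 1 / (pi * pairs.amp k x)) \<longlonglongrightarrow> spectral_density x"
  unfolding spectral_density_def exp_minus
  using tendsto_divide[OF tendsto_const[of 1] tendsto_mult[OF tendsto_const[of pi]
      pairs.amp_tendsto[of x]]]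
  by (simp add: field_simps)

text \<open>The same sequence of integrals has two limits: weak convergence gives the integral
  against \<mu>, while locally uniform convergence of the densities on the support, away from 0,
  gives the integral against the limit density.\<close>

lemma integral_test_function:
  fixes \<phi> :: "real \<Rightarrow> real"
  assumes c: "0 < c" and supp: "\<And>t. \<not> (c \<le> \<bar>t\<bar> \<and> \<bar>t\<bar> \<le> M) \<Longrightarrow> \<phi> t = 0"
    and L: "\<And>s t. \<bar>\<phi> s - \<phi> t\<bar> \<le> L * \<bar>s - t\<bar>" and nonneg: "\<And>t. 0 \<le> \<phi> t" and le: "\<And>t. \<phi> t \<le> 1"
  shows "(\<integral>\<^sup>+ t. ennreal (\<phi> t) \<partial>\<mu>) = (\<integral>\<^sup>+ t. ennreal (\<phi> t) \<partial>density lborel (\<lambda>x. ennreal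
      (spectral_density x)))"
proof -
  interpret fm: finite_measure \<mu> by (rule finite_measure_spec) simp
  have [measurable]: "\<phi> \<in> borel_measurable borel" by (rule borel_measurable_lipschitz[OF L])
  have int_ind: "integrable lborel (\<lambda>t. C * indicator {-M..M} t)" for C :: real
    by (intro integrable_mult_right integrable_real_indicator) (auto simp: emeasure_lborel_Icc_eq)
  have \<phi>_ind: "\<phi> t \<le> indicator {-M..M} t" for t
    using le[of t] supp[of t] by (auto simp: indicator_def abs_le_iff)
  have int_\<phi>: "integrable lborel \<phi>"
    by (rule Bochner_Integration.integrable_bound[OF int_ind[of 1]]) (use \<phi>_ind nonneg in auto)
  obtain \<delta> where \<delta>: "\<delta> > 0"
    "\<forall>\<^sub>F k in sequentially. \<forall>x. c \<le> \<bar>x\<bar> \<and> \<bar>x\<bar> \<le> M \<longrightarrow> \<delta> \<le> pairs.amp k x"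
    using pairs.amp_eventually_bounded_below[OF c] by blast
  then obtain k0 where k0: "\<And>k x. k \<ge> k0 \<Longrightarrow> c \<le> \<bar>x\<bar> \<Longrightarrow> \<bar>x\<bar> \<le> M \<Longrightarrow> \<delta> \<le> pairs.amp k x"
    unfolding eventually_sequentially by blast
  have amp_meas [measurable]: "pairs.amp k \<in> borel_measurable borel" for k
    by (intro borel_measurable_continuous_onI pairs.continuous_on_amp)
  \<comment> \<open>The lower bound \<delta> on the amplitudes holds from k0 on only; hence the
    shift of all sequences by k0.\<close>
  have bound: "norm (\<phi> t * (1 / (pi * pairs.amp (k + k0) t))) \<le> 1 / (pi * \<delta>) * indicator {-M..M} t"
      for k t
  proof (cases "c \<le> \<bar>t\<bar> \<and> \<bar>t\<bar> \<le> M")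
    case True
    then have "\<delta> \<le> pairs.amp (k + k0) t" using k0[of "k + k0" t] by simp
    then have "1 / (pi * pairs.amp (k + k0) t) \<le> 1 / (pi * \<delta>)"
      using \<delta>(1) by (intro divide_left_mono mult_left_mono mult_pos_pos) auto
    then have "\<phi> t * (1 / (pi * pairs.amp (k + k0) t)) \<le> 1 * (1 / (pi * \<delta>))"
      using nonneg le[of t] pairs.amp_pos[of "k + k0" t] by (intro mult_mono) auto
    then show ?thesis
      using True nonneg[of t] pairs.amp_pos[of "k + k0" t] by (simp add: indicator_def abs_le_iff
          abs_mult)
  next
    case False
    then show ?thesis using supp[of t] \<delta>(1) by (simp add: indicator_def)
  qed
  have conv: "AE t in lborel. (\<lambda>k. \<phi> t * (1 / (pi * pairs.amp (k + k0) t))) \<longlonglongrightarrow> \<phi> t * spectral_density t"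
  proof (rule AE_I2)
    fix t
    show "(\<lambda>k. \<phi> t * (1 / (pi * pairs.amp (k + k0) t))) \<longlonglongrightarrow> \<phi> t * spectral_density t"
    proof (cases "t = 0")
      case True
      then show ?thesis using supp[of t] c by simp
    next
      case False
      then show ?thesis by (intro tendsto_mult_left LIMSEQ_ignore_initial_segment[OF
          approx_density_tendsto])
    qed
  qed
  have lim1: "(\<lambda>k. \<integral> t. \<phi> t * (1 / (pi * pairs.amp (k + k0) t)) \<partial>lborel) \<longlonglongrightarrow> (\<integral> t. \<phi> t *
      spectral_density t \<partial>lborel)"
    by (rule integral_dominated_convergence[OF _ _ int_ind[of "1 / (pi * \<delta>)"] conv]) (use bound in auto)
  have int_lim: "integrable lborel (\<lambda>t. \<phi> t * spectral_density t)"
    by (rule integrable_dominated_convergence[OF _ _ int_ind[of "1 / (pi * \<delta>)"] conv]) (use bound in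
        auto)
  have "(\<lambda>k. \<integral> t. \<phi> t \<partial>approx_measure k) \<longlonglongrightarrow> (\<integral> t. \<phi> t \<partial>\<mu>)"
  proof (rule weak_convergence_from_poisson[OF _ _ _ approx_measure_props(1) _
      approx_measure_props(2) _ L le nonneg int_\<phi>])
    show "finite_measure \<mu>" by (rule fm.finite_measure_axioms)
    show "measure \<mu> UNIV \<le> 1" by (simp add: measure_spec_UNIV)
    show "sets (approx_measure k) = sets borel" for k by (simp add: approx_measure_def)
    fix x y :: real assume y: "y > 0"
    have "(\<lambda>k. Im (carmona_m (2 * k + 2) (Complex x y))) \<longlonglongrightarrow> Im (stieltjes (Complex x y))"
      by (intro tendsto_Im carmona_tendsto_stieltjes) (simp add: y)
    then show "(\<lambda>k. \<integral> t. poisson y x t \<partial>approx_measure k) \<longlonglongrightarrow> (\<integral> t. poisson y x t \<partial>\<mu>)"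
      by (simp only: approx_measure_props(3)[OF y] Im_stieltjes[OF y] poisson_def[symmetric])
  qed simp
  then have "(\<lambda>k. \<integral> t. \<phi> t \<partial>approx_measure (k + k0)) \<longlonglongrightarrow> (\<integral> t. \<phi> t \<partial>\<mu>)"
    by (rule LIMSEQ_ignore_initial_segment)
  moreover have "(\<integral> t. \<phi> t \<partial>approx_measure k) = (\<integral> t. \<phi> t * (1 / (pi * pairs.amp k t)) \<partial>lborel)" for k
    unfolding approx_measure_def
    by (subst integral_density) (use pairs.amp_pos in \<open>auto intro!: less_imp_le simp: mult.commute\<close>)
  ultimately have eq: "(\<integral> t. \<phi> t \<partial>\<mu>) = (\<integral> t. \<phi> t * spectral_density t \<partial>lborel)"
    using lim1 LIMSEQ_unique by simp
  have "(\<integral>\<^sup>+ t. ennreal (\<phi> t) \<partial>\<mu>) = ennreal (\<integral> t. \<phi> t \<partial>\<mu>)"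
  proof (rule nn_integral_eq_integral)
    show "integrable \<mu> \<phi>"
      by (rule fm.integrable_const_bound[where B = 1]) (use nonneg le in auto)
  qed (use nonneg in auto)
  also have "\<dots> = (\<integral>\<^sup>+ t. ennreal (\<phi> t * spectral_density t) \<partial>lborel)"
    unfolding eq using mult_nonneg_nonneg[OF nonneg less_imp_le[OF spectral_density_pos]]
    by (intro nn_integral_eq_integral[symmetric] int_lim AE_I2)
  also have "\<dots> = (\<integral>\<^sup>+ t. ennreal (\<phi> t) \<partial>density lborel (\<lambda>x. ennreal (spectral_density x)))"
    by (subst nn_integral_density)
       (auto intro!: nn_integral_cong simp: ennreal_mult[OF nonneg less_imp_le[OF
           spectral_density_pos]] mult.commute)
  finally show ?thesis .
qed

lemma emeasure_spectral_density:
  assumes B: "B \<in> sets borel" "B \<subseteq> - {0}"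
  shows "emeasure \<mu> B = (\<integral>\<^sup>+ x\<in>B. ennreal (spectral_density x) \<partial>lborel)"
proof -
  let ?\<nu> = "density lborel (\<lambda>x. ennreal (spectral_density x))"
  have "emeasure \<mu> B = emeasure ?\<nu> B"
  proof (rule emeasure_eq_away_from_0[OF _ _ _ _ B])
    show "finite_measure \<mu>" by (rule finite_measure_spec) simp
    fix U :: "real set" and c M :: real
    assume U: "open U" and c: "0 < c" and sub: "U \<subseteq> {x. c \<le> \<bar>x\<bar> \<and> \<bar>x\<bar> \<le> M}"
    show "emeasure \<mu> U = emeasure ?\<nu> U"
    proof (rule emeasure_open_from_lipschitz[OF _ _ U])
      have "0 \<notin> U" using sub c by auto
      then show "U \<noteq> UNIV" by blast
      fix \<phi> :: "real \<Rightarrow> real" and L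
      assume \<phi>: "\<And>s t. \<bar>\<phi> s - \<phi> t\<bar> \<le> L * \<bar>s - t\<bar>" "\<And>t. 0 \<le> \<phi> t" "\<And>t. \<phi> t \<le> 1" "\<And>t. t \<notin> U \<Longrightarrow> \<phi> t = 0"
      have "\<phi> t = 0" if "\<not> (c \<le> \<bar>t\<bar> \<and> \<bar>t\<bar> \<le> M)" for t
        using that sub by (intro \<phi>(4)) blast
      then show "(\<integral>\<^sup>+ t. ennreal (\<phi> t) \<partial>\<mu>) = (\<integral>\<^sup>+ t. ennreal (\<phi> t) \<partial>?\<nu>)"
        by (rule integral_test_function[OF c _ \<phi>(1-3)])
    qed simp_all
  qed simp_all
  also have "\<dots> = (\<integral>\<^sup>+ x\<in>B. ennreal (spectral_density x) \<partial>lborel)"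
    using B by (subst emeasure_density) auto
  finally show ?thesis .
qed

end

theorem theorem2p2:
  fixes \<alpha> :: real and b :: "nat \<Rightarrow> real"
    and E :: "real set \<Rightarrow> (nat \<Rightarrow> complex) \<Rightarrow> (nat \<Rightarrow> complex)"
  assumes "0 < \<alpha>" and "\<alpha> < 1"
    and "0 < b 0"
    and "\<And>k. k \<ge> 1 \<Longrightarrow> b (2 * k - 1) = real k powr \<alpha>"
    and "\<And>k. k \<ge> 1 \<Longrightarrow> b (2 * k) = real k powr \<alpha>"
    and "is_spectral_resolution (jacobi_operator b) E"
  shows "\<exists>f :: real \<Rightarrow> real.
           continuous_on (- {0}) f \<and> (\<forall>x\<in>- {0}. 0 < f x) \<and>
           (\<forall>B\<in>sets borel. B \<subseteq> - {0} \<longrightarrow>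
              emeasure (spectral_measure E (basis_vec 0)) B = (\<integral>\<^sup>+ x\<in>B. ennreal (f x) \<partial>lborel))"
proof -
  have b_pos: "0 < b n" for n
  proof (cases "even n")
    case True
    then obtain k where k: "n = 2 * k" by blast
    then show ?thesis using assms(3) assms(5)[of k] by (cases "k = 0") auto
  next
    case False
    then obtain k where "n = 2 * k + 1" using oddE by blast
    then show ?thesis using assms(4)[of "k + 1"] by simp
  qed
  interpret jacobi_pairs b E \<alpha>
    by unfold_locales (use assms b_pos in auto)
  show ?thesis
    using continuous_on_spectral_density spectral_density_pos emeasure_spectral_density by blast
qed

end
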